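(* Suppose that $Y_\alpha=C^{1/2}(X_\alpha)\mathcal E_\alpha$ for all $\alpha\in\{1,\dots,n\}\cup\{01,\dots,0n\}$, where $\mathcal E_\alpha=(\varepsilon_{\alpha1},\dots,\varepsilon_{\alpha p})^\top$ is independent of $\mathcal F_{\mathcal X}$ and the $\varepsilon_{\alpha j}$ are i.i.d. in both $\alpha$ and $j$ with $\mathrm E(\varepsilon_{\alpha j})=0$, $\mathrm E(\varepsilon_{\alpha j}^2)=1$, $\mathrm E(\varepsilon_{\alpha j}^4)=\mu^{(4)}$, $\mathrm E|\varepsilon_{\alpha j}|^{4+\eta_1}<\infty$ for some $\eta_1>0$, and consider fitting the linear covariance regression model $C_\beta(X_i)=\sum_{k=1}^K\beta^{(k)}X_i^{(k)}$ with $\hat\beta=\hat\beta_{\rm WLS}=\{\sum_{i=1}^n\mathbf X_i^\top\mathbf W(X_i)\mathbf X_i\}^{-1}\sum_{i=1}^n\mathbf X_i^\top\mathbf W(X_i)\mathbf Y_i$. Then $$\mathcal V_{\rm ErrS}=\frac1n\mathrm E\,\mathrm{tr}\big\{(\widetilde{\mathbf X}^\top\widetilde{\mathbf X})^{-1}\widetilde{\mathbf X}^\top\widetilde{\mathbb V}(\mathbb X)\widetilde{\mathbf X}\big\}=\frac{\mathrm E\,U(\mathbb X)}2=\frac{\mathrm{OptS}}2,$$ $$\mathcal V_{\rm ErrR}=\frac1n\mathrm{tr}\Big[\mathrm E\big\{(\widetilde{\mathbf X}^\top\widetilde{\mathbf X})^{-1}\widetilde{\mathbf X}^\top\widetilde{\mathbb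 V}(\mathbb X)\widetilde{\mathbf X}(\widetilde{\mathbf X}^\top\widetilde{\mathbf X})^{-1}\big\}\,\mathrm E\big(\widetilde{\mathbf X}^\top\widetilde{\mathbf X}\big)\Big]=\mathrm E\,\mathrm{tr}\big\{(\widetilde{\mathbf X}^\top\widetilde{\mathbf X})^{-1}\widetilde{\mathbf X}^\top\widetilde{\mathbb V}(\mathbb X)\widetilde{\mathbf X}(\widetilde{\mathbf X}^\top\widetilde{\mathbf X})^{-1}\widetilde{\mathbf X}_{01}^\top\widetilde{\mathbf X}_{01}\big\},$$ and $\mathcal B^{(d)}=\mathcal B_{\rm ErrR}-\mathcal B_{\rm ErrS}\ge0$. Furthermore, if $\mathbf W(X_\alpha)=\mathbf V^-(X_\alpha)$ (Moore–Penrose inverse), then $\mathcal V^{(d)}=\mathcal V_{\rm ErrR}-\mathcal V_{\rm ErrS}\ge0$, and hence $\mathrm{ErrR}\ge\mathrm{ErrS}$.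
   Context: **Data.** Training data $(\mathbb X,\mathbb Y)=\{(X_i,Y_i):i=1,\dots,n\}$ and test data $\{(X_{0i},Y_{0i}):i=1,\dots,n\}$; $Y_\alpha\in\mathbb R^p$, $X_\alpha=(X_\alpha^{(1)},\dots,X_\alpha^{(K)})$ with each $X_\alpha^{(k)}$ a $p\times p$ matrix, $\alpha\in\{1,\dots,n\}\cup\{01,\dots,0n\}$. Let $\mathcal F_{\mathcal X}$ be the $\sigma$-algebra generated by all $X_\alpha$. The true model is $\mathrm{Cov}[Y_\alpha|\mathcal F_{\mathcal X}]=C(X_\alpha)$, with $C(\cdot)$ positive definite $p\times p$ valued; $C(\cdot)$ is not necessarily of the fitted linear form. **Data-generating assumption.** $Y_\alpha=C^{1/2}(X_\alpha)\mathcal E_\alpha$ for all $\alpha$, where $\mathcal E_\alpha=(\varepsilon_{\alpha1},\dots,\varepsilon_{\alpha p})^\top$ is independent of $\mathcal F_{\mathcal X}$ and the $\varepsilon_{\alpha j}$ are i.i.d. in both $\alpha$ and $j$ with $\mathrm E(\varepsilon_{\alpha j})=0$, $\mathrm E(\varepsilon_{\alpha j}^2)=1$, $\mathrm E(\varepsilon_{\alpha j}^4)=\mu^{(4)}$, $\mathrm E|\varepsilon_{\alpha j}|^{4+\eta_1}<\infty$ for some $\eta_1>0$. **Notation.** $\mathbf Y_\alpha=\mathrm{vec}(Y_\alpha Y_\alpha^\top)$; $\mathbf C(\cdot)=\mathrm{vec}\,C(\cdot)$; $\mathbf X_\alpha=(\mathrm{vec}(X_\alpha^{(1)}),\dots,\mathrm{vec}(X_\alpha^{(K)}))\in\mathbb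 R^{p^2\times K}$; $\mathbf W(\cdot)$ is a given positive semidefinite $p^2\times p^2$ weight matrix function; $\mathbf V(X_\alpha)=\mathrm{Cov}[\mathbf Y_\alpha|X_\alpha]$. $\widetilde{\mathbf X}_\alpha=\mathbf W^{1/2}(X_\alpha)\mathbf X_\alpha$, $\widetilde{\mathbf X}=(\widetilde{\mathbf X}_1^\top,\dots,\widetilde{\mathbf X}_n^\top)^\top\in\mathbb R^{np^2\times K}$. $\mathbb W(\mathbb X)=\mathrm{diag}\{\mathbf W(X_1),\dots,\mathbf W(X_n)\}$ and $\mathbb V(\mathbb X)=\mathrm{diag}\{\mathbf V(X_1),\dots,\mathbf V(X_n)\}$ are block-diagonal $np^2\times np^2$ matrices and $\widetilde{\mathbb V}(\mathbb X)=\mathbb W^{1/2}(\mathbb X)\mathbb V(\mathbb X)\mathbb W^{1/2}(\mathbb X)$. $U(\mathbb X)=\frac2n\mathrm{tr}\{(\widetilde{\mathbf X}^\top\widetilde{\mathbf X})^{-1}\widetilde{\mathbf X}^\top\widetilde{\mathbb V}(\mathbb X)\widetilde{\mathbf X}\}$. $\widetilde{\mathbf X}^\top\widetilde{\mathbf X}$ is a.s. invertible, and all expectations appearing are understood to exist and be finite. **Errors.** $\hat{\mathbf C}(\cdot)=\mathrm{vec}\,C_{\hat\beta}(\cdot)$, $\widetilde{\mathbf C}(X_\alpha)=\mathbf W^{1/2}(X_\alpha)\mathbf C(X_\alpha)$, $\hat{\widetilde{\mathbf C}}(X_\alpha)=\mathbf W^{1/2}(X_\alpha)\hat{\mathbf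 C}(X_\alpha)$, $L(\mathbf Y_\alpha,\hat{\mathbf C}(X_\alpha))=\{\mathbf Y_\alpha-\hat{\mathbf C}(X_\alpha)\}^\top\mathbf W(X_\alpha)\{\mathbf Y_\alpha-\hat{\mathbf C}(X_\alpha)\}$. Expected test error $\mathrm{Err}=\mathrm E\{\frac1n\sum_{i=1}^nL(\mathbf Y_{0i},\hat{\mathbf C}(X_{0i}))\}$, denoted $\mathrm{ErrR}$, $\mathrm{ErrS}$ under the settings below. $\mathrm{OptS}=\mathrm{ErrS}-\mathrm E\{\frac1n\sum_{i=1}^nL(\mathbf Y_i,\hat{\mathbf C}(X_i))\}$ under Same-$X$. **Settings.** *Random-$X$*: $(X_1,Y_1),\dots,(X_n,Y_n),(X_{01},Y_{01}),\dots,(X_{0n},Y_{0n})$ are i.i.d. from some joint distribution of $(X,Y)$. *Same-$X$*: $(X_1,Y_1),\dots,(X_n,Y_n)$ are i.i.d. from the same joint distribution, $X_{0i}=X_i$ for $i=1,\dots,n$, and the $Y_{0i}$ are independently distributed according to the conditional distribution of $Y_i|X_i$. **Bias and variance terms.** Under Random-$X$: $\mathcal B_{\rm ErrR}=\mathrm E\|\mathrm E[\hat{\widetilde{\mathbf C}}(X_{01})|\mathbb X,X_{01}]-\widetilde{\mathbf C}(X_{01})\|_2^2$ and $\mathcal V_{\rm ErrR}=\mathrm E\,\mathrm{tr}\{\mathrm{Cov}[\hat{\widetilde{\mathbf C}}(X_{01})|\mathbb X,X_{01}]\}$. Under Same-$X$: $\mathcal B_{\rm ErrS}=\mathrm E\|\mathrm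 E[\hat{\widetilde{\mathbf C}}(X_1)|\mathbb X]-\widetilde{\mathbf C}(X_1)\|_2^2$ and $\mathcal V_{\rm ErrS}=\mathrm E\,\mathrm{tr}\{\mathrm{Cov}[\hat{\widetilde{\mathbf C}}(X_1)|\mathbb X]\}$. *)

theory Defs
  imports "HOL-Probability.Probability"
begin

section \<open>Matrices\<close>

definition psd :: "real^'m^'m \<Rightarrow> bool" where
  "psd A \<longleftrightarrow> transpose A = A \<and> (\<forall>v. 0 \<le> v \<bullet> (A *v v))"

definition posdef :: "real^'m^'m \<Rightarrow> bool" where
  "posdef A \<longleftrightarrow> transpose A = A \<and> (\<forall>v. v \<noteq> 0 \<longrightarrow> 0 < v \<bullet> (A *v v))"

text \<open>The root exists and is unique when the argument is positive semidefinite; for other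
  arguments the value is unspecified. Likewise, the Moore--Penrose inverse always exists and is
  determined by the four Penrose equations.\<close>

definition sqrtm :: "real^'m^'m \<Rightarrow> real^'m^'m" where
  "sqrtm A = (THE B. psd B \<and> B ** B = A)"

definition pinv :: "real^'m^'m \<Rightarrow> real^'m^'m" where
  "pinv A = (THE B. A ** B ** A = A \<and> B ** A ** B = B \<and>
     transpose (A ** B) = A ** B \<and> transpose (B ** A) = B ** A)"

text \<open>Vectors of length $p^2$ are indexed by pairs instead of by $1,\dots,p^2$, and those of length
  $np^2$ by a sample index together with such a pair.\<close>

definition vecm :: "real^'p::finite^'p \<Rightarrow> real^('p \<times> 'p)" where
  "vecm A = (\<chi> a. A $ fst a $ snd a)"

definition vec_outer :: "real^'p::finite \<Rightarrow> real^('p \<times> 'p)" where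
  "vec_outer y = vecm (\<chi> i j. y $ i * y $ j)"

definition blockdiag :: "('n::finite \<Rightarrow> real^'m::finite^'m) \<Rightarrow> real^('n \<times> 'm)^('n \<times> 'm)" where
  "blockdiag A = (\<chi> r c. if fst r = fst c then A (fst r) $ snd r $ snd c else 0)"


section \<open>Conditional moments of random vectors\<close>

definition gen_sigma :: "'w measure \<Rightarrow> ('w \<Rightarrow> 'a::topological_space) \<Rightarrow> 'w measure" where
  "gen_sigma M Z = vimage_algebra (space M) Z borel"

definition cond_mean :: "'w measure \<Rightarrow> 'w measure \<Rightarrow> ('w \<Rightarrow> real^'m) \<Rightarrow> 'w \<Rightarrow> real^'m" where
  "cond_mean M F Z \<omega> = (\<chi> a. real_cond_exp M F (\<lambda>\<omega>'. Z \<omega>' $ a) \<omega>)"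

definition cond_cov :: "'w measure \<Rightarrow> 'w measure \<Rightarrow> ('w \<Rightarrow> real^'m) \<Rightarrow> 'w \<Rightarrow> real^'m^'m" where
  "cond_cov M F Z \<omega> = (\<chi> a b. real_cond_exp M F
     (\<lambda>\<omega>'. (Z \<omega>' $ a - cond_mean M F Z \<omega>' $ a) * (Z \<omega>' $ b - cond_mean M F Z \<omega>' $ b)) \<omega>)"

definition iid :: "'w measure \<Rightarrow> ('i \<Rightarrow> 'w \<Rightarrow> 'a::topological_space) \<Rightarrow> 'i set \<Rightarrow> bool" where
  "iid M Z I \<longleftrightarrow> prob_space.indep_vars M (\<lambda>_. borel) Z I \<and>
     (\<forall>i\<in>I. \<forall>j\<in>I. distr M borel (Z i) = distr M borel (Z j))"


section \<open>Samples\<close>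

text \<open>The type \<open>'n\<close> indexes $1,\dots,n$, so that $n$ is its cardinality. The full index set
  $\{1,\dots,n\}\cup\{01,\dots,0n\}$ is \<open>'n + 'n\<close>: \<open>Inl i\<close> is the training index $i$ and
  \<open>Inr i\<close> is the test index $0i$. A covariate \<open>x\<close> has the matrices \<open>x $ k\<close>.\<close>

type_synonym ('k, 'p) covariate = "real^'p^'p^'k"

definition train :: "('n + 'n \<Rightarrow> 'w \<Rightarrow> 'a) \<Rightarrow> 'w \<Rightarrow> 'a^'n" where
  "train Z \<omega> = (\<chi> i. Z (Inl i) \<omega>)"

text \<open>Independence of the errors from $\mathcal F_{\mathcal X}$ is required of the whole error array
  jointly, as is implicit in the settings below. That
  $\mathrm{Cov}[Y_\alpha|\mathcal F_{\mathcal X}]=C(X_\alpha)$ is a consequence of the model.\<close>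

definition data_model ::
  "'w measure \<Rightarrow> (('k::finite, 'p::finite) covariate \<Rightarrow> real^'p^'p) \<Rightarrow> real \<Rightarrow>
   ('n::finite + 'n \<Rightarrow> 'w \<Rightarrow> ('k, 'p) covariate) \<Rightarrow> ('n + 'n \<Rightarrow> 'w \<Rightarrow> real^'p) \<Rightarrow>
   ('n + 'n \<Rightarrow> 'w \<Rightarrow> real^'p) \<Rightarrow> bool" where
  "data_model M C \<mu>4 X Y \<E> \<longleftrightarrow>
     prob_space M \<and>
     (\<forall>\<alpha>. X \<alpha> \<in> borel_measurable M) \<and>
     (\<forall>\<alpha>. \<forall>\<omega>\<in>space M. Y \<alpha> \<omega> = sqrtm (C (X \<alpha> \<omega>)) *v \<E> \<alpha> \<omega>) \<and>
     prob_space.indep_set M (sets (gen_sigma M (\<lambda>\<omega>. \<chi> \<alpha>. \<E> \<alpha> \<omega>)))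
       (sets (gen_sigma M (\<lambda>\<omega>. \<chi> \<alpha>. X \<alpha> \<omega>))) \<and>
     iid M (\<lambda>(\<alpha>, j) \<omega>. \<E> \<alpha> \<omega> $ j) UNIV \<and>
     (\<forall>\<alpha> j. (\<integral>\<omega>. \<E> \<alpha> \<omega> $ j \<partial>M) = 0 \<and>
            (\<integral>\<omega>. (\<E> \<alpha> \<omega> $ j)^2 \<partial>M) = 1 \<and>
            (\<integral>\<omega>. (\<E> \<alpha> \<omega> $ j)^4 \<partial>M) = \<mu>4) \<and>
     (\<exists>\<eta>>0. \<forall>\<alpha> j. integrable M (\<lambda>\<omega>. \<bar>\<E> \<alpha> \<omega> $ j\<bar> powr (4 + \<eta>)))"

definition random_X ::
  "'w measure \<Rightarrow> ('n::finite + 'n \<Rightarrow> 'w \<Rightarrow> ('k::finite, 'p::finite) covariate) \<Rightarrow>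
   ('n + 'n \<Rightarrow> 'w \<Rightarrow> real^'p) \<Rightarrow> bool" where
  "random_X M X Y \<longleftrightarrow> iid M (\<lambda>\<alpha> \<omega>. (X \<alpha> \<omega>, Y \<alpha> \<omega>)) UNIV"

text \<open>The last clause says that, given the training data, the test responses are independent and
  the $i$-th of them has the conditional distribution of $Y_i$ given $X_i$.\<close>

definition same_X ::
  "'w measure \<Rightarrow> ('n::finite + 'n \<Rightarrow> 'w \<Rightarrow> ('k::finite, 'p::finite) covariate) \<Rightarrow>
   ('n + 'n \<Rightarrow> 'w \<Rightarrow> real^'p) \<Rightarrow> bool" where
  "same_X M X Y \<longleftrightarrow>
     iid M (\<lambda>i \<omega>. (X (Inl i) \<omega>, Y (Inl i) \<omega>)) UNIV \<and>
     (\<forall>i. \<forall>\<omega>\<in>space M. X (Inr i) \<omega> = X (Inl i) \<omega>) \<and>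
     (\<forall>i. Y (Inr i) \<in> borel_measurable M) \<and>
     (\<forall>B. (\<forall>i. B i \<in> sets borel) \<longrightarrow>
       (AE \<omega> in M.
          real_cond_exp M (gen_sigma M (\<lambda>\<omega>'. (train X \<omega>', train Y \<omega>')))
            (indicator {\<omega>' \<in> space M. \<forall>i. Y (Inr i) \<omega>' \<in> B i}) \<omega> =
          (\<Prod>i\<in>UNIV. real_cond_exp M (gen_sigma M (X (Inl i)))
            (indicator {\<omega>' \<in> space M. Y (Inl i) \<omega>' \<in> B i}) \<omega>)))"


section \<open>Weighted least squares\<close>

type_synonym ('k, 'p) weight = "('k, 'p) covariate \<Rightarrow> real^('p \<times> 'p)^('p \<times> 'p)"

definition design :: "('k::finite, 'p::finite) covariate \<Rightarrow> real^'k^('p \<times> 'p)" where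
  "design x = (\<chi> a k. vecm (x $ k) $ a)"

definition lin_cov :: "real^'k \<Rightarrow> ('k::finite, 'p::finite) covariate \<Rightarrow> real^'p^'p" where
  "lin_cov \<beta> x = (\<Sum>k\<in>UNIV. (\<beta> $ k) *\<^sub>R (x $ k))"

definition wls ::
  "('k::finite, 'p::finite) weight \<Rightarrow> ('k, 'p) covariate^'n::finite \<Rightarrow> (real^'p)^'n \<Rightarrow> real^'k"
  where
  "wls W xs ys =
     matrix_inv (\<Sum>i\<in>UNIV. transpose (design (xs $ i)) ** W (xs $ i) ** design (xs $ i)) *v
     (\<Sum>i\<in>UNIV. (transpose (design (xs $ i)) ** W (xs $ i)) *v vec_outer (ys $ i))"

definition C_hat ::
  "('k::finite, 'p::finite) weight \<Rightarrow> ('k, 'p) covariate^'n::finite \<Rightarrow> (real^'p)^'n \<Rightarrow>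
   ('k, 'p) covariate \<Rightarrow> real^('p \<times> 'p)" where
  "C_hat W xs ys x = vecm (lin_cov (wls W xs ys) x)"

definition X_tilde ::
  "('k::finite, 'p::finite) weight \<Rightarrow> ('k, 'p) covariate \<Rightarrow> real^'k^('p \<times> 'p)" where
  "X_tilde W x = sqrtm (W x) ** design x"

definition XX_tilde ::
  "('k::finite, 'p::finite) weight \<Rightarrow> ('k, 'p) covariate^'n::finite \<Rightarrow> real^'k^('n \<times> 'p \<times> 'p)"
  where
  "XX_tilde W xs = (\<chi> r k. X_tilde W (xs $ fst r) $ snd r $ k)"

definition gram ::
  "('k::finite, 'p::finite) weight \<Rightarrow> ('k, 'p) covariate^'n::finite \<Rightarrow> real^'k^'k" where
  "gram W xs = transpose (XX_tilde W xs) ** XX_tilde W xs"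

definition WW ::
  "('k::finite, 'p::finite) weight \<Rightarrow> ('k, 'p) covariate^'n::finite \<Rightarrow>
   real^('n \<times> 'p \<times> 'p)^('n \<times> 'p \<times> 'p)" where
  "WW W xs = blockdiag (\<lambda>i. W (xs $ i))"

definition V_cov ::
  "'w measure \<Rightarrow> ('n::finite + 'n \<Rightarrow> 'w \<Rightarrow> ('k::finite, 'p::finite) covariate) \<Rightarrow>
   ('n + 'n \<Rightarrow> 'w \<Rightarrow> real^'p) \<Rightarrow> 'n + 'n \<Rightarrow> 'w \<Rightarrow> real^('p \<times> 'p)^('p \<times> 'p)" where
  "V_cov M X Y \<alpha> = cond_cov M (gen_sigma M (X \<alpha>)) (\<lambda>\<omega>. vec_outer (Y \<alpha> \<omega>))"

definition VV ::
  "'w measure \<Rightarrow> ('n::finite + 'n \<Rightarrow> 'w \<Rightarrow> ('k::finite, 'p::finite) covariate) \<Rightarrow>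
   ('n + 'n \<Rightarrow> 'w \<Rightarrow> real^'p) \<Rightarrow> 'w \<Rightarrow> real^('n \<times> 'p \<times> 'p)^('n \<times> 'p \<times> 'p)" where
  "VV M X Y \<omega> = blockdiag (\<lambda>i. V_cov M X Y (Inl i) \<omega>)"

definition VV_tilde ::
  "'w measure \<Rightarrow> ('k::finite, 'p::finite) weight \<Rightarrow>
   ('n::finite + 'n \<Rightarrow> 'w \<Rightarrow> ('k, 'p) covariate) \<Rightarrow>
   ('n + 'n \<Rightarrow> 'w \<Rightarrow> real^'p) \<Rightarrow> 'w \<Rightarrow> real^('n \<times> 'p \<times> 'p)^('n \<times> 'p \<times> 'p)" where
  "VV_tilde M W X Y \<omega> =
     sqrtm (WW W (train X \<omega>)) ** VV M X Y \<omega> ** sqrtm (WW W (train X \<omega>))"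

definition hat_cov ::
  "'w measure \<Rightarrow> ('k::finite, 'p::finite) weight \<Rightarrow>
   ('n::finite + 'n \<Rightarrow> 'w \<Rightarrow> ('k, 'p) covariate) \<Rightarrow>
   ('n + 'n \<Rightarrow> 'w \<Rightarrow> real^'p) \<Rightarrow> 'w \<Rightarrow> real^'k^'k" where
  "hat_cov M W X Y \<omega> =
     matrix_inv (gram W (train X \<omega>)) ** transpose (XX_tilde W (train X \<omega>)) **
     VV_tilde M W X Y \<omega> ** XX_tilde W (train X \<omega>)"

definition U_stat ::
  "'w measure \<Rightarrow> ('k::finite, 'p::finite) weight \<Rightarrow>
   ('n::finite + 'n \<Rightarrow> 'w \<Rightarrow> ('k, 'p) covariate) \<Rightarrow>
   ('n + 'n \<Rightarrow> 'w \<Rightarrow> real^'p) \<Rightarrow> 'w \<Rightarrow> real" where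
  "U_stat M W X Y \<omega> = 2 / real CARD('n) * trace (hat_cov M W X Y \<omega>)"

definition sandwich ::
  "'w measure \<Rightarrow> ('k::finite, 'p::finite) weight \<Rightarrow>
   ('n::finite + 'n \<Rightarrow> 'w \<Rightarrow> ('k, 'p) covariate) \<Rightarrow>
   ('n + 'n \<Rightarrow> 'w \<Rightarrow> real^'p) \<Rightarrow> 'w \<Rightarrow> real^'k^'k" where
  "sandwich M W X Y \<omega> = hat_cov M W X Y \<omega> ** matrix_inv (gram W (train X \<omega>))"

definition sandwich_test ::
  "'w measure \<Rightarrow> ('k::finite, 'p::finite) weight \<Rightarrow>
   ('n::finite + 'n \<Rightarrow> 'w \<Rightarrow> ('k, 'p) covariate) \<Rightarrow>
   ('n + 'n \<Rightarrow> 'w \<Rightarrow> real^'p) \<Rightarrow> 'n \<Rightarrow> 'w \<Rightarrow> real^'k^'k" where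
  "sandwich_test M W X Y i \<omega> = sandwich M W X Y \<omega> **
     transpose (X_tilde W (X (Inr i) \<omega>)) ** X_tilde W (X (Inr i) \<omega>)"


section \<open>Prediction errors\<close>

definition loss :: "real^'m^'m \<Rightarrow> real^'m \<Rightarrow> real^'m \<Rightarrow> real" where
  "loss w y c = (y - c) \<bullet> (w *v (y - c))"

definition pred_loss ::
  "('k::finite, 'p::finite) weight \<Rightarrow> ('n::finite + 'n \<Rightarrow> 'w \<Rightarrow> ('k, 'p) covariate) \<Rightarrow>
   ('n + 'n \<Rightarrow> 'w \<Rightarrow> real^'p) \<Rightarrow> 'n + 'n \<Rightarrow> 'w \<Rightarrow> real" where
  "pred_loss W X Y \<alpha> \<omega> = loss (W (X \<alpha> \<omega>)) (vec_outer (Y \<alpha> \<omega>))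
     (C_hat W (train X \<omega>) (train Y \<omega>) (X \<alpha> \<omega>))"

definition test_loss ::
  "('k::finite, 'p::finite) weight \<Rightarrow> ('n::finite + 'n \<Rightarrow> 'w \<Rightarrow> ('k, 'p) covariate) \<Rightarrow>
   ('n + 'n \<Rightarrow> 'w \<Rightarrow> real^'p) \<Rightarrow> 'w \<Rightarrow> real" where
  "test_loss W X Y \<omega> = 1 / real CARD('n) * (\<Sum>i\<in>UNIV. pred_loss W X Y (Inr i) \<omega>)"

definition train_loss ::
  "('k::finite, 'p::finite) weight \<Rightarrow> ('n::finite + 'n \<Rightarrow> 'w \<Rightarrow> ('k, 'p) covariate) \<Rightarrow>
   ('n + 'n \<Rightarrow> 'w \<Rightarrow> real^'p) \<Rightarrow> 'w \<Rightarrow> real" where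
  "train_loss W X Y \<omega> = 1 / real CARD('n) * (\<Sum>i\<in>UNIV. pred_loss W X Y (Inl i) \<omega>)"

text \<open>This is ErrR or ErrS according to the setting in which the data live.\<close>

definition Err ::
  "'w measure \<Rightarrow> ('k::finite, 'p::finite) weight \<Rightarrow>
   ('n::finite + 'n \<Rightarrow> 'w \<Rightarrow> ('k, 'p) covariate) \<Rightarrow>
   ('n + 'n \<Rightarrow> 'w \<Rightarrow> real^'p) \<Rightarrow> real" where
  "Err M W X Y = (\<integral>\<omega>. test_loss W X Y \<omega> \<partial>M)"

definition OptS ::
  "'w measure \<Rightarrow> ('k::finite, 'p::finite) weight \<Rightarrow>
   ('n::finite + 'n \<Rightarrow> 'w \<Rightarrow> ('k, 'p) covariate) \<Rightarrow>
   ('n + 'n \<Rightarrow> 'w \<Rightarrow> real^'p) \<Rightarrow> real" where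
  "OptS M W X Y = Err M W X Y - (\<integral>\<omega>. train_loss W X Y \<omega> \<partial>M)"


section \<open>Bias and variance terms\<close>

definition C_tilde ::
  "(('k::finite, 'p::finite) covariate \<Rightarrow> real^'p^'p) \<Rightarrow> ('k, 'p) weight \<Rightarrow>
   ('k, 'p) covariate \<Rightarrow> real^('p \<times> 'p)" where
  "C_tilde C W x = sqrtm (W x) *v vecm (C x)"

definition C_hat_tilde ::
  "('k::finite, 'p::finite) weight \<Rightarrow> ('n::finite + 'n \<Rightarrow> 'w \<Rightarrow> ('k, 'p) covariate) \<Rightarrow>
   ('n + 'n \<Rightarrow> 'w \<Rightarrow> real^'p) \<Rightarrow> 'n + 'n \<Rightarrow> 'w \<Rightarrow> real^('p \<times> 'p)" where
  "C_hat_tilde W X Y \<alpha> \<omega> =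
     sqrtm (W (X \<alpha> \<omega>)) *v C_hat W (train X \<omega>) (train Y \<omega>) (X \<alpha> \<omega>)"

text \<open>Both settings share the following conditional squared bias and conditional total variance of
  the fit at the index \<open>\<alpha>\<close>, given \<open>F\<close>; they differ in \<open>F\<close> and \<open>\<alpha>\<close> only.\<close>

definition sq_bias ::
  "'w measure \<Rightarrow> 'w measure \<Rightarrow> (('k::finite, 'p::finite) covariate \<Rightarrow> real^'p^'p) \<Rightarrow>
   ('k, 'p) weight \<Rightarrow> ('n::finite + 'n \<Rightarrow> 'w \<Rightarrow> ('k, 'p) covariate) \<Rightarrow>
   ('n + 'n \<Rightarrow> 'w \<Rightarrow> real^'p) \<Rightarrow> 'n + 'n \<Rightarrow> 'w \<Rightarrow> real" where
  "sq_bias M F C W X Y \<alpha> \<omega> =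
     (norm (cond_mean M F (C_hat_tilde W X Y \<alpha>) \<omega> - C_tilde C W (X \<alpha> \<omega>)))^2"

definition tr_var ::
  "'w measure \<Rightarrow> 'w measure \<Rightarrow> ('k::finite, 'p::finite) weight \<Rightarrow>
   ('n::finite + 'n \<Rightarrow> 'w \<Rightarrow> ('k, 'p) covariate) \<Rightarrow>
   ('n + 'n \<Rightarrow> 'w \<Rightarrow> real^'p) \<Rightarrow> 'n + 'n \<Rightarrow> 'w \<Rightarrow> real" where
  "tr_var M F W X Y \<alpha> \<omega> = trace (cond_cov M F (C_hat_tilde W X Y \<alpha>) \<omega>)"

definition sigmaR ::
  "'w measure \<Rightarrow> ('n::finite + 'n \<Rightarrow> 'w \<Rightarrow> ('k::finite, 'p::finite) covariate) \<Rightarrow> 'n \<Rightarrow> 'w measure"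
  where
  "sigmaR M X i = gen_sigma M (\<lambda>\<omega>. (train X \<omega>, X (Inr i) \<omega>))"

definition sigmaS ::
  "'w measure \<Rightarrow> ('n::finite + 'n \<Rightarrow> 'w \<Rightarrow> ('k::finite, 'p::finite) covariate) \<Rightarrow> 'w measure"
  where
  "sigmaS M X = gen_sigma M (train X)"

text \<open>In the next four definitions \<open>i\<close> plays the role of the index 1.\<close>

definition B_ErrR ::
  "'w measure \<Rightarrow> (('k::finite, 'p::finite) covariate \<Rightarrow> real^'p^'p) \<Rightarrow>
   ('k, 'p) weight \<Rightarrow> ('n::finite + 'n \<Rightarrow> 'w \<Rightarrow> ('k, 'p) covariate) \<Rightarrow>
   ('n + 'n \<Rightarrow> 'w \<Rightarrow> real^'p) \<Rightarrow> 'n \<Rightarrow> real" where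
  "B_ErrR M C W X Y i = (\<integral>\<omega>. sq_bias M (sigmaR M X i) C W X Y (Inr i) \<omega> \<partial>M)"

definition V_ErrR ::
  "'w measure \<Rightarrow> ('k::finite, 'p::finite) weight \<Rightarrow>
   ('n::finite + 'n \<Rightarrow> 'w \<Rightarrow> ('k, 'p) covariate) \<Rightarrow>
   ('n + 'n \<Rightarrow> 'w \<Rightarrow> real^'p) \<Rightarrow> 'n \<Rightarrow> real" where
  "V_ErrR M W X Y i = (\<integral>\<omega>. tr_var M (sigmaR M X i) W X Y (Inr i) \<omega> \<partial>M)"

definition B_ErrS ::
  "'w measure \<Rightarrow> (('k::finite, 'p::finite) covariate \<Rightarrow> real^'p^'p) \<Rightarrow>
   ('k, 'p) weight \<Rightarrow> ('n::finite + 'n \<Rightarrow> 'w \<Rightarrow> ('k, 'p) covariate) \<Rightarrow>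
   ('n + 'n \<Rightarrow> 'w \<Rightarrow> real^'p) \<Rightarrow> 'n \<Rightarrow> real" where
  "B_ErrS M C W X Y i = (\<integral>\<omega>. sq_bias M (sigmaS M X) C W X Y (Inl i) \<omega> \<partial>M)"

definition V_ErrS ::
  "'w measure \<Rightarrow> ('k::finite, 'p::finite) weight \<Rightarrow>
   ('n::finite + 'n \<Rightarrow> 'w \<Rightarrow> ('k, 'p) covariate) \<Rightarrow>
   ('n + 'n \<Rightarrow> 'w \<Rightarrow> real^'p) \<Rightarrow> 'n \<Rightarrow> real" where
  "V_ErrS M W X Y i = (\<integral>\<omega>. tr_var M (sigmaS M X) W X Y (Inl i) \<omega> \<partial>M)"

end

theory Submission
  imports Defs
begin

text \<open>
  The idea is to freeze the covariates. Given them, \<open>vec_outer (Y \<alpha>)\<close> is \<open>vecm (C x)\<close> plus a noise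
  vector with mean zero and covariance \<open>V x\<close>, where \<open>x\<close> is the covariate at \<open>\<alpha>\<close>, and the noise
  vectors at different indices are uncorrelated. The matrix function \<open>V\<close> is the same for all
  indices, because the errors have one common law. Write \<open>G\<close> for the Gram matrix of the weighted
  design. The weighted least squares estimator is affine in the training noise,
  \<open>\<beta> = wls_mean + (\<Sum>j. A j *v noise j)\<close> with \<open>A j = wls_coef W xs j\<close>, so its conditional
  covariance is \<open>wls_cov V W xs\<close>, which is the sandwich matrix wherever \<open>G\<close> is invertible. Every
  conditional quantity of the theorem thereby becomes an explicit function of the covariates: the
  squared bias is \<open>fit_bias\<close>, the total variance is \<open>fit_var\<close>, a test loss has conditional mean
  \<open>fit_bias + trace (W x ** V x) + fit_var\<close>, and a training loss has the same conditional mean less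
  \<open>2 * optimism\<close>. The passage from conditional expectations to partial integrals over the errors is
  \<open>real_cond_exp_freeze\<close>. It asks for integrability in the errors at fixed covariates only, which the
  fourth moments provide, whereas \<open>C (X \<alpha>)\<close> itself may fail to be integrable. It also asks for joint
  measurability, hence for measurability of the matrix square root, which follows from its
  continuity on positive semidefinite matrices (\<open>sqrtm_holder\<close>).

  Under Same-X, \<open>wls_cov\<close> is a symmetric function of an i.i.d. sample. The variance at the index
  \<open>i1\<close> may therefore be replaced by its average over the sample, and since the Gram matrices of the
  single points add up to \<open>G\<close> this average is \<open>trace (hat_cov) / n\<close>. The optimism terms of the
  sample add up to the same trace, which gives OptS. Under Random-X the test covariate is
  independent of the training sample and distributed like its members, so the expectation of the
  trace defining the variance factorises.

  For the bias, \<open>wls_mean\<close> is the weighted least squares fit to the noiseless \<open>C\<close>. Under Random-X the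
  squared biases at the \<open>n\<close> test points add up to a residual sum of squares on the test sample, for a
  coefficient vector that was fitted elsewhere. It is at least the minimal residual sum of squares
  on that sample (\<open>least_squares_minimal\<close>). The Same-X biases add up to such a minimum for the training
  sample, which has the same law as the Random-X test sample; dividing the two expected sums by \<open>n\<close>
  compares the biases (\<open>bias_gap\<close>).

  If the weight is the Moore--Penrose inverse of \<open>V\<close>, then \<open>W ** V ** W = W\<close>, so that \<open>hat_cov\<close> is the
  identity and the sandwich is the inverse of \<open>G\<close>. The Same-X variance is then \<open>K / n\<close>, and the
  Random-X variance is the trace of \<open>E (matrix_inv G) ** E G\<close> over \<open>n\<close>. This is at least \<open>K / n\<close> by a
  matrix form of the inequality between an expectation and its harmonic counterpart
  (\<open>trace_inverse_product_ge\<close>). Finally, the noise term \<open>trace (W x ** V x)\<close> has the same mean in both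
  designs, so the gap between the prediction errors is the sum of the bias gap and the variance gap
  (\<open>error_gap\<close>).
\<close>

section \<open>Spectral decomposition and square roots of symmetric matrices\<close>

lemma linear_term_zero_if_nonneg:
  fixes a b :: real
  assumes "\<And>t. 0 \<le> a * t + b * t\<^sup>2"
  shows "a = 0"
proof (rule ccontr)
  assume "a \<noteq> 0"
  \<comment> \<open>Close enough to 0 the linear term dominates the quadratic one; this point is close enough.\<close>
  define t where "t = - a / (1 + \<bar>b\<bar>)"
  have "a * t + b * t\<^sup>2 \<le> a * t + \<bar>b\<bar> * t\<^sup>2"
    by (intro add_left_mono mult_right_mono) auto
  also have "\<dots> = - a\<^sup>2 / (1 + \<bar>b\<bar>)\<^sup>2"
  proof -
    have "1 + \<bar>b\<bar> \<noteq> 0" by linarith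
    then show ?thesis
      by (simp add: t_def power2_eq_square divide_simps) (simp add: algebra_simps)
  qed
  also have "\<dots> < 0"
    using \<open>a \<noteq> 0\<close> by (simp add: divide_neg_pos add_pos_nonneg)
  finally show False using assms[of t] by simp
qed

lemma inner_symmetric_matrix:
  fixes A :: "real^'m^'m"
  assumes "transpose A = A"
  shows "u \<bullet> (A *v v) = (A *v u) \<bullet> v"
  by (metis assms dot_lmul_matrix vector_transpose_matrix)

text \<open>An orthonormal family of eigenvectors that need not span, so that it can be enlarged one vector at
  a time.\<close>

definition eigenframe :: "real^'m^'m \<Rightarrow> (real^'m) set \<Rightarrow> (real^'m \<Rightarrow> real) \<Rightarrow> bool" where
  "eigenframe A B l \<longleftrightarrow> finite B \<and> pairwise orthogonal B \<and>
     (\<forall>b\<in>B. norm b = 1 \<and> A *v b = l b *\<^sub>R b)"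

text \<open>The orthogonal complement of an eigenframe is invariant under the matrix. A unit vector there at
  which the quadratic form is maximal is an eigenvector: along any direction in the
  complement, the form compared with its maximum times the squared norm changes to first order by
  the inner product of that direction with the residual, up to a constant, and the residual is
  itself such a direction.\<close>

lemma symmetric_eigenvector_in_complement:
  fixes A :: "real^'m^'m"
  assumes sym: "transpose A = A" and fr: "eigenframe A B l" and x: "x \<noteq> 0" "\<And>b. b \<in> B \<Longrightarrow> b \<bullet> x = 0"
  shows "\<exists>v \<mu>. norm v = 1 \<and> A *v v = \<mu> *\<^sub>R v \<and> (\<forall>b\<in>B. b \<bullet> v = 0)"
proof -
  define S where "S = {x. \<forall>b\<in>B. b \<bullet> x = 0}"
  have S_lin: "p *\<^sub>R u + q *\<^sub>R w \<in> S" if "u \<in> S" "w \<in> S" for u w p q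
    using that by (simp add: S_def inner_add_right)
  have S_inv: "A *v u \<in> S" if "u \<in> S" for u
    using that fr by (simp add: S_def inner_symmetric_matrix[OF sym] eigenframe_def)
  have "closed S"
  proof -
    have "S = (\<Inter>b\<in>B. {x. b \<bullet> x = 0})" by (auto simp: S_def)
    then show ?thesis by (simp add: closed_INT closed_hyperplane)
  qed
  then have "compact (sphere 0 1 \<inter> S)"
    by (simp add: compact_Int_closed)
  moreover have "x /\<^sub>R norm x \<in> sphere 0 1 \<inter> S"
    using x by (simp add: S_def)
  moreover have "continuous_on (sphere 0 1 \<inter> S) (\<lambda>v. v \<bullet> (A *v v))"
    by (intro continuous_intros matrix_vector_mult_linear_continuous_on)
  ultimately obtain v where v: "v \<in> sphere 0 1 \<inter> S"
    and vmax: "\<And>u. u \<in> sphere 0 1 \<inter> S \<Longrightarrow> u \<bullet> (A *v u) \<le> v \<bullet> (A *v v)"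
    using continuous_attains_sup[of "sphere 0 1 \<inter> S" "\<lambda>v. v \<bullet> (A *v v)"] by blast
  define \<mu> where "\<mu> = v \<bullet> (A *v v)"
  have le: "u \<bullet> (A *v u) \<le> \<mu> * (u \<bullet> u)" if "u \<in> S" for u
  proof (cases "u = 0")
    case False
    have "u /\<^sub>R norm u \<in> sphere 0 1 \<inter> S"
      using that False S_lin[of u u "inverse (norm u)" 0] by simp
    from vmax[OF this] have "inverse (norm u) * (inverse (norm u) * (u \<bullet> (A *v u))) \<le> \<mu>"
      by (simp add: \<mu>_def matrix_vector_mult_scaleR)
    then show ?thesis
      using False by (simp add: field_simps dot_square_norm power2_eq_square)
  qed simp
  define w where "w = \<mu> *\<^sub>R v - A *v v"
  have vS: "v \<in> S" and vv: "v \<bullet> v = 1" using v by (auto simp: dot_square_norm)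
  have wS: "w \<in> S"
    using S_lin[OF vS S_inv[OF vS], of \<mu> "-1"] by (simp add: w_def)
  have "0 \<le> (2 * (w \<bullet> w)) * t + (\<mu> * (w \<bullet> w) - w \<bullet> (A *v w)) * t\<^sup>2" for t
  proof -
    have "(v + t *\<^sub>R w) \<bullet> (A *v (v + t *\<^sub>R w)) \<le> \<mu> * ((v + t *\<^sub>R w) \<bullet> (v + t *\<^sub>R w))"
      using le S_lin[OF vS wS, of 1 t] by simp
    moreover have "v \<bullet> (A *v w) = \<mu> * (v \<bullet> w) - w \<bullet> w"
      using inner_symmetric_matrix[OF sym, of v w]
      by (subst (2) w_def) (simp add: inner_diff_left)
    moreover from this have "w \<bullet> (A *v v) = \<mu> * (v \<bullet> w) - w \<bullet> w"
      using inner_symmetric_matrix[OF sym, of w v] by (simp add: inner_commute)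
    ultimately show ?thesis
      by (simp add: matrix_vector_right_distrib matrix_vector_mult_scaleR inner_add_left
          inner_add_right vv \<mu>_def[symmetric] inner_commute[of w v] power2_eq_square algebra_simps)
  qed
  then have "2 * (w \<bullet> w) = 0" by (rule linear_term_zero_if_nonneg)
  then have "A *v v = \<mu> *\<^sub>R v" by (simp add: w_def)
  then show ?thesis using v by (auto simp: S_def)
qed

text \<open>An eigenframe of maximal cardinality spans, since otherwise its complement would supply one more
  eigenvector.\<close>

theorem symmetric_matrix_eigenbasis:
  fixes A :: "real^'m^'m"
  assumes sym: "transpose A = A"
  obtains B l where "eigenframe A B l" "span B = UNIV"
proof -
  have frame_card: "card B \<le> CARD('m)" if "eigenframe A B l" for B l
  proof -
    have "0 \<notin> B" using that by (auto simp: eigenframe_def)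
    with that have "independent B"
      unfolding eigenframe_def by (intro pairwise_orthogonal_independent) simp_all
    from independent_card_le[OF this] show ?thesis by (simp)
  qed
  define Q where "Q k \<longleftrightarrow> (\<exists>B l. eigenframe A B l \<and> card B = k)" for k
  have "Q 0"
    unfolding Q_def by (rule exI[of _ "{}"]) (simp add: eigenframe_def)
  moreover have "\<forall>k. Q k \<longrightarrow> k \<le> CARD('m)"
    using frame_card by (auto simp: Q_def)
  ultimately obtain k where "Q k" and kmax: "\<And>k'. Q k' \<Longrightarrow> k' \<le> k"
    using ex_has_greatest_nat[of Q 0 "\<lambda>k. k" "Suc CARD('m)"]
    by (auto simp: less_Suc_eq_le)
  then obtain B l where fr: "eigenframe A B l" and k: "card B = k"
    by (auto simp: Q_def)
  have "span B = UNIV"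
  proof (rule ccontr)
    assume "span B \<noteq> UNIV"
    then obtain x where x: "x \<noteq> 0" "\<And>b. b \<in> span B \<Longrightarrow> x \<bullet> b = 0"
      using span_not_UNIV_orthogonal[of B] by auto
    then have "b \<bullet> x = 0" if "b \<in> B" for b
      using that by (metis inner_commute span_base)
    from symmetric_eigenvector_in_complement[OF sym fr x(1) this]
    obtain v \<mu> where v: "norm v = 1" "A *v v = \<mu> *\<^sub>R v" "\<forall>b\<in>B. b \<bullet> v = 0" by blast
    have "v \<notin> B" using v by (metis norm_zero inner_eq_zero_iff zero_neq_one)
    have "eigenframe A (insert v B) (l(v := \<mu>))"
      using fr v \<open>v \<notin> B\<close> unfolding eigenframe_def
      by (auto simp: pairwise_insert orthogonal_def inner_commute)
    moreover have "card (insert v B) = Suc k"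
      using k \<open>v \<notin> B\<close> fr by (simp add: eigenframe_def)
    ultimately have "Q (Suc k)" unfolding Q_def by blast
    then have "Suc k \<le> k" by (rule kmax)
    then show False by simp
  qed
  with fr that show ?thesis by blast
qed

lemma matrix_eq_on_span:
  fixes P Q :: "real^'m^'q"
  assumes "span B = UNIV" and "\<And>b. b \<in> B \<Longrightarrow> P *v b = Q *v b"
  shows "P = Q"
proof -
  have "P *v x = Q *v x" for x
    by (rule linear_eq_on[of "(*v) P" "(*v) Q" x B]) (use assms in auto)
  then show ?thesis by (simp add: matrix_eq)
qed

text \<open>The functional calculus: on an eigenframe of a matrix, this has the same eigenvectors, with
  eigenvalues given by \<open>f\<close>. Both the square root and the Moore--Penrose inverse arise in this way.\<close>

definition spectral_sum :: "(real^'m) set \<Rightarrow> (real^'m \<Rightarrow> real) \<Rightarrow> real^'m^'m" where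
  "spectral_sum B f = (\<chi> i j. \<Sum>b\<in>B. f b * (b $ i * b $ j))"

lemma spectral_sum_mult: "spectral_sum B f *v x = (\<Sum>b\<in>B. (f b * (b \<bullet> x)) *\<^sub>R b)"
proof -
  have "(\<Sum>j\<in>UNIV. (\<Sum>b\<in>B. f b * (b $ i * b $ j)) * x $ j)
      = (\<Sum>b\<in>B. \<Sum>j\<in>UNIV. f b * (b $ i * b $ j) * x $ j)" for i
    by (subst sum.swap) (simp add: sum_distrib_right)
  then show ?thesis
    by (simp add: vec_eq_iff spectral_sum_def matrix_vector_mult_def inner_vec_def
        sum_distrib_left sum_distrib_right algebra_simps)
qed

lemma transpose_spectral_sum: "transpose (spectral_sum B f) = spectral_sum B f"
  by (simp add: vec_eq_iff spectral_sum_def transpose_def mult.commute)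

lemma spectral_sum_quadratic: "x \<bullet> (spectral_sum B f *v x) = (\<Sum>b\<in>B. f b * (b \<bullet> x)\<^sup>2)"
  by (simp add: spectral_sum_mult inner_sum_right power2_eq_square inner_commute mult.assoc)

lemma spectral_sum_eigenvector:
  assumes "eigenframe A B l" "b \<in> B"
  shows "spectral_sum B f *v b = f b *\<^sub>R b"
proof -
  have "(f c * (c \<bullet> b)) *\<^sub>R c = (if c = b then f b *\<^sub>R b else 0)" if "c \<in> B" for c
    using assms that by (auto simp: eigenframe_def pairwise_def orthogonal_def dot_square_norm)
  then have "spectral_sum B f *v b = (\<Sum>c\<in>B. if c = b then f b *\<^sub>R b else 0)"
    by (simp add: spectral_sum_mult)
  then show ?thesis using assms by (simp add: eigenframe_def)
qed

lemma spectral_sum_eigenvalues: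
  assumes "eigenframe A B l" "span B = UNIV"
  shows "spectral_sum B l = A"
  using assms by (intro matrix_eq_on_span[OF assms(2)])
    (simp add: spectral_sum_eigenvector[OF assms(1)] eigenframe_def)

lemma psd_spectral_sum: "(\<And>b. b \<in> B \<Longrightarrow> 0 \<le> f b) \<Longrightarrow> psd (spectral_sum B f)"
  by (simp add: psd_def transpose_spectral_sum spectral_sum_quadratic sum_nonneg)

text \<open>This forces uniqueness of the square root. The operator \<open>R + sqrt \<mu>\<close> annihilates
  \<open>(R - sqrt \<mu>) v\<close> but is positive definite when \<open>\<mu>\<close> is positive; when \<open>\<mu>\<close> is 0 the norm of \<open>R v\<close>
  vanishes.\<close>

lemma psd_root_unique_on_eigenvector:
  assumes R: "psd R" and v: "(R ** R) *v v = \<mu> *\<^sub>R v" and "0 \<le> \<mu>"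
  shows "R *v v = sqrt \<mu> *\<^sub>R v"
proof (cases "\<mu> = 0")
  case True
  have "norm (R *v v) ^ 2 = v \<bullet> ((R ** R) *v v)"
    using R inner_symmetric_matrix[of R v "R *v v"]
    by (simp add: psd_def dot_square_norm matrix_vector_mul_assoc)
  then show ?thesis using v True by simp
next
  case False
  define w where "w = R *v v - sqrt \<mu> *\<^sub>R v"
  have "R *v w = - sqrt \<mu> *\<^sub>R w"
    using v \<open>0 \<le> \<mu>\<close> by (simp add: w_def matrix_vector_mult_diff_distrib matrix_vector_mult_scaleR
        matrix_vector_mul_assoc algebra_simps)
  moreover have "0 \<le> w \<bullet> (R *v w)" using R by (simp add: psd_def)
  ultimately have "0 \<le> - sqrt \<mu> * (w \<bullet> w)" by simp
  moreover have "0 < sqrt \<mu>" using False \<open>0 \<le> \<mu>\<close> by simp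
  ultimately have "w \<bullet> w \<le> 0"
    by (metis mult_minus_left neg_0_le_iff_le mult_le_0_iff not_le)
  then have "w = 0" using inner_gt_zero_iff[of w] by (simp flip: not_less)
  then show ?thesis by (simp add: w_def)
qed

lemma psd_eigenvalue_nonneg:
  assumes "psd A" "eigenframe A B l" "b \<in> B"
  shows "0 \<le> l b"
proof -
  have "b \<bullet> (A *v b) = l b" using assms by (simp add: eigenframe_def dot_square_norm)
  then show ?thesis using assms(1) by (metis psd_def)
qed

lemma psd_sqrt_ex1:
  fixes A :: "real^'m^'m"
  assumes "psd A"
  shows "\<exists>!R. psd R \<and> R ** R = A"
proof -
  obtain B l where fr: "eigenframe A B l" and sp: "span B = UNIV"
    using symmetric_matrix_eigenbasis[of A] assms by (auto simp: psd_def)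
  note nn = psd_eigenvalue_nonneg[OF assms fr]
  show ?thesis
  proof (intro ex1I conjI)
    show "psd (spectral_sum B (\<lambda>b. sqrt (l b)))"
      using nn by (intro psd_spectral_sum) auto
    show "spectral_sum B (\<lambda>b. sqrt (l b)) ** spectral_sum B (\<lambda>b. sqrt (l b)) = A"
      using nn fr by (intro matrix_eq_on_span[OF sp])
        (simp add: spectral_sum_eigenvector[OF fr] matrix_vector_mul_assoc[symmetric]
          matrix_vector_mult_scaleR eigenframe_def)
    fix R assume R: "psd R \<and> R ** R = A"
    show "R = spectral_sum B (\<lambda>b. sqrt (l b))"
      using R nn fr by (intro matrix_eq_on_span[OF sp])
        (simp add: spectral_sum_eigenvector[OF fr] psd_root_unique_on_eigenvector eigenframe_def)
  qed
qed

lemma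
  assumes "psd A"
  shows psd_sqrtm: "psd (sqrtm A)" and sqrtm_square: "sqrtm A ** sqrtm A = A"
  using theI'[OF psd_sqrt_ex1[OF assms]] by (auto simp: sqrtm_def)

lemma sqrtm_eqI: "psd R \<Longrightarrow> R ** R = A \<Longrightarrow> psd A \<Longrightarrow> sqrtm A = R"
  unfolding sqrtm_def by (rule the1_equality[OF psd_sqrt_ex1]) auto

lemma transpose_sqrtm: "psd A \<Longrightarrow> transpose (sqrtm A) = sqrtm A"
  using psd_sqrtm by (auto simp: psd_def)

lemma posdef_imp_psd: "posdef A \<Longrightarrow> psd A"
  unfolding psd_def posdef_def by (metis inner_zero_left less_eq_real_def)

text \<open>With \<open>D = R - T\<close> one has \<open>R ** R - T ** T = R ** D + D ** T\<close>, whose quadratic form at an eigenvector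
  of \<open>D\<close> is \<open>\<mu>\<close> times that of \<open>R + T\<close>; and the form of \<open>R + T\<close> dominates that of \<open>R - T\<close>, which
  is \<open>\<mu>\<close>.\<close>

lemma psd_root_eigenvalue_bound:
  assumes "psd R" "psd T" and v: "(R - T) *v v = \<mu> *\<^sub>R v" "norm v = 1"
  shows "\<mu>\<^sup>2 \<le> \<bar>v \<bullet> ((R ** R - T ** T) *v v)\<bar>"
proof -
  have sym: "transpose R = R" "transpose T = T" using assms by (auto simp: psd_def)
  have D: "R *v v = T *v v + \<mu> *\<^sub>R v"
    using v by (simp add: algebra_simps matrix_vector_mult_diff_rdistrib)
  have "v \<bullet> ((R ** R - T ** T) *v v) = (R *v v) \<bullet> (R *v v) - (T *v v) \<bullet> (T *v v)"
    by (simp add: matrix_vector_mult_diff_rdistrib inner_diff_right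
        matrix_vector_mul_assoc[symmetric] inner_symmetric_matrix[OF sym(1)]
        inner_symmetric_matrix[OF sym(2)])
  also have "\<dots> = \<mu> * (v \<bullet> (R *v v) + v \<bullet> (T *v v))"
    by (simp add: D inner_add_left inner_add_right inner_commute algebra_simps)
  finally have eq: "\<bar>v \<bullet> ((R ** R - T ** T) *v v)\<bar> = \<bar>\<mu>\<bar> * \<bar>v \<bullet> (R *v v) + v \<bullet> (T *v v)\<bar>"
    by (simp add: abs_mult)
  have "v \<bullet> (R *v v) - v \<bullet> (T *v v) = \<mu>"
    using v(2) by (simp add: D inner_add_right dot_square_norm)
  moreover have "0 \<le> v \<bullet> (R *v v)" "0 \<le> v \<bullet> (T *v v)" using assms by (auto simp: psd_def)
  ultimately have "\<bar>\<mu>\<bar> \<le> \<bar>v \<bullet> (R *v v) + v \<bullet> (T *v v)\<bar>" by linarith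
  then have "\<bar>\<mu>\<bar> * \<bar>\<mu>\<bar> \<le> \<bar>v \<bullet> ((R ** R - T ** T) *v v)\<bar>"
    unfolding eq by (rule mult_left_mono) simp
  then show ?thesis by (simp add: power2_eq_square)
qed

text \<open>Continuity of the square root with exponent 1/2: the eigenvalues of the difference of the roots
  are controlled by \<open>psd_root_eigenvalue_bound\<close>, and its entries by those eigenvalues. The
  estimate reaches singular matrices, where the root is not Lipschitz.\<close>

lemma sqrtm_holder:
  fixes P Q :: "real^'m^'m"
  assumes P: "psd P" and Q: "psd Q"
  shows "\<bar>(sqrtm P - sqrtm Q) $ i $ j\<bar> \<le> CARD('m) * sqrt (onorm ((*v) (P - Q)))"
proof -
  define D where "D = sqrtm P - sqrtm Q"
  have "transpose D = D"
    using transpose_sqrtm[OF P] transpose_sqrtm[OF Q]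
    by (simp add: D_def vec_eq_iff transpose_def)
  then obtain B l where fr: "eigenframe D B l" and sp: "span B = UNIV"
    using symmetric_matrix_eigenbasis by blast
  have B: "b \<noteq> 0" "norm b = 1" if "b \<in> B" for b using fr that by (auto simp: eigenframe_def)
  have "0 \<notin> B" using B(1) by blast
  then have "independent B"
    using fr unfolding eigenframe_def by (intro pairwise_orthogonal_independent) simp_all
  then have cardB: "card B \<le> CARD('m)" using independent_card_le by fastforce
  have l: "\<bar>l b\<bar> \<le> sqrt (onorm ((*v) (P - Q)))" if "b \<in> B" for b
  proof -
    have "(l b)\<^sup>2 \<le> \<bar>b \<bullet> ((P - Q) *v b)\<bar>"
      using psd_root_eigenvalue_bound[OF psd_sqrtm[OF P] psd_sqrtm[OF Q], of b "l b"] fr that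
      by (simp add: eigenframe_def D_def sqrtm_square P Q)
    also have "\<dots> \<le> norm b * norm ((P - Q) *v b)" by (rule Cauchy_Schwarz_ineq2)
    also have "\<dots> \<le> onorm ((*v) (P - Q))"
      using onorm[OF matrix_vector_mul_bounded_linear, of "P - Q" b] B(2)[OF that] by simp
    finally show ?thesis using real_sqrt_le_mono by fastforce
  qed
  have comp: "\<bar>b $ i\<bar> \<le> 1" if "b \<in> B" for b i
    using component_le_norm_cart[of b i] B(2)[OF that] by simp
  have "D $ i $ j = (\<Sum>b\<in>B. l b * (b $ i * b $ j))"
    by (subst spectral_sum_eigenvalues[OF fr sp, symmetric]) (simp add: spectral_sum_def)
  also have "\<bar>\<dots>\<bar> \<le> (\<Sum>b\<in>B. sqrt (onorm ((*v) (P - Q))))"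
  proof (rule order_trans[OF sum_abs sum_mono])
    fix b assume b: "b \<in> B"
    have "\<bar>b $ i\<bar> * \<bar>b $ j\<bar> \<le> 1 * 1" using comp[OF b] by (intro mult_mono) auto
    then have "\<bar>l b\<bar> * (\<bar>b $ i\<bar> * \<bar>b $ j\<bar>) \<le> sqrt (onorm ((*v) (P - Q))) * 1"
      using l[OF b] by (intro mult_mono) (auto simp: onorm_pos_le)
    then show "\<bar>l b * (b $ i * b $ j)\<bar> \<le> sqrt (onorm ((*v) (P - Q)))" by (simp add: abs_mult)
  qed
  also have "\<dots> \<le> CARD('m) * sqrt (onorm ((*v) (P - Q)))"
    using cardB by (simp add: mult_right_mono onorm_pos_le[OF matrix_vector_mul_bounded_linear])
  finally show ?thesis by (simp add: D_def)
qed

section \<open>The Moore--Penrose inverse\<close>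

definition penrose :: "real^'m^'m \<Rightarrow> real^'m^'m \<Rightarrow> bool" where
  "penrose A B \<longleftrightarrow> A ** B ** A = A \<and> B ** A ** B = B \<and>
     transpose (A ** B) = A ** B \<and> transpose (B ** A) = B ** A"

lemma penrose_sym: "penrose A B \<Longrightarrow> penrose B A"
  by (simp add: penrose_def)

text \<open>Both products \<open>A ** B\<close> and \<open>B ** A\<close> are determined by \<open>A\<close> alone, and \<open>B\<close> is recovered as
  \<open>B ** A ** B\<close>.\<close>

lemma penrose_unique:
  assumes B: "penrose A B" and C: "penrose A C"
  shows "B = C"
proof -
  have "A ** B = A ** C"
  proof -
    have "A ** B = transpose (A ** C ** A ** B)"
      using B C by (simp add: penrose_def)
    also have "\<dots> = transpose (A ** B) ** transpose (A ** C)"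
      by (simp add: matrix_transpose_mul[symmetric] matrix_mul_assoc)
    also have "\<dots> = A ** B ** A ** C" using B C by (simp add: penrose_def matrix_mul_assoc)
    finally show ?thesis using B by (simp add: penrose_def)
  qed
  moreover have "B ** A = C ** A"
  proof -
    have "B ** A = transpose (B ** A ** C ** A)"
      using B C by (simp add: penrose_def matrix_mul_assoc[symmetric])
    also have "\<dots> = transpose (C ** A) ** transpose (B ** A)"
      by (simp add: matrix_transpose_mul[symmetric] matrix_mul_assoc)
    also have "\<dots> = (C ** A) ** (B ** A)" using B C by (simp add: penrose_def)
    also have "\<dots> = C ** (A ** B ** A)" by (simp only: matrix_mul_assoc)
    also have "\<dots> = C ** A" using B by (simp add: penrose_def)
    finally show ?thesis .
  qed
  ultimately have "B ** A ** B = C ** A ** C"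
    by (metis (no_types) matrix_mul_assoc)
  then show ?thesis using B C by (simp add: penrose_def)
qed

lemma penrose_imp_pinv: "penrose A B \<Longrightarrow> pinv A = B"
  unfolding pinv_def using penrose_unique
  by (intro the_equality) (auto simp: penrose_def)

lemma penrose_pinv_symmetric:
  fixes A :: "real^'m^'m"
  assumes "transpose A = A"
  shows "penrose A (pinv A)"
proof -
  obtain B l where fr: "eigenframe A B l" and sp: "span B = UNIV"
    using symmetric_matrix_eigenbasis[OF assms] .
  define P where "P = spectral_sum B (\<lambda>b. inverse (l b))"
  have b: "P *v b = inverse (l b) *\<^sub>R b" "A *v b = l b *\<^sub>R b" if "b \<in> B" for b
    using that fr by (simp_all add: P_def spectral_sum_eigenvector[OF fr])
      (simp add: eigenframe_def)
  have comm: "P ** A = A ** P"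
    by (rule matrix_eq_on_span[OF sp])
      (simp add: b matrix_vector_mult_scaleR matrix_vector_mul_assoc[symmetric])
  have "penrose A P"
    unfolding penrose_def
  proof (intro conjI)
    show "A ** P ** A = A" "P ** A ** P = P"
      by (rule matrix_eq_on_span[OF sp], force simp: b matrix_vector_mult_scaleR
          simp flip: matrix_vector_mul_assoc)+
    show "transpose (A ** P) = A ** P" "transpose (P ** A) = P ** A"
      by (simp_all add: matrix_transpose_mul assms P_def transpose_spectral_sum comm[unfolded P_def])
  qed
  then show ?thesis using penrose_imp_pinv by metis
qed

section \<open>Measurability of matrix expressions\<close>

lemma measurable_vec_nth [measurable (raw)]:
  fixes f :: "'w \<Rightarrow> 'b::euclidean_space^'n"
  assumes "f \<in> borel_measurable M"
  shows "(\<lambda>x. f x $ i) \<in> borel_measurable M"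
proof -
  have "(\<lambda>v::'b^'n. v $ i) \<in> borel_measurable borel"
    by (intro borel_measurable_continuous_onI continuous_intros)
  from measurable_compose[OF assms this] show ?thesis .
qed

lemma measurable_vec_lambda [measurable (raw)]:
  fixes f :: "'w \<Rightarrow> 'n::finite \<Rightarrow> 'b::euclidean_space"
  assumes "\<And>i. (\<lambda>x. f x i) \<in> borel_measurable M"
  shows "(\<lambda>x. \<chi> i. f x i) \<in> borel_measurable M"
proof (rule borel_measurable_euclidean_space[THEN iffD2], intro ballI)
  fix e :: "'b^'n" assume "e \<in> Basis"
  then obtain i u where e: "e = axis i u" by (auto simp: Basis_vec_def)
  have "(\<lambda>x. (\<chi> i. f x i) \<bullet> e) = (\<lambda>x. f x i \<bullet> u)"
    by (simp add: e inner_axis)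
  then show "(\<lambda>x. (\<chi> i. f x i) \<bullet> e) \<in> borel_measurable M"
    using assms[of i] by simp
qed

lemma measurable_matrix_mult [measurable (raw)]:
  fixes P :: "'w \<Rightarrow> real^'k^'m" and Q :: "'w \<Rightarrow> real^'q^'k"
  assumes [measurable]: "P \<in> borel_measurable M" "Q \<in> borel_measurable M"
  shows "(\<lambda>x. P x ** Q x) \<in> borel_measurable M"
  unfolding matrix_matrix_mult_def by measurable

lemma measurable_matrix_vector_mult [measurable (raw)]:
  fixes P :: "'w \<Rightarrow> real^'k^'m" and v :: "'w \<Rightarrow> real^'k"
  assumes [measurable]: "P \<in> borel_measurable M" "v \<in> borel_measurable M"
  shows "(\<lambda>x. P x *v v x) \<in> borel_measurable M"
  unfolding matrix_vector_mult_def by measurable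

lemma measurable_transpose [measurable (raw)]:
  fixes P :: "'w \<Rightarrow> real^'k^'m"
  assumes [measurable]: "P \<in> borel_measurable M"
  shows "(\<lambda>x. transpose (P x)) \<in> borel_measurable M"
  unfolding transpose_def by measurable

lemma measurable_trace [measurable (raw)]:
  fixes P :: "'w \<Rightarrow> real^'k^'k"
  assumes [measurable]: "P \<in> borel_measurable M"
  shows "(\<lambda>x. trace (P x)) \<in> borel_measurable M"
  unfolding trace_def by measurable

lemma measurable_det [measurable (raw)]:
  fixes P :: "'w \<Rightarrow> real^'k^'k"
  assumes [measurable]: "P \<in> borel_measurable M"
  shows "(\<lambda>x. det (P x)) \<in> borel_measurable M"
  unfolding det_def by measurable

text \<open>On singular matrices \<open>matrix_inv\<close> is a choice from the empty predicate, hence one fixed matrix.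
  Together with Cramer's rule on the open set of regular matrices this makes it measurable.\<close>

lemma matrix_inv_singular:
  fixes P Q :: "real^'k^'k"
  assumes "\<not> invertible P" "\<not> invertible Q"
  shows "matrix_inv P = matrix_inv Q"
proof -
  have "(P ** R = mat 1 \<and> R ** P = mat 1) = (Q ** R = mat 1 \<and> R ** Q = mat 1)" for R
    using assms by (auto simp: invertible_def)
  then show ?thesis by (simp add: matrix_inv_def)
qed

lemma matrix_inv_inverse:
  fixes P :: "real^'k^'k"
  assumes "invertible P"
  shows "P ** matrix_inv P = mat 1" "matrix_inv P ** P = mat 1"
  using someI_ex[OF assms[unfolded invertible_def]] by (auto simp: matrix_inv_def)

lemma matrix_inv_cramer:
  fixes P :: "real^'k^'k"
  assumes "det P \<noteq> 0"
  shows "matrix_inv P $ k $ j = det (\<chi> a b. if b = k then axis j 1 $ a else P $ a $ b) / det P"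
proof -
  have "P *v (matrix_inv P *v axis j 1) = axis j 1"
    using assms by (simp add: matrix_vector_mul_assoc matrix_inv_inverse invertible_det_nz)
  then have "matrix_inv P *v axis j 1 =
      (\<chi> k. det (\<chi> a b. if b = k then axis j 1 $ a else P $ a $ b) / det P)"
    by (simp add: cramer[OF assms])
  then show ?thesis
    by (metis (no_types, lifting) vec_lambda_beta column_def matrix_vector_mul_component
        matrix_vector_mult_basis)
qed

lemma measurable_matrix_inv [measurable (raw)]:
  fixes P :: "'w \<Rightarrow> real^'k^'k"
  assumes [measurable]: "P \<in> borel_measurable M"
  shows "(\<lambda>x. matrix_inv (P x)) \<in> borel_measurable M"
proof -
  have "matrix_inv (P x) = (if det (P x) = 0 then matrix_inv 0 else
      (\<chi> k j. det (\<chi> a b. if b = k then axis j 1 $ a else P x $ a $ b) / det (P x)))" for x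
  proof (cases "det (P x) = 0")
    case True
    moreover have "det (0 :: real^'k^'k) = 0"
      by (rule det_zero_row(1)[of undefined]) (simp add: row_def vec_eq_iff)
    ultimately show ?thesis using matrix_inv_singular[of "P x" 0] by (simp add: invertible_det_nz)
  qed (simp add: vec_eq_iff matrix_inv_cramer)
  then show ?thesis by simp
qed

lemma continuous_on_sqrtm: "continuous_on {A. psd A} (sqrtm :: real^'m^'m \<Rightarrow> _)"
  unfolding continuous_on_def
proof (intro ballI vec_tendstoI)
  fix Q :: "real^'m^'m" and i j assume "Q \<in> {A. psd A}"
  let ?F = "at Q within {A. psd A}"
  let ?b = "\<lambda>P. CARD('m) * sqrt (\<Sum>i\<in>UNIV. \<Sum>j\<in>UNIV. \<bar>(P - Q) $ i $ j\<bar>)"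
  have "((\<lambda>P. sqrtm P $ i $ j - sqrtm Q $ i $ j) \<longlongrightarrow> 0) ?F"
  proof (rule Lim_null_comparison)
    show "\<forall>\<^sub>F P in ?F. norm (sqrtm P $ i $ j - sqrtm Q $ i $ j) \<le> ?b P"
      unfolding eventually_at_filter
    proof (intro always_eventually allI impI)
      fix P :: "real^'m^'m" assume "P \<in> {A. psd A}"
      with \<open>Q \<in> _\<close> have "norm (sqrtm P $ i $ j - sqrtm Q $ i $ j)
          \<le> CARD('m) * sqrt (onorm ((*v) (P - Q)))"
        using sqrtm_holder[of P Q i j] by simp
      also have "\<dots> \<le> ?b P"
        by (intro mult_left_mono real_sqrt_le_mono onorm_le_matrix_component_sum) simp
      finally show "norm (sqrtm P $ i $ j - sqrtm Q $ i $ j) \<le> ?b P" .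
    qed
    have "(?b \<longlongrightarrow> ?b Q) ?F" by (intro tendsto_intros)
    then show "(?b \<longlongrightarrow> 0) ?F" by simp
  qed
  then show "((\<lambda>P. sqrtm P $ i $ j) \<longlongrightarrow> sqrtm Q $ i $ j) ?F"
    by (simp add: LIM_zero_iff)
qed

lemma measurable_sqrtm [measurable (raw)]:
  fixes P :: "'w \<Rightarrow> real^'m^'m"
  assumes "P \<in> borel_measurable M" "\<And>x. psd (P x)"
  shows "(\<lambda>x. sqrtm (P x)) \<in> borel_measurable M"
proof -
  have "P \<in> M \<rightarrow>\<^sub>M restrict_space borel {A. psd A}"
    using assms by (intro measurable_restrict_space2) auto
  from measurable_compose[OF this
      borel_measurable_continuous_on_restrict[OF continuous_on_sqrtm]]
  show ?thesis by simp
qed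

lemma measurable_vecm [measurable (raw)]:
  fixes P :: "'w \<Rightarrow> real^'p::finite^'p"
  assumes [measurable]: "P \<in> borel_measurable M"
  shows "(\<lambda>x. vecm (P x)) \<in> borel_measurable M"
  unfolding vecm_def by measurable

lemma measurable_vec_outer [measurable (raw)]:
  fixes y :: "'w \<Rightarrow> real^'p::finite"
  assumes [measurable]: "y \<in> borel_measurable M"
  shows "(\<lambda>x. vec_outer (y x)) \<in> borel_measurable M"
  unfolding vec_outer_def by measurable

lemma measurable_design [measurable (raw)]:
  fixes x :: "'w \<Rightarrow> ('k::finite, 'p::finite) covariate"
  assumes [measurable]: "x \<in> borel_measurable M"
  shows "(\<lambda>\<omega>. design (x \<omega>)) \<in> borel_measurable M"
  unfolding design_def by measurable

lemma measurable_train [measurable (raw)]: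
  fixes Z :: "'n::finite + 'n \<Rightarrow> 'w \<Rightarrow> 'a::euclidean_space"
  assumes [measurable]: "\<And>\<alpha>. Z \<alpha> \<in> borel_measurable M"
  shows "train Z \<in> borel_measurable M"
  unfolding train_def[abs_def] by measurable

section \<open>Conditional moments given an independent part of the data\<close>

lemma subalgebra_gen_sigma: "T \<in> borel_measurable M \<Longrightarrow> subalgebra M (gen_sigma M T)"
  unfolding subalgebra_def gen_sigma_def
  by (auto simp: sets_vimage_algebra intro!: sets.sigma_sets_subset)

text \<open>Independence of two random elements of different types, in the form in which Fubini's theorem
  applies to it.\<close>

definition indep_pair ::
  "'w measure \<Rightarrow> ('w \<Rightarrow> 't::topological_space) \<Rightarrow> ('w \<Rightarrow> 'e::topological_space) \<Rightarrow> bool" where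
  "indep_pair M T E \<longleftrightarrow> T \<in> borel_measurable M \<and> E \<in> borel_measurable M \<and>
     distr M (borel \<Otimes>\<^sub>M borel) (\<lambda>\<omega>. (T \<omega>, E \<omega>)) = distr M borel T \<Otimes>\<^sub>M distr M borel E"

context prob_space
begin

lemma indep_pairI_indep_set:
  fixes T :: "'a \<Rightarrow> 't::topological_space" and E :: "'a \<Rightarrow> 'e::topological_space"
  assumes [measurable]: "T \<in> borel_measurable M" "E \<in> borel_measurable M"
    and ind: "indep_set (sets (gen_sigma M E)) (sets (gen_sigma M T))"
  shows "indep_pair M T E"
proof -
  interpret DT: prob_space "distr M borel T" by (rule prob_space_distr) simp
  interpret DE: prob_space "distr M borel E" by (rule prob_space_distr) simp
  have "distr M borel T \<Otimes>\<^sub>M distr M borel E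
      = distr M (borel \<Otimes>\<^sub>M borel) (\<lambda>\<omega>. (T \<omega>, E \<omega>))"
  proof (rule pair_measure_eqI)
    show "sets (distr M borel T \<Otimes>\<^sub>M distr M borel E)
        = sets (distr M (borel \<Otimes>\<^sub>M borel) (\<lambda>\<omega>. (T \<omega>, E \<omega>)))"
      by simp
    fix A B assume "A \<in> sets (distr M borel T)" "B \<in> sets (distr M borel E)"
    then have [measurable]: "A \<in> sets borel" "B \<in> sets borel" by auto
    have "T -` A \<inter> space M \<in> sets (gen_sigma M T)" "E -` B \<inter> space M \<in> sets (gen_sigma M E)"
      by (auto simp: gen_sigma_def intro: in_vimage_algebra)
    then have "prob ((E -` B \<inter> space M) \<inter> (T -` A \<inter> space M))
        = prob (E -` B \<inter> space M) * prob (T -` A \<inter> space M)"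
      using ind by (auto simp: indep_sets2_eq)
    moreover have "(\<lambda>\<omega>. (T \<omega>, E \<omega>)) -` (A \<times> B) \<inter> space M
        = (E -` B \<inter> space M) \<inter> (T -` A \<inter> space M)" by auto
    ultimately show "emeasure (distr M borel T) A * emeasure (distr M borel E) B
        = emeasure (distr M (borel \<Otimes>\<^sub>M borel) (\<lambda>\<omega>. (T \<omega>, E \<omega>))) (A \<times> B)"
      by (simp add: emeasure_distr emeasure_eq_measure ennreal_mult[symmetric] mult.commute)
  qed (unfold_locales)
  then show ?thesis by (simp add: indep_pair_def)
qed

lemma indep_pair_compose:
  fixes T :: "'a \<Rightarrow> 't::topological_space" and E :: "'a \<Rightarrow> 'e::topological_space"
    and f :: "'t \<Rightarrow> 'u::topological_space"
  assumes TE: "indep_pair M T E" and [measurable]: "f \<in> borel_measurable borel"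
  shows "indep_pair M (\<lambda>\<omega>. f (T \<omega>)) E"
proof -
  have [measurable]: "T \<in> borel_measurable M" "E \<in> borel_measurable M"
    using TE by (auto simp: indep_pair_def)
  interpret DT: prob_space "distr M borel T" by (rule prob_space_distr) simp
  interpret DE: prob_space "distr M borel E" by (rule prob_space_distr) simp
  have "distr M borel (\<lambda>\<omega>. f (T \<omega>)) = distr (distr M borel T) borel f"
    by (simp add: distr_distr comp_def)
  moreover have "distr (distr M borel T) borel f \<Otimes>\<^sub>M distr (distr M borel E) borel (\<lambda>e. e)
      = distr (distr M borel T \<Otimes>\<^sub>M distr M borel E) (borel \<Otimes>\<^sub>M borel) (\<lambda>(t, e). (f t, e))"
    by (rule pair_measure_distr) (auto simp: distr_id2 intro: DE.sigma_finite_measure_axioms)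
  moreover have "distr (distr M borel T \<Otimes>\<^sub>M distr M borel E) (borel \<Otimes>\<^sub>M borel) (\<lambda>(t, e). (f t, e))
      = distr M (borel \<Otimes>\<^sub>M borel) (\<lambda>\<omega>. (f (T \<omega>), E \<omega>))"
    using TE by (subst indep_pair_def[THEN iffD1, THEN conjunct2, THEN conjunct2, symmetric])
      (simp_all add: distr_distr comp_def)
  ultimately show ?thesis by (simp add: indep_pair_def distr_id2)
qed

text \<open>Both sides have the same integral over each event \<open>T -` B\<close>, by Tonelli for the product of the two
  laws.\<close>

lemma nn_cond_exp_freeze:
  fixes T :: "'a \<Rightarrow> 't::topological_space" and E :: "'a \<Rightarrow> 'e::topological_space"
    and h :: "'t \<times> 'e \<Rightarrow> ennreal"
  assumes ind: "indep_pair M T E"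
    and h [measurable]: "h \<in> borel_measurable (borel \<Otimes>\<^sub>M borel)"
  shows "AE \<omega> in M. nn_cond_exp M (gen_sigma M T) (\<lambda>\<omega>. h (T \<omega>, E \<omega>)) \<omega>
           = (\<integral>\<^sup>+ e. h (T \<omega>, e) \<partial>distr M borel E)"
proof -
  have [measurable]: "T \<in> borel_measurable M" "E \<in> borel_measurable M"
    using ind by (auto simp: indep_pair_def)
  interpret F: finite_measure_subalgebra M "gen_sigma M T"
    by (intro finite_measure_subalgebra.intro finite_measure_axioms
        finite_measure_subalgebra_axioms.intro subalgebra_gen_sigma) simp
  interpret DT: prob_space "distr M borel T" by (rule prob_space_distr) simp
  interpret DE: prob_space "distr M borel E" by (rule prob_space_distr) simp
  have joint: "distr M (borel \<Otimes>\<^sub>M borel) (\<lambda>\<omega>. (T \<omega>, E \<omega>))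
      = distr M borel T \<Otimes>\<^sub>M distr M borel E"
    using ind by (simp add: indep_pair_def)
  have hT [measurable]: "(\<lambda>t. \<integral>\<^sup>+ e. h (t, e) \<partial>distr M borel E) \<in> borel_measurable borel"
    by measurable
  have "AE \<omega> in M. (\<integral>\<^sup>+ e. h (T \<omega>, e) \<partial>distr M borel E)
      = nn_cond_exp M (gen_sigma M T) (\<lambda>\<omega>. h (T \<omega>, E \<omega>)) \<omega>"
  proof (rule F.nn_cond_exp_charact)
    fix A assume "A \<in> sets (gen_sigma M T)"
    then obtain B where B [measurable]: "B \<in> sets borel" and A: "A = T -` B \<inter> space M"
      by (auto simp: gen_sigma_def sets_vimage_algebra2)
    have "(\<integral>\<^sup>+\<omega>\<in>A. h (T \<omega>, E \<omega>) \<partial>M) = (\<integral>\<^sup>+\<omega>. (\<lambda>(t, e). h (t, e) * indicator B t) (T \<omega>, E \<omega>) \<partial>M)"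
      by (intro nn_integral_cong) (auto simp: A indicator_def)
    also have "\<dots> = (\<integral>\<^sup>+z. (case z of (t, e) \<Rightarrow> h (t, e) * indicator B t)
        \<partial>(distr M borel T \<Otimes>\<^sub>M distr M borel E))"
      by (subst joint[symmetric], subst nn_integral_distr) simp_all
    also have "\<dots> = (\<integral>\<^sup>+t. \<integral>\<^sup>+e. h (t, e) * indicator B t \<partial>distr M borel E \<partial>distr M borel T)"
      by (subst DE.nn_integral_fst[symmetric]) simp_all
    also have "\<dots> = (\<integral>\<^sup>+t. (\<integral>\<^sup>+e. h (t, e) \<partial>distr M borel E) * indicator B t \<partial>distr M borel T)"
      by (intro nn_integral_cong nn_integral_multc) measurable
    also have "\<dots> = (\<integral>\<^sup>+\<omega>. (\<integral>\<^sup>+e. h (T \<omega>, e) \<partial>distr M borel E) * indicator B (T \<omega>) \<partial>M)"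
      by (subst nn_integral_distr) simp_all
    also have "\<dots> = (\<integral>\<^sup>+\<omega>\<in>A. (\<integral>\<^sup>+e. h (T \<omega>, e) \<partial>distr M borel E) \<partial>M)"
      by (intro nn_integral_cong) (auto simp: A indicator_def)
    finally show "(\<integral>\<^sup>+\<omega>\<in>A. h (T \<omega>, E \<omega>) \<partial>M)
        = (\<integral>\<^sup>+\<omega>\<in>A. (\<integral>\<^sup>+e. h (T \<omega>, e) \<partial>distr M borel E) \<partial>M)" .
  next
    have "T \<in> measurable (gen_sigma M T) borel"
      unfolding gen_sigma_def by (rule measurable_vimage_algebra1) simp
    from measurable_compose[OF this hT]
    show "(\<lambda>\<omega>. \<integral>\<^sup>+ e. h (T \<omega>, e) \<partial>distr M borel E) \<in> borel_measurable (gen_sigma M T)" .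
  qed measurable
  then show ?thesis by (rule AE_mp) simp
qed

text \<open>Positive and negative parts are conditioned separately, and both have finite conditional
  expectations because every section \<open>g t\<close> is integrable. This covers functions whose growth in
  \<open>T\<close> is uncontrolled.\<close>

lemma real_cond_exp_freeze:
  fixes T :: "'a \<Rightarrow> 't::topological_space" and E :: "'a \<Rightarrow> 'e::topological_space"
    and g :: "'t \<Rightarrow> 'e \<Rightarrow> real"
  assumes ind: "indep_pair M T E"
    and g [measurable]: "(\<lambda>(t, e). g t e) \<in> borel_measurable (borel \<Otimes>\<^sub>M borel)"
    and s: "\<And>t. has_bochner_integral (distr M borel E) (g t) (s t)"
  shows "AE \<omega> in M. real_cond_exp M (gen_sigma M T) (\<lambda>\<omega>. g (T \<omega>) (E \<omega>)) \<omega> = s (T \<omega>)"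
proof -
  let ?D = "distr M borel E"
  have "AE \<omega> in M. nn_cond_exp M (gen_sigma M T) (\<lambda>\<omega>. ennreal (g (T \<omega>) (E \<omega>))) \<omega>
           = (\<integral>\<^sup>+ e. ennreal (g (T \<omega>) e) \<partial>?D)"
    using nn_cond_exp_freeze[OF ind, of "\<lambda>(t, e). ennreal (g t e)"] by simp
  moreover have "AE \<omega> in M. nn_cond_exp M (gen_sigma M T) (\<lambda>\<omega>. ennreal (- g (T \<omega>) (E \<omega>))) \<omega>
           = (\<integral>\<^sup>+ e. ennreal (- g (T \<omega>) e) \<partial>?D)"
    using nn_cond_exp_freeze[OF ind, of "\<lambda>(t, e). ennreal (- g t e)"] by simp
  moreover have eq: "enn2real (\<integral>\<^sup>+ e. ennreal (g t e) \<partial>?D) - enn2real (\<integral>\<^sup>+ e. ennreal (- g t e) \<partial>?D) = s t" for t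
    using real_lebesgue_integral_def[of ?D "g t"] s[of t]
    by (auto simp: has_bochner_integral_iff)
  ultimately show ?thesis
    unfolding real_cond_exp_def eq[symmetric] by (elim AE_mp) simp
qed

lemma integral_freeze:
  fixes T :: "'a \<Rightarrow> 't::topological_space" and E :: "'a \<Rightarrow> 'e::topological_space"
    and g :: "'t \<Rightarrow> 'e \<Rightarrow> real"
  assumes ind: "indep_pair M T E"
    and g [measurable]: "(\<lambda>(t, e). g t e) \<in> borel_measurable (borel \<Otimes>\<^sub>M borel)"
    and s: "\<And>t. has_bochner_integral (distr M borel E) (g t) (s t)"
    and int: "integrable M (\<lambda>\<omega>. g (T \<omega>) (E \<omega>))"
  shows "has_bochner_integral M (\<lambda>\<omega>. s (T \<omega>)) (\<integral>\<omega>. g (T \<omega>) (E \<omega>) \<partial>M)"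
proof -
  have [measurable]: "T \<in> borel_measurable M" "E \<in> borel_measurable M"
    using ind by (auto simp: indep_pair_def)
  let ?D = "distr M borel E"
  interpret DT: prob_space "distr M borel T" by (rule prob_space_distr) simp
  interpret DE: prob_space ?D by (rule prob_space_distr) simp
  interpret P: pair_prob_space "distr M borel T" ?D by unfold_locales
  have joint: "distr M (borel \<Otimes>\<^sub>M borel) (\<lambda>\<omega>. (T \<omega>, E \<omega>)) = distr M borel T \<Otimes>\<^sub>M ?D"
    using ind by (simp add: indep_pair_def)
  have s_eq: "s t = (\<integral>e. g t e \<partial>?D)" for t
    using s[of t] by (simp add: has_bochner_integral_iff)
  have s_meas [measurable]: "s \<in> borel_measurable borel"
    unfolding s_eq[abs_def] by measurable
  have "integrable (distr M (borel \<Otimes>\<^sub>M borel) (\<lambda>\<omega>. (T \<omega>, E \<omega>))) (\<lambda>(t, e). g t e)"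
    using int by (subst integrable_distr_eq) simp_all
  then have int': "integrable (distr M borel T \<Otimes>\<^sub>M ?D) (\<lambda>(t, e). g t e)"
    by (simp add: joint)
  have "integrable (distr M borel T) s"
    using P.integrable_fst'[OF int'] by (simp add: s_eq[abs_def])
  moreover have "(\<integral>t. s t \<partial>distr M borel T) = (\<integral>\<omega>. g (T \<omega>) (E \<omega>) \<partial>M)"
  proof -
    have "(\<integral>t. s t \<partial>distr M borel T) = (\<integral>z. (case z of (t, e) \<Rightarrow> g t e) \<partial>(distr M borel T \<Otimes>\<^sub>M ?D))"
      using P.integral_fst'[OF int'] by (simp add: s_eq)
    then show ?thesis
      by (simp add: joint[symmetric] integral_distr)
  qed
  ultimately show ?thesis
    by (simp add: has_bochner_integral_iff integrable_distr_eq integral_distr)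
qed

text \<open>The conditional covariance is an expectation around the conditional mean, which is only a version
  of \<open>m (T \<omega>)\<close>. It is therefore replaced by \<open>m (T \<omega>)\<close> before the frozen formula is used.\<close>

lemma cond_moments_freeze:
  fixes T :: "'a \<Rightarrow> 't::topological_space" and E :: "'a \<Rightarrow> 'e::topological_space"
    and g :: "'t \<Rightarrow> 'e \<Rightarrow> real^'m"
  assumes ind: "indep_pair M T E" and Z: "\<And>\<omega>. \<omega> \<in> space M \<Longrightarrow> Z \<omega> = g (T \<omega>) (E \<omega>)"
    and g [measurable]: "(\<lambda>(t, e). g t e) \<in> borel_measurable (borel \<Otimes>\<^sub>M borel)"
    and m: "\<And>t a. has_bochner_integral (distr M borel E) (\<lambda>e. g t e $ a) (m t $ a)"
    and K: "\<And>t a b. has_bochner_integral (distr M borel E)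
              (\<lambda>e. (g t e $ a - m t $ a) * (g t e $ b - m t $ b)) (K t $ a $ b)"
  shows cond_mean_freeze: "AE \<omega> in M. cond_mean M (gen_sigma M T) Z \<omega> = m (T \<omega>)"
    and cond_cov_freeze: "AE \<omega> in M. cond_cov M (gen_sigma M T) Z \<omega> = K (T \<omega>)"
proof -
  have [measurable]: "T \<in> borel_measurable M" "E \<in> borel_measurable M"
    using ind by (auto simp: indep_pair_def)
  interpret F: finite_measure_subalgebra M "gen_sigma M T"
    by (intro finite_measure_subalgebra.intro finite_measure_axioms
        finite_measure_subalgebra_axioms.intro subalgebra_gen_sigma) simp
  interpret DE: prob_space "distr M borel E" by (rule prob_space_distr) simp
  let ?Z = "\<lambda>\<omega>. g (T \<omega>) (E \<omega>)"
  have Z_meas [measurable]: "Z \<in> borel_measurable M"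
    using measurable_cong[of M Z ?Z borel] Z by simp
  have [measurable]: "(\<lambda>(t, e). g t e $ a) \<in> borel_measurable (borel \<Otimes>\<^sub>M borel)" for a
    by measurable
  have m_meas [measurable]: "(\<lambda>t. m t $ a) \<in> borel_measurable borel" for a
  proof -
    have "(\<lambda>t. m t $ a) = (\<lambda>t. \<integral>e. g t e $ a \<partial>distr M borel E)"
      using m by (auto simp: has_bochner_integral_iff)
    then show ?thesis by simp
  qed
  have "AE \<omega> in M. \<forall>a. cond_mean M (gen_sigma M T) Z \<omega> $ a = m (T \<omega>) $ a"
    unfolding AE_all_countable
  proof
    fix a
    show "AE \<omega> in M. cond_mean M (gen_sigma M T) Z \<omega> $ a = m (T \<omega>) $ a"
    proof -
      have "AE \<omega> in M. real_cond_exp M (gen_sigma M T) (\<lambda>\<omega>. Z \<omega> $ a) \<omega>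
          = real_cond_exp M (gen_sigma M T) (\<lambda>\<omega>. ?Z \<omega> $ a) \<omega>"
        by (rule F.real_cond_exp_cong) (use Z in auto)
      moreover have "AE \<omega> in M. real_cond_exp M (gen_sigma M T) (\<lambda>\<omega>. ?Z \<omega> $ a) \<omega> = m (T \<omega>) $ a"
        by (rule real_cond_exp_freeze[OF ind _ m]) measurable
      ultimately show ?thesis by eventually_elim (simp add: cond_mean_def)
    qed
  qed
  then show mean: "AE \<omega> in M. cond_mean M (gen_sigma M T) Z \<omega> = m (T \<omega>)"
    by eventually_elim (simp add: vec_eq_iff)
  have "AE \<omega> in M. cond_cov M (gen_sigma M T) Z \<omega> $ a $ b = K (T \<omega>) $ a $ b" for a b
  proof -
    have "AE \<omega> in M. real_cond_exp M (gen_sigma M T) (\<lambda>\<omega>.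
        (Z \<omega> $ a - cond_mean M (gen_sigma M T) Z \<omega> $ a) *
        (Z \<omega> $ b - cond_mean M (gen_sigma M T) Z \<omega> $ b)) \<omega>
      = real_cond_exp M (gen_sigma M T) (\<lambda>\<omega>.
        (?Z \<omega> $ a - m (T \<omega>) $ a) * (?Z \<omega> $ b - m (T \<omega>) $ b)) \<omega>"
    proof (rule F.real_cond_exp_cong)
      show "AE \<omega> in M. (Z \<omega> $ a - cond_mean M (gen_sigma M T) Z \<omega> $ a) *
          (Z \<omega> $ b - cond_mean M (gen_sigma M T) Z \<omega> $ b)
        = (?Z \<omega> $ a - m (T \<omega>) $ a) * (?Z \<omega> $ b - m (T \<omega>) $ b)"
        using mean AE_space by eventually_elim (simp add: Z)
    qed (simp_all add: cond_mean_def)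
    moreover have "AE \<omega> in M. real_cond_exp M (gen_sigma M T) (\<lambda>\<omega>.
        (?Z \<omega> $ a - m (T \<omega>) $ a) * (?Z \<omega> $ b - m (T \<omega>) $ b)) \<omega> = K (T \<omega>) $ a $ b"
      by (rule real_cond_exp_freeze[OF ind _ K]) measurable
    ultimately show ?thesis by eventually_elim (simp add: cond_cov_def)
  qed
  then have "AE \<omega> in M. \<forall>a b. cond_cov M (gen_sigma M T) Z \<omega> $ a $ b = K (T \<omega>) $ a $ b"
    by (simp add: AE_all_countable)
  then show "AE \<omega> in M. cond_cov M (gen_sigma M T) Z \<omega> = K (T \<omega>)"
    by eventually_elim (simp add: vec_eq_iff)
qed

end

section \<open>Uncorrelated random vectors\<close>

lemma matrix_sum_nth: "(\<Sum>i\<in>I. P i) $ a $ b = (\<Sum>i\<in>I. P i $ a $ b)"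
  for P :: "'i \<Rightarrow> real^'k^'m"
  by (simp add: sum_component)

lemma double_sum_product:
  fixes f :: "'a \<Rightarrow> 'b \<Rightarrow> real" and g :: "'c \<Rightarrow> 'd \<Rightarrow> real"
  shows "(\<Sum>i\<in>I. \<Sum>c\<in>J. f i c) * (\<Sum>j\<in>I'. \<Sum>d\<in>J'. g j d)
    = (\<Sum>i\<in>I. \<Sum>c\<in>J. \<Sum>j\<in>I'. \<Sum>d\<in>J'. f i c * g j d)"
proof -
  have left: "(\<Sum>i\<in>I. \<Sum>c\<in>J. f i c) * r = (\<Sum>i\<in>I. \<Sum>c\<in>J. f i c * r)" for r
    by (simp only: sum_distrib_right)
  have right: "r * (\<Sum>j\<in>I'. \<Sum>d\<in>J'. g j d) = (\<Sum>j\<in>I'. \<Sum>d\<in>J'. r * g j d)" for r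
    by (simp only: sum_distrib_left)
  show ?thesis unfolding left unfolding right ..
qed

text \<open>All bilinear computations with the noise reduce to this: in the double sum over the indices only
  the diagonal blocks survive.\<close>

lemma uncorrelated_linear_moments:
  fixes U :: "'i::finite \<Rightarrow> 'e \<Rightarrow> real^'m" and P Q :: "'i \<Rightarrow> real^'m^'q"
  assumes mean: "\<And>i a. has_bochner_integral N (\<lambda>e. U i e $ a) 0"
    and cov: "\<And>i j a b. has_bochner_integral N (\<lambda>e. U i e $ a * U j e $ b)
                (if i = j then V i $ a $ b else 0)"
  shows uncorrelated_linear_mean:
      "has_bochner_integral N (\<lambda>e. (\<Sum>i\<in>UNIV. P i *v U i e) $ a) 0"
    and uncorrelated_linear_cov:
      "has_bochner_integral N (\<lambda>e. (\<Sum>i\<in>UNIV. P i *v U i e) $ a * (\<Sum>i\<in>UNIV. Q i *v U i e) $ b)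
         ((\<Sum>i\<in>UNIV. P i ** V i ** transpose (Q i)) $ a $ b)"
proof -
  have lin: "(\<Sum>i\<in>UNIV. R i *v U i e) $ a = (\<Sum>i\<in>UNIV. \<Sum>c\<in>UNIV. R i $ a $ c * U i e $ c)"
    for R :: "'i \<Rightarrow> real^'m^'q" and a e
    by (simp add: matrix_vector_mult_def)
  have "has_bochner_integral N (\<lambda>e. \<Sum>i\<in>UNIV. \<Sum>c\<in>UNIV. P i $ a $ c * U i e $ c)
      (\<Sum>i\<in>(UNIV::'i set). \<Sum>c\<in>(UNIV::'m set). P i $ a $ c * 0)"
    by (intro has_bochner_integral_sum has_bochner_integral_mult_right mean)
  then show "has_bochner_integral N (\<lambda>e. (\<Sum>i\<in>UNIV. P i *v U i e) $ a) 0"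
    by (simp only: lin) simp
  have prod: "(\<Sum>i\<in>UNIV. P i *v U i e) $ a * (\<Sum>i\<in>UNIV. Q i *v U i e) $ b =
      (\<Sum>i\<in>UNIV. \<Sum>c\<in>UNIV. \<Sum>j\<in>UNIV. \<Sum>d\<in>UNIV.
        (P i $ a $ c * Q j $ b $ d) * (U i e $ c * U j e $ d))" for e
    unfolding lin double_sum_product by (intro sum.cong refl) (simp only: mult_ac)
  have val: "(\<Sum>i\<in>UNIV. P i ** V i ** transpose (Q i)) $ a $ b =
      (\<Sum>i\<in>UNIV. \<Sum>c\<in>UNIV. \<Sum>j\<in>UNIV. \<Sum>d\<in>UNIV.
        (P i $ a $ c * Q j $ b $ d) * (if i = j then V i $ c $ d else 0))"
  proof -
    have "(\<Sum>j\<in>UNIV. \<Sum>d\<in>UNIV. (P i $ a $ c * Q j $ b $ d) * (if i = j then V i $ c $ d else 0))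
        = (\<Sum>j\<in>UNIV. if i = j then \<Sum>d\<in>UNIV. (P i $ a $ c * Q i $ b $ d) * V i $ c $ d else 0)"
      for i c by (intro sum.cong) auto
    moreover have "(P i ** V i ** transpose (Q i)) $ a $ b
        = (\<Sum>c\<in>UNIV. \<Sum>d\<in>UNIV. (P i $ a $ c * Q i $ b $ d) * V i $ c $ d)" for i
      by (subst sum.swap) (simp add: matrix_matrix_mult_def transpose_def sum_distrib_right
          sum_distrib_left ac_simps)
    ultimately show ?thesis by (simp add: matrix_sum_nth)
  qed
  show "has_bochner_integral N
      (\<lambda>e. (\<Sum>i\<in>UNIV. P i *v U i e) $ a * (\<Sum>i\<in>UNIV. Q i *v U i e) $ b)
      ((\<Sum>i\<in>UNIV. P i ** V i ** transpose (Q i)) $ a $ b)"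
    unfolding prod val
    by (intro has_bochner_integral_sum has_bochner_integral_mult_right cov)
qed

text \<open>The decomposition of a mean square into squared bias and total variance.\<close>

lemma uncorrelated_norm_square:
  fixes U :: "'i::finite \<Rightarrow> 'e \<Rightarrow> real^'m" and P :: "'i \<Rightarrow> real^'m^'q"
  assumes N: "prob_space N"
    and mean: "\<And>i a. has_bochner_integral N (\<lambda>e. U i e $ a) 0"
    and cov: "\<And>i j a b. has_bochner_integral N (\<lambda>e. U i e $ a * U j e $ b)
                (if i = j then V i $ a $ b else 0)"
  shows "has_bochner_integral N (\<lambda>e. (norm (v + (\<Sum>i\<in>UNIV. P i *v U i e)))\<^sup>2)
           ((norm v)\<^sup>2 + (\<Sum>i\<in>UNIV. trace (P i ** V i ** transpose (P i))))"
proof -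
  interpret prob_space N by fact
  let ?L = "\<lambda>e. \<Sum>i\<in>UNIV. P i *v U i e"
  have expand: "(norm (v + ?L e))\<^sup>2 =
      (\<Sum>a\<in>UNIV. (v $ a)\<^sup>2 + 2 * v $ a * ?L e $ a + ?L e $ a * ?L e $ a)" for e
    by (simp only: power2_norm_eq_inner inner_vec_def) (simp add: power2_eq_square algebra_simps)
  have "has_bochner_integral N
      (\<lambda>e. \<Sum>a\<in>UNIV. (v $ a)\<^sup>2 + 2 * v $ a * ?L e $ a + ?L e $ a * ?L e $ a)
      (\<Sum>a\<in>UNIV. (v $ a)\<^sup>2 + 2 * v $ a * 0 + (\<Sum>i\<in>UNIV. P i ** V i ** transpose (P i)) $ a $ a)"
    by (intro has_bochner_integral_sum has_bochner_integral_add has_bochner_integral_mult_right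
        uncorrelated_linear_mean[OF mean cov] uncorrelated_linear_cov[OF mean cov])
      (simp add: has_bochner_integral_iff prob_space)
  moreover have "(\<Sum>a\<in>UNIV. (v $ a)\<^sup>2 + 2 * v $ a * 0 + (\<Sum>i\<in>UNIV. P i ** V i ** transpose (P i)) $ a $ a)
      = (norm v)\<^sup>2 + (\<Sum>i\<in>UNIV. trace (P i ** V i ** transpose (P i)))"
  proof -
    have "(norm v)\<^sup>2 = (\<Sum>a\<in>UNIV. (v $ a)\<^sup>2)"
      by (simp only: power2_norm_eq_inner inner_vec_def) (simp add: power2_eq_square)
    moreover have "(\<Sum>a\<in>UNIV. \<Sum>i\<in>UNIV. (P i ** V i ** transpose (P i)) $ a $ a)
        = (\<Sum>i\<in>UNIV. trace (P i ** V i ** transpose (P i)))"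
      unfolding trace_def by (rule sum.swap)
    ultimately show ?thesis by (simp add: sum.distrib matrix_sum_nth)
  qed
  ultimately show ?thesis by (simp only: expand)
qed

section \<open>Laws of independent and identically distributed families\<close>

lemma iid_compose:
  assumes "prob_space M" "iid M Z I" and [measurable]: "f \<in> borel_measurable borel"
  shows "iid M (\<lambda>i \<omega>. f (Z i \<omega>)) I"
proof -
  interpret prob_space M by fact
  have ind: "indep_vars (\<lambda>_. borel) Z I" using assms(2) by (simp add: iid_def)
  have "distr M borel (\<lambda>\<omega>. f (Z i \<omega>)) = distr (distr M borel (Z i)) borel f" if "i \<in> I" for i
    using ind that by (subst distr_distr) (auto simp: indep_vars_def comp_def)
  moreover have "distr M borel (Z i) = distr M borel (Z j)" if "i \<in> I" "j \<in> I" for i j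
    using assms(2) that unfolding iid_def by blast
  moreover have "indep_vars (\<lambda>_. borel) (\<lambda>i \<omega>. f (Z i \<omega>)) I"
    by (rule indep_vars_compose2[OF ind]) simp
  ultimately show ?thesis unfolding iid_def by metis
qed

lemma iid_measurable:
  assumes "prob_space M" "iid M Z I" "i \<in> I"
  shows "Z i \<in> borel_measurable M"
proof -
  interpret prob_space M by fact
  show ?thesis using assms(2,3) by (simp add: iid_def indep_vars_def)
qed

lemma (in prob_space) indep_vars_inj_reindex:
  assumes ind: "indep_vars N Z UNIV" and \<sigma>: "inj \<sigma>"
  shows "indep_vars (\<lambda>q. N (\<sigma> q)) (\<lambda>q. Z (\<sigma> q)) UNIV"
proof -
  let ?F = "\<lambda>i. {Z i -` A \<inter> space M | A. A \<in> sets (N i)}"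
  have F: "indep_sets ?F UNIV" and rv: "\<And>i. random_variable (N i) (Z i)"
    using ind by (auto simp: indep_vars_def2)
  have "indep_sets (\<lambda>q. ?F (\<sigma> q)) UNIV"
  proof (rule indep_setsI)
    show "?F (\<sigma> q) \<subseteq> events" for q using rv by auto
    fix A J assume J: "J \<noteq> {}" "finite J" and A: "\<forall>j\<in>J. A j \<in> ?F (\<sigma> j)"
    have inv: "inv \<sigma> (\<sigma> q) = q" for q using \<sigma> by simp
    have "prob (\<Inter>i\<in>\<sigma> ` J. A (inv \<sigma> i)) = (\<Prod>i\<in>\<sigma> ` J. prob (A (inv \<sigma> i)))"
      using J A by (intro indep_setsD[OF F]) (auto simp: inv)
    then show "prob (\<Inter>j\<in>J. A j) = (\<Prod>j\<in>J. prob (A j))"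
      using prod.reindex[OF inj_on_subset[OF \<sigma> subset_UNIV],
          of "\<lambda>i. prob (A (inv \<sigma> i))" J] by (simp add: inv comp_def)
  qed
  then show ?thesis using rv by (simp add: indep_vars_def2)
qed

text \<open>The right-hand side depends on the marginal law only, which is what makes i.i.d. families, possibly
  on different probability spaces, interchangeable.\<close>

lemma law_of_iid_subfamily:
  fixes Z :: "'i \<Rightarrow> 'w \<Rightarrow> 'a::euclidean_space" and \<sigma> :: "'q::finite \<Rightarrow> 'i"
  assumes M: "prob_space M" and Z: "iid M Z UNIV" and \<sigma>: "inj \<sigma>"
  shows "distr M borel (\<lambda>\<omega>. \<chi> q. Z (\<sigma> q) \<omega>)
    = distr (PiM UNIV (\<lambda>q::'q. distr M borel (Z i))) borel (\<lambda>f. \<chi> q. f q)"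
proof -
  interpret prob_space M by fact
  have ind: "indep_vars (\<lambda>_. borel) Z UNIV" using Z by (simp add: iid_def)
  have rv [measurable]: "Z i \<in> borel_measurable M" for i using iid_measurable[OF M Z] by simp
  have "indep_vars (\<lambda>_. borel) (\<lambda>q. Z (\<sigma> q)) UNIV"
    by (rule indep_vars_inj_reindex[OF ind \<sigma>])
  then have "distr M (\<Pi>\<^sub>M q\<in>UNIV. borel) (\<lambda>\<omega>. \<lambda>q\<in>UNIV. Z (\<sigma> q) \<omega>)
      = (\<Pi>\<^sub>M q\<in>UNIV. distr M borel (Z (\<sigma> q)))"
    by (subst (asm) indep_vars_iff_distr_eq_PiM') simp_all
  also have "\<dots> = (\<Pi>\<^sub>M q\<in>UNIV. distr M borel (Z i))"
    using Z by (intro PiM_cong) (auto simp: iid_def)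
  finally have eq: "distr M (\<Pi>\<^sub>M q\<in>UNIV. borel) (\<lambda>\<omega>. \<lambda>q\<in>UNIV. Z (\<sigma> q) \<omega>)
      = (\<Pi>\<^sub>M q\<in>UNIV. distr M borel (Z i))" .
  have "(\<lambda>f. \<chi> q. f q) \<in> borel_measurable (\<Pi>\<^sub>M q\<in>(UNIV :: 'q set). (borel :: 'a measure))"
    by measurable
  then show ?thesis
    unfolding eq[symmetric] by (subst distr_distr) (auto simp: comp_def restrict_def
        intro!: measurable_PiM_single')
qed

lemma iid_subfamilies_same_law:
  fixes Z :: "'i \<Rightarrow> 'w \<Rightarrow> 'a::euclidean_space" and Z' :: "'j \<Rightarrow> 'v \<Rightarrow> 'a"
    and \<sigma> :: "'q::finite \<Rightarrow> 'i" and \<sigma>' :: "'q \<Rightarrow> 'j"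
  assumes "prob_space M" "iid M Z UNIV" "inj \<sigma>" and "prob_space M'" "iid M' Z' UNIV" "inj \<sigma>'"
    and "distr M borel (Z i) = distr M' borel (Z' j)"
  shows "distr M borel (\<lambda>\<omega>. \<chi> q. Z (\<sigma> q) \<omega>) = distr M' borel (\<lambda>\<omega>. \<chi> q. Z' (\<sigma>' q) \<omega>)"
  using assms by (simp add: law_of_iid_subfamily[where i = i] law_of_iid_subfamily[where i = j])

section \<open>Algebra of weighted least squares\<close>

lemma matrix_mult_sum_left: "(\<Sum>i\<in>I. P i) ** Q = (\<Sum>i\<in>I. P i ** Q)"
  for Q :: "real^'q^'k" and P :: "'i \<Rightarrow> real^'k^'m"
  unfolding vec_eq_iff
  by (auto simp: matrix_matrix_mult_def sum_distrib_right intro: sum.swap)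

lemma matrix_mult_sum_right: "Q ** (\<Sum>i\<in>I. P i) = (\<Sum>i\<in>I. Q ** P i)"
  for Q :: "real^'k^'q" and P :: "'i \<Rightarrow> real^'m^'k"
  unfolding vec_eq_iff
  by (auto simp: matrix_matrix_mult_def sum_distrib_left intro: sum.swap)

lemma matrix_diff_left: "(P - Q) ** R = P ** R - Q ** R" for P Q :: "real^'k^'m"
  by (simp add: vec_eq_iff matrix_matrix_mult_def left_diff_distrib sum_subtractf)

lemma matrix_diff_right: "R ** (P - Q) = R ** P - R ** Q" for P Q :: "real^'k^'m"
  by (simp add: vec_eq_iff matrix_matrix_mult_def right_diff_distrib sum_subtractf)

lemma inner_transpose_mult: "v \<bullet> (transpose P *v w) = (P *v v) \<bullet> w" for P :: "real^'k^'m"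
  by (metis dot_lmul_matrix inner_commute transpose_matrix_vector)

lemma matrix_sum_vector_mult: "(\<Sum>i\<in>I. P i) *v x = (\<Sum>i\<in>I. P i *v x)"
  for P :: "'i \<Rightarrow> real^'k^'m"
  unfolding vec_eq_iff
  by (auto simp: matrix_vector_mult_def sum_distrib_right intro: sum.swap)

lemma trace_sum: "trace (\<Sum>i\<in>I. P i) = (\<Sum>i\<in>I. trace (P i))"
  for P :: "'i \<Rightarrow> real^'m^'m"
  unfolding trace_def by (subst sum.swap) simp

lemma trace_transpose: "trace (transpose P) = trace P" for P :: "real^'m^'m"
  by (simp add: trace_def transpose_def)

text \<open>The trace equals that of \<open>R ** Q ** R\<close> with \<open>R\<close> the square root of \<open>P\<close>, a sum of values of the
  quadratic form of \<open>Q\<close>.\<close>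

lemma trace_product_nonneg:
  fixes P Q :: "real^'m^'m"
  assumes "psd P" "psd Q"
  shows "0 \<le> trace (P ** Q)"
proof -
  have "trace (P ** Q) = trace (transpose (sqrtm P) ** (Q ** sqrtm P))"
    using trace_mul_sym[of "sqrtm P" "sqrtm P ** Q"] sqrtm_square[OF assms(1)]
      transpose_sqrtm[OF assms(1)] trace_mul_sym[of "sqrtm P ** Q" "sqrtm P"]
    by (simp add: matrix_mul_assoc)
  also have "\<dots> = (\<Sum>i\<in>UNIV. column i (sqrtm P) \<bullet> (Q *v column i (sqrtm P)))"
    by (simp add: trace_def matrix_matrix_mult_def transpose_def column_def inner_vec_def
        matrix_vector_mult_def)
  also have "\<dots> \<ge> 0" using assms(2) by (simp add: psd_def sum_nonneg)
  finally show ?thesis .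
qed

lemma psd_congruence: "psd V \<Longrightarrow> psd (P ** V ** transpose P)"
  for P :: "real^'k^'m"
  unfolding psd_def
  by (metis inner_transpose_mult matrix_mul_assoc matrix_transpose_mul matrix_vector_mul_assoc
      transpose_transpose)

lemma psd_transpose_mult_self: "psd (transpose P ** P)" for P :: "real^'k^'m"
  by (simp add: psd_def matrix_transpose_mul inner_transpose_mult
      flip: matrix_vector_mul_assoc del: transpose_matrix_vector)

lemma transpose_matrix_inv:
  fixes G :: "real^'k^'k"
  assumes sym: "transpose G = G" and inv: "invertible G"
  shows "transpose (matrix_inv G) = matrix_inv G"
proof -
  have "G ** transpose (matrix_inv G) = mat 1"
    using matrix_inv_inverse(2)[OF inv, THEN arg_cong[where f = transpose]]
    by (simp add: matrix_transpose_mul sym)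
  then have "matrix_inv G ** (G ** transpose (matrix_inv G)) = matrix_inv G" by simp
  then show ?thesis by (simp add: matrix_mul_assoc matrix_inv_inverse(2)[OF inv])
qed

lemma psd_matrix_inv:
  fixes G :: "real^'k^'k"
  assumes "psd G" and inv: "invertible G"
  shows "psd (matrix_inv G)"
proof -
  have sym: "transpose G = G" using assms(1) by (simp add: psd_def)
  have "matrix_inv G ** G ** transpose (matrix_inv G) = matrix_inv G"
    by (simp add: matrix_inv_inverse(2)[OF inv] transpose_matrix_inv[OF sym inv])
  then show ?thesis using psd_congruence[OF assms(1), of "matrix_inv G"] by simp
qed

text \<open>Matrices with one block of rows for each sample index, such as the weighted design of the whole
  sample.\<close>

definition stack :: "('n::finite \<Rightarrow> real^'k^'m) \<Rightarrow> real^'k^('n \<times> 'm)" where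
  "stack P = (\<chi> r. P (fst r) $ snd r)"

lemma stack_nth: "stack P $ (i, a) = P i $ a"
  by (simp add: stack_def)

lemma blockdiag_nth: "blockdiag P $ (i, a) $ (j, b) = (if i = j then P i $ a $ b else 0)"
  by (simp add: blockdiag_def cong: if_cong)

lemma sum_prod_UNIV: "(\<Sum>r\<in>UNIV. f r) = (\<Sum>i\<in>UNIV. \<Sum>a\<in>UNIV. f (i, a))"
  for f :: "'n::finite \<times> 'm::finite \<Rightarrow> real"
  by (simp add: sum.cartesian_product UNIV_Times_UNIV[symmetric] case_prod_unfold
      del: UNIV_Times_UNIV)

lemma block_row_sum:
  fixes p :: "'m::finite \<Rightarrow> real" and q :: "'n::finite \<Rightarrow> 'm \<Rightarrow> real"
  shows "(\<Sum>j\<in>UNIV. \<Sum>c\<in>UNIV. (if i = j then p c else 0) * q j c) = (\<Sum>c\<in>UNIV. p c * q i c)"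
proof -
  have "(\<Sum>c\<in>UNIV. (if i = j then p c else 0) * q j c)
      = (if i = j then \<Sum>c\<in>UNIV. p c * q i c else 0)" for j
    by simp
  then show ?thesis by simp
qed

lemma blockdiag_mult: "blockdiag P ** blockdiag Q = blockdiag (\<lambda>i. P i ** Q i)"
  for P Q :: "'n::finite \<Rightarrow> real^'m::finite^'m"
  by (simp add: vec_eq_iff blockdiag_nth matrix_matrix_mult_def sum_prod_UNIV block_row_sum)

lemma blockdiag_mult_stack: "blockdiag P ** stack Q = stack (\<lambda>i. P i ** Q i)"
  for P :: "'n::finite \<Rightarrow> real^'m::finite^'m"
  by (simp add: vec_eq_iff blockdiag_nth stack_nth matrix_matrix_mult_def sum_prod_UNIV block_row_sum)

lemma transpose_stack_mult_stack:
  "transpose (stack P) ** stack Q = (\<Sum>i\<in>UNIV. transpose (P i) ** Q i)"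
  by (simp add: vec_eq_iff stack_nth matrix_matrix_mult_def transpose_def sum_prod_UNIV
      matrix_sum_nth)

lemma blockdiag_quadratic:
  "v \<bullet> (blockdiag P *v v) = (\<Sum>i\<in>UNIV. (\<chi> a. v $ (i, a)) \<bullet> (P i *v (\<chi> a. v $ (i, a))))"
  for P :: "'n::finite \<Rightarrow> real^'m::finite^'m"
  by (simp add: inner_vec_def matrix_vector_mult_def blockdiag_nth sum_prod_UNIV block_row_sum)

lemma psd_blockdiag:
  fixes P :: "'n::finite \<Rightarrow> real^'m::finite^'m"
  assumes "\<And>i. psd (P i)"
  shows "psd (blockdiag P)"
proof -
  have sym: "P i $ a $ b = P i $ b $ a" for i a b
    using assms[of i] by (auto simp: psd_def vec_eq_iff transpose_def)
  have "transpose (blockdiag P) = blockdiag P"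
    by (auto simp: vec_eq_iff transpose_def blockdiag_nth sym)
  moreover have "0 \<le> v \<bullet> (blockdiag P *v v)" for v
    using assms by (simp add: blockdiag_quadratic psd_def sum_nonneg)
  ultimately show ?thesis by (simp add: psd_def)
qed

lemma sqrtm_blockdiag:
  fixes P :: "'n::finite \<Rightarrow> real^'m::finite^'m"
  assumes "\<And>i. psd (P i)"
  shows "sqrtm (blockdiag P) = blockdiag (\<lambda>i. sqrtm (P i))"
  using assms by (intro sqrtm_eqI psd_blockdiag psd_sqrtm)
    (simp_all add: blockdiag_mult sqrtm_square)

text \<open>The estimator is linear in the responses with these coefficients.\<close>

definition wls_coef ::
  "('k::finite, 'p::finite) weight \<Rightarrow> ('k, 'p) covariate^'n::finite \<Rightarrow> 'n \<Rightarrow> real^('p \<times> 'p)^'k"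
  where
  "wls_coef W xs i = matrix_inv (gram W xs) ** (transpose (design (xs $ i)) ** W (xs $ i))"

text \<open>The conditional mean of the estimator, which is the weighted least squares fit to the true
  covariance function.\<close>

definition wls_mean ::
  "(('k::finite, 'p::finite) covariate \<Rightarrow> real^'p^'p) \<Rightarrow> ('k, 'p) weight \<Rightarrow>
   ('k, 'p) covariate^'n::finite \<Rightarrow> real^'k" where
  "wls_mean C W xs = (\<Sum>i\<in>UNIV. wls_coef W xs i *v vecm (C (xs $ i)))"

text \<open>The conditional covariance of the estimator when \<open>V\<close> is the covariance function of the
  responses.\<close>

definition wls_cov ::
  "('k::finite, 'p::finite) weight \<Rightarrow> ('k, 'p) weight \<Rightarrow> ('k, 'p) covariate^'n::finite \<Rightarrow> real^'k^'k"
  where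
  "wls_cov V W xs = (\<Sum>i\<in>UNIV. wls_coef W xs i ** V (xs $ i) ** transpose (wls_coef W xs i))"

text \<open>The conditional covariance of the score \<open>\<Sum>i. transpose (design x) ** W x *v vec_outer y\<close>, the
  middle factor of the sandwich.\<close>

definition score_cov ::
  "('k::finite, 'p::finite) weight \<Rightarrow> ('k, 'p) weight \<Rightarrow> ('k, 'p) covariate^'n::finite \<Rightarrow> real^'k^'k"
  where
  "score_cov V W xs =
     (\<Sum>i\<in>UNIV. transpose (design (xs $ i)) ** W (xs $ i) ** V (xs $ i) ** W (xs $ i) ** design (xs $ i))"

definition fit_bias ::
  "(('k::finite, 'p::finite) covariate \<Rightarrow> real^'p^'p) \<Rightarrow> ('k, 'p) weight \<Rightarrow>
   ('k, 'p) covariate^'n::finite \<Rightarrow> ('k, 'p) covariate \<Rightarrow> real" where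
  "fit_bias C W xs x = (norm (X_tilde W x *v wls_mean C W xs - C_tilde C W x))\<^sup>2"

definition point_gram ::
  "('k::finite, 'p::finite) weight \<Rightarrow> ('k, 'p) covariate \<Rightarrow> real^'k^'k" where
  "point_gram W x = transpose (X_tilde W x) ** X_tilde W x"

definition fit_var ::
  "('k::finite, 'p::finite) weight \<Rightarrow> ('k, 'p) weight \<Rightarrow>
   ('k, 'p) covariate^'n::finite \<Rightarrow> ('k, 'p) covariate \<Rightarrow> real" where
  "fit_var V W xs x = trace (wls_cov V W xs ** point_gram W x)"

lemma design_mult: "design x *v \<beta> = vecm (lin_cov \<beta> x)"
  by (simp add: vec_eq_iff design_def vecm_def lin_cov_def matrix_vector_mult_def matrix_sum_nth
      mult.commute)

locale weighted_regression =
  fixes C :: "('k::finite, 'p::finite) covariate \<Rightarrow> real^'p^'p" and W :: "('k, 'p) weight"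
  assumes C_meas [measurable]: "C \<in> borel_measurable borel" and C_posdef: "posdef (C x)"
    and W_meas [measurable]: "W \<in> borel_measurable borel" and W_psd: "psd (W x)"
begin

lemma sqrtm_W [simp]: "sqrtm (W x) ** sqrtm (W x) = W x" "transpose (sqrtm (W x)) = sqrtm (W x)"
  using W_psd by (simp_all add: sqrtm_square transpose_sqrtm)

lemma sqrtm_W_mult:
  fixes P :: "real^('p \<times> 'p)^'a" and Q :: "real^'b^('p \<times> 'p)"
  shows "P ** sqrtm (W x) ** (sqrtm (W x) ** Q) = P ** W x ** Q"
  by (metis matrix_mul_assoc sqrtm_W(1))

lemma transpose_W [simp]: "transpose (W x) = W x"
  using W_psd by (simp add: psd_def)

lemma transpose_X_tilde: "transpose (X_tilde W x) = transpose (design x) ** sqrtm (W x)"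
  by (simp add: X_tilde_def matrix_transpose_mul)

lemma X_tilde_sqrtm:
  "transpose (X_tilde W x) ** sqrtm (W x) = transpose (design x) ** W x"
  by (simp add: transpose_X_tilde flip: matrix_mul_assoc)

lemma point_gram_eq: "point_gram W x = transpose (design x) ** W x ** design x"
  by (simp add: point_gram_def X_tilde_def matrix_mul_assoc X_tilde_sqrtm[unfolded X_tilde_def])

lemma XX_tilde_eq: "XX_tilde W xs = stack (\<lambda>i. X_tilde W (xs $ i))"
  by (simp add: XX_tilde_def stack_def vec_eq_iff)

lemma gram_eq: "gram W xs = (\<Sum>i\<in>UNIV. point_gram W (xs $ i))"
  by (simp add: gram_def XX_tilde_eq transpose_stack_mult_stack point_gram_def)

lemma psd_point_gram: "psd (point_gram W x)"
  unfolding point_gram_def by (rule psd_transpose_mult_self)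

lemma transpose_gram: "transpose (gram W xs) = gram W xs"
  by (simp add: gram_def matrix_transpose_mul)

lemma psd_gram: "psd (gram W xs)"
  unfolding gram_def by (rule psd_transpose_mult_self)

lemma wls_eq: "wls W xs ys = (\<Sum>i\<in>UNIV. wls_coef W xs i *v vec_outer (ys $ i))"
  by (simp add: wls_def wls_coef_def gram_eq point_gram_eq matrix_vector_mul_assoc[symmetric]
      vec.sum)

lemma C_hat_eq: "C_hat W xs ys x = design x *v wls W xs ys"
  by (simp add: C_hat_def design_mult)

lemma loss_eq: "loss (W x) y c = (norm (sqrtm (W x) *v (y - c)))\<^sup>2"
proof -
  have "(norm (sqrtm (W x) *v (y - c)))\<^sup>2 = (y - c) \<bullet> (sqrtm (W x) *v (sqrtm (W x) *v (y - c)))"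
    by (simp add: power2_norm_eq_inner inner_symmetric_matrix)
  then show ?thesis by (simp add: loss_def matrix_vector_mul_assoc)
qed

lemma hat_cov_eq:
  assumes "\<And>i. V_cov M X Y (Inl i) \<omega> = V (X (Inl i) \<omega>)"
  shows "hat_cov M W X Y \<omega> = matrix_inv (gram W (train X \<omega>)) ** score_cov V W (train X \<omega>)"
proof -
  let ?xs = "train X \<omega>"
  have "sqrtm (WW W ?xs) = blockdiag (\<lambda>i. sqrtm (W (?xs $ i)))"
    unfolding WW_def by (rule sqrtm_blockdiag) (rule W_psd)
  then have "VV_tilde M W X Y \<omega> ** XX_tilde W ?xs
      = stack (\<lambda>i. sqrtm (W (?xs $ i)) ** V (?xs $ i) ** W (?xs $ i) ** design (?xs $ i))"
    by (simp add: VV_tilde_def VV_def assms XX_tilde_eq blockdiag_mult blockdiag_mult_stack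
        X_tilde_def train_def sqrtm_W_mult)
  then have "transpose (XX_tilde W ?xs) ** (VV_tilde M W X Y \<omega> ** XX_tilde W ?xs)
      = score_cov V W ?xs"
    by (simp add: XX_tilde_eq transpose_stack_mult_stack score_cov_def matrix_mul_assoc
        X_tilde_sqrtm)
  then show ?thesis by (simp add: hat_cov_def flip: matrix_mul_assoc)
qed

lemma wls_cov_eq:
  assumes "invertible (gram W xs)"
  shows "wls_cov V W xs = matrix_inv (gram W xs) ** score_cov V W xs ** matrix_inv (gram W xs)"
  by (simp add: wls_cov_def score_cov_def wls_coef_def matrix_transpose_mul matrix_mult_sum_left
      matrix_mult_sum_right transpose_matrix_inv[OF transpose_gram assms] matrix_mul_assoc)

lemma sum_fit_var:
  assumes "invertible (gram W xs)"
  shows "(\<Sum>i\<in>UNIV. fit_var V W xs (xs $ i)) = trace (matrix_inv (gram W xs) ** score_cov V W xs)"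
proof -
  have "(\<Sum>i\<in>UNIV. fit_var V W xs (xs $ i)) = trace (wls_cov V W xs ** gram W xs)"
    by (simp add: fit_var_def gram_eq matrix_mult_sum_right trace_sum)
  also have "wls_cov V W xs ** gram W xs = matrix_inv (gram W xs) ** score_cov V W xs"
    by (simp add: wls_cov_eq[OF assms] matrix_inv_inverse[OF assms] flip: matrix_mul_assoc)
  finally show ?thesis .
qed

text \<open>The residuals of \<open>wls_mean\<close> satisfy the normal equations, so by Pythagoras every other coefficient
  vector adds a nonnegative term.\<close>

lemma least_squares_minimal:
  assumes "invertible (gram W xs)"
  shows "(\<Sum>i\<in>UNIV. fit_bias C W xs (xs $ i))
    \<le> (\<Sum>i\<in>UNIV. (norm (X_tilde W (xs $ i) *v \<beta> - C_tilde C W (xs $ i)))\<^sup>2)"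
proof -
  define r where "r i = X_tilde W (xs $ i) *v wls_mean C W xs - C_tilde C W (xs $ i)" for i
  define \<delta> where "\<delta> = \<beta> - wls_mean C W xs"
  have "(\<Sum>i\<in>UNIV. transpose (X_tilde W (xs $ i)) *v r i)
      = gram W xs *v wls_mean C W xs
        - (\<Sum>i\<in>UNIV. (transpose (design (xs $ i)) ** W (xs $ i)) *v vecm (C (xs $ i)))"
    by (simp add: r_def matrix_vector_mult_diff_distrib sum_subtractf matrix_vector_mul_assoc
        C_tilde_def X_tilde_sqrtm gram_eq point_gram_def matrix_sum_vector_mult)
  also have "gram W xs *v wls_mean C W xs
      = (gram W xs ** matrix_inv (gram W xs)) *v
        (\<Sum>i\<in>UNIV. (transpose (design (xs $ i)) ** W (xs $ i)) *v vecm (C (xs $ i)))"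
    by (simp add: wls_mean_def wls_coef_def vec.sum matrix_vector_mul_assoc matrix_mul_assoc)
  finally have normal: "(\<Sum>i\<in>UNIV. transpose (X_tilde W (xs $ i)) *v r i) = 0"
    by (simp add: matrix_inv_inverse(1)[OF assms])
  have "(norm (X_tilde W (xs $ i) *v \<beta> - C_tilde C W (xs $ i)))\<^sup>2
      = (norm (r i))\<^sup>2 + (norm (X_tilde W (xs $ i) *v \<delta>))\<^sup>2
        + 2 * (\<delta> \<bullet> (transpose (X_tilde W (xs $ i)) *v r i))" for i
  proof -
    have "X_tilde W (xs $ i) *v \<beta> - C_tilde C W (xs $ i) = r i + X_tilde W (xs $ i) *v \<delta>"
      by (simp add: r_def \<delta>_def matrix_vector_mult_diff_distrib)
    moreover have "r i \<bullet> (X_tilde W (xs $ i) *v \<delta>) = \<delta> \<bullet> (transpose (X_tilde W (xs $ i)) *v r i)"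
      by (metis dot_lmul_matrix inner_commute transpose_matrix_vector)
    ultimately show ?thesis
      by (simp add: power2_norm_eq_inner inner_add_left inner_add_right inner_commute)
  qed
  then have "(\<Sum>i\<in>UNIV. (norm (X_tilde W (xs $ i) *v \<beta> - C_tilde C W (xs $ i)))\<^sup>2)
      = (\<Sum>i\<in>UNIV. (norm (r i))\<^sup>2) + (\<Sum>i\<in>UNIV. (norm (X_tilde W (xs $ i) *v \<delta>))\<^sup>2)
        + 2 * (\<delta> \<bullet> (\<Sum>i\<in>UNIV. transpose (X_tilde W (xs $ i)) *v r i))"
    by (simp add: sum.distrib inner_sum_right sum_distrib_left)
  also have "\<dots> \<ge> (\<Sum>i\<in>UNIV. (norm (r i))\<^sup>2)"
    unfolding normal by (simp add: sum_nonneg)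
  finally show ?thesis by (simp add: fit_bias_def r_def)
qed

text \<open>All these are sums over the sample, hence blind to its order.\<close>

lemma permute_sample:
  assumes "bij \<pi>"
  shows "gram W (\<chi> i. xs $ \<pi> i) = gram W xs"
    and "wls_mean C W (\<chi> i. xs $ \<pi> i) = wls_mean C W xs"
    and "wls_cov V W (\<chi> i. xs $ \<pi> i) = wls_cov V W xs"
proof -
  show g: "gram W (\<chi> i. xs $ \<pi> i) = gram W xs"
    unfolding gram_eq using sum.reindex_bij_betw[OF assms, of "\<lambda>i. point_gram W (xs $ i)"] by simp
  have c: "wls_coef W (\<chi> i. xs $ \<pi> i) i = wls_coef W xs (\<pi> i)" for i
    by (simp add: wls_coef_def g)
  show "wls_mean C W (\<chi> i. xs $ \<pi> i) = wls_mean C W xs"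
    unfolding wls_mean_def c
    using sum.reindex_bij_betw[OF assms, of "\<lambda>i. wls_coef W xs i *v vecm (C (xs $ i))"] by simp
  show "wls_cov V W (\<chi> i. xs $ \<pi> i) = wls_cov V W xs"
    unfolding wls_cov_def c
    using sum.reindex_bij_betw[OF assms,
        of "\<lambda>i. wls_coef W xs i ** V (xs $ i) ** transpose (wls_coef W xs i)"] by simp
qed

end

text \<open>The difference of the two sides is the trace of the product of the positive semidefinite matrices
  \<open>matrix_inv A\<close> and \<open>(A - G) ** matrix_inv G ** (A - G)\<close>. For scalars it is the inequality
  \<open>a / g + g / a \<ge> 2\<close>. It is linear in \<open>G\<close> and in its inverse, so that it can be averaged over a
  random \<open>G\<close> with \<open>A\<close> the mean of \<open>G\<close>.\<close>

lemma trace_inverse_product_ge: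
  fixes G A :: "real^'k^'k"
  assumes G: "psd G" "invertible G" and A: "psd A" "invertible A"
  shows "2 * real CARD('k) \<le> trace (matrix_inv G ** A) + trace (matrix_inv A ** G)"
proof -
  let ?H = "matrix_inv G" and ?B = "matrix_inv A"
  have "psd ((A - G) ** ?H ** transpose (A - G))"
    by (intro psd_congruence psd_matrix_inv G)
  moreover have "transpose (A - G) = A - G"
    using G(1) A(1) by (simp add: psd_def transpose_def vec_eq_iff)
  ultimately have "0 \<le> trace (?B ** ((A - G) ** ?H ** (A - G)))"
    using trace_product_nonneg[OF psd_matrix_inv[OF A]] by simp
  also have "?B ** ((A - G) ** ?H ** (A - G)) = ?H ** A - mat 1 - mat 1 + ?B ** G"
  proof -
    have "?B ** ((A - G) ** ?H ** (A - G)) = (?B ** A - ?B ** G) ** (?H ** A - ?H ** G)"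
      by (simp add: matrix_mul_assoc matrix_diff_left matrix_diff_right)
    also have "\<dots> = ?H ** A - mat 1 - (?B ** G ** ?H ** A - ?B ** G)"
      by (simp add: matrix_mul_assoc matrix_diff_left matrix_diff_right
          matrix_inv_inverse[OF G(2)] matrix_inv_inverse[OF A(2)])
    also have "?B ** G ** ?H ** A = mat 1"
      by (simp add: matrix_inv_inverse[OF G(2)] matrix_inv_inverse[OF A(2)]
          matrix_mul_assoc[symmetric])
    finally show ?thesis by simp
  qed
  finally have "0 \<le> trace (?H ** A) - trace (mat 1 :: real^'k^'k) - trace (mat 1 :: real^'k^'k)
      + trace (?B ** G)" by (simp only: trace_add trace_sub)
  then show ?thesis by (simp add: trace_I)
qed

section \<open>Moments of the errors\<close>

definition noise ::
  "(('k::finite, 'p::finite) covariate \<Rightarrow> real^'p^'p) \<Rightarrow> ('k, 'p) covariate \<Rightarrow> real^'p \<Rightarrow> real^('p \<times> 'p)"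
  where
  "noise C x e = vec_outer (sqrtm (C x) *v e) - vecm (C x)"

definition noise_cov ::
  "(('k::finite, 'p::finite) covariate \<Rightarrow> real^'p^'p) \<Rightarrow> (real^'p) measure \<Rightarrow> ('k, 'p) weight" where
  "noise_cov C D x = (\<chi> a b. \<integral>e. noise C x e $ a * noise C x e $ b \<partial>D)"

lemma quartic_monomial_bound:
  "\<bar>(a * b) * (c * d)\<bar> \<le> a ^ 4 + b ^ 4 + c ^ 4 + d ^ 4" for a b c d :: real
proof -
  have sq: "\<bar>u * v\<bar> \<le> u\<^sup>2 + v\<^sup>2" for u v :: real
  proof -
    have "2 * (\<bar>u\<bar> * \<bar>v\<bar>) \<le> u\<^sup>2 + v\<^sup>2"
      using sum_squares_bound[of "\<bar>u\<bar>" "\<bar>v\<bar>"] by simp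
    moreover have "0 \<le> \<bar>u\<bar> * \<bar>v\<bar>" by simp
    ultimately show ?thesis unfolding abs_mult by linarith
  qed
  have "\<bar>(a * b) * (c * d)\<bar> \<le> (a * b)\<^sup>2 + (c * d)\<^sup>2" by (rule sq)
  also have "\<dots> = a\<^sup>2 * b\<^sup>2 + c\<^sup>2 * d\<^sup>2" by (simp add: power_mult_distrib)
  also have "\<dots> \<le> ((a\<^sup>2)\<^sup>2 + (b\<^sup>2)\<^sup>2) + ((c\<^sup>2)\<^sup>2 + (d\<^sup>2)\<^sup>2)"
    using sq[of "a\<^sup>2" "b\<^sup>2"] sq[of "c\<^sup>2" "d\<^sup>2"] by (intro add_mono) (auto dest: abs_le_D1)
  finally show ?thesis by (simp add: power_mult[symmetric])
qed

context weighted_regression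
begin

lemma measurable_sqrtm_W [measurable (raw)]:
  assumes [measurable]: "f \<in> borel_measurable N"
  shows "(\<lambda>\<omega>. sqrtm (W (f \<omega>))) \<in> borel_measurable N"
  by (rule measurable_sqrtm) (use W_psd in measurable)

lemma C_psd: "psd (C x)"
  using C_posdef by (rule posdef_imp_psd)

lemma measurable_sqrtm_C [measurable (raw)]:
  assumes [measurable]: "f \<in> borel_measurable N"
  shows "(\<lambda>\<omega>. sqrtm (C (f \<omega>))) \<in> borel_measurable N"
  by (rule measurable_sqrtm) (use C_psd in measurable)

lemma measurable_X_tilde [measurable (raw)]:
  assumes [measurable]: "f \<in> borel_measurable N"
  shows "(\<lambda>\<omega>. X_tilde W (f \<omega>)) \<in> borel_measurable N"
  unfolding X_tilde_def by measurable

lemma measurable_C_tilde [measurable (raw)]: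
  assumes [measurable]: "f \<in> borel_measurable N"
  shows "(\<lambda>\<omega>. C_tilde C W (f \<omega>)) \<in> borel_measurable N"
  unfolding C_tilde_def by measurable

lemma measurable_point_gram [measurable (raw)]:
  assumes [measurable]: "f \<in> borel_measurable N"
  shows "(\<lambda>\<omega>. point_gram W (f \<omega>)) \<in> borel_measurable N"
  unfolding point_gram_def by measurable

lemma measurable_gram [measurable (raw)]:
  assumes [measurable]: "xs \<in> borel_measurable N"
  shows "(\<lambda>\<omega>. gram W (xs \<omega>)) \<in> borel_measurable N"
  unfolding gram_eq by measurable

lemma measurable_wls_coef [measurable (raw)]:
  assumes [measurable]: "xs \<in> borel_measurable N"
  shows "(\<lambda>\<omega>. wls_coef W (xs \<omega>) i) \<in> borel_measurable N"
  unfolding wls_coef_def by measurable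

lemma measurable_wls_mean [measurable (raw)]:
  assumes [measurable]: "xs \<in> borel_measurable N"
  shows "(\<lambda>\<omega>. wls_mean C W (xs \<omega>)) \<in> borel_measurable N"
  unfolding wls_mean_def by measurable

lemma measurable_wls_cov [measurable (raw)]:
  assumes [measurable]: "xs \<in> borel_measurable N" "V \<in> borel_measurable borel"
  shows "(\<lambda>\<omega>. wls_cov V W (xs \<omega>)) \<in> borel_measurable N"
  unfolding wls_cov_def by measurable

lemma measurable_fit_bias [measurable (raw)]:
  assumes [measurable]: "xs \<in> borel_measurable N" "x \<in> borel_measurable N"
  shows "(\<lambda>\<omega>. fit_bias C W (xs \<omega>) (x \<omega>)) \<in> borel_measurable N"
  unfolding fit_bias_def by measurable

lemma measurable_fit_var [measurable (raw)]:
  assumes [measurable]: "xs \<in> borel_measurable N" "x \<in> borel_measurable N"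
    "V \<in> borel_measurable borel"
  shows "(\<lambda>\<omega>. fit_var V W (xs \<omega>) (x \<omega>)) \<in> borel_measurable N"
  unfolding fit_var_def by measurable

lemma measurable_noise [measurable (raw)]:
  assumes [measurable]: "x \<in> borel_measurable N" "e \<in> borel_measurable N"
  shows "(\<lambda>\<omega>. noise C (x \<omega>) (e \<omega>)) \<in> borel_measurable N"
  unfolding noise_def by measurable

text \<open>The noise is a fixed linear image of the matrix with entries \<open>e $ j * e $ k\<close> less the identity,
  because \<open>C x\<close> is the image of the identity matrix. Its moments thus come from those of products of
  error components.\<close>

lemma noise_nth:
  "noise C x e $ (i, l) = (\<Sum>j\<in>UNIV. \<Sum>k\<in>UNIV. (sqrtm (C x) $ i $ j * sqrtm (C x) $ l $ k) *
     (e $ j * e $ k - (if j = k then 1 else 0)))"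
proof -
  let ?R = "sqrtm (C x)"
  have "C x $ i $ l = (?R ** transpose ?R) $ i $ l"
    using C_psd by (simp add: sqrtm_square transpose_sqrtm)
  also have "\<dots> = (\<Sum>j\<in>UNIV. \<Sum>k\<in>UNIV. (?R $ i $ j * ?R $ l $ k) * (if j = k then 1 else 0))"
    by (simp add: matrix_matrix_mult_def transpose_def mult_delta_right)
  finally have "C x $ i $ l = (\<Sum>j\<in>UNIV. \<Sum>k\<in>UNIV. (?R $ i $ j * ?R $ l $ k) * (if j = k then 1 else 0))" .
  moreover have "vec_outer (?R *v e) $ (i, l) = (\<Sum>j\<in>UNIV. \<Sum>k\<in>UNIV. (?R $ i $ j * ?R $ l $ k) * (e $ j * e $ k))"
    by (simp add: vec_outer_def vecm_def matrix_vector_mult_def sum_product mult_ac)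
  ultimately show ?thesis
    by (simp add: noise_def vecm_def sum_subtractf right_diff_distrib)
qed

end

locale covariance_model = weighted_regression C W + prob_space M
  for M :: "'w measure"
    and C :: "('k::finite, 'p::finite) covariate \<Rightarrow> real^'p^'p" and W :: "('k, 'p) weight" +
  fixes \<mu>4 :: real and X :: "'n::finite + 'n \<Rightarrow> 'w \<Rightarrow> ('k, 'p) covariate"
    and Y E :: "'n + 'n \<Rightarrow> 'w \<Rightarrow> real^'p"
  assumes model: "data_model M C \<mu>4 X Y E"
begin

definition errors :: "'w \<Rightarrow> (real^'p)^('n + 'n)" where
  "errors \<omega> = (\<chi> \<alpha>. E \<alpha> \<omega>)"

text \<open>The index of the error is immaterial, since all errors have the same law.\<close>

definition V :: "('k, 'p) weight" where
  "V = noise_cov C (distr M borel (E (Inl undefined)))"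

lemma X_meas [measurable]: "X \<alpha> \<in> borel_measurable M"
  using model by (simp add: data_model_def)

lemma Y_eq: "\<omega> \<in> space M \<Longrightarrow> Y \<alpha> \<omega> = sqrtm (C (X \<alpha> \<omega>)) *v E \<alpha> \<omega>"
  using model by (simp add: data_model_def)

lemma vec_outer_Y: "\<omega> \<in> space M \<Longrightarrow> vec_outer (Y \<alpha> \<omega>) = vecm (C (X \<alpha> \<omega>)) + noise C (X \<alpha> \<omega>) (E \<alpha> \<omega>)"
  by (simp add: Y_eq noise_def)

lemma errors_iid: "iid M (\<lambda>(\<alpha>, j) \<omega>. E \<alpha> \<omega> $ j) UNIV"
  using model by (simp add: data_model_def)

lemma E_nth_meas [measurable]: "(\<lambda>\<omega>. E \<alpha> \<omega> $ j) \<in> borel_measurable M"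
  using iid_measurable[OF prob_space_axioms errors_iid, of "(\<alpha>, j)"] by simp

lemma E_meas [measurable]: "E \<alpha> \<in> borel_measurable M"
  using measurable_vec_lambda[of "\<lambda>\<omega> j. E \<alpha> \<omega> $ j" M] by simp

lemma errors_meas [measurable]: "errors \<in> borel_measurable M"
  unfolding errors_def[abs_def] by measurable

lemma errors_nth [simp]: "errors \<omega> $ \<alpha> = E \<alpha> \<omega>"
  by (simp add: errors_def)

lemma same_error_law: "distr M borel (E \<alpha>) = distr M borel (E \<beta>)"
proof -
  have "distr M borel (\<lambda>\<omega>. \<chi> j. (case (\<alpha>, j) of (\<alpha>, j) \<Rightarrow> \<lambda>\<omega>. E \<alpha> \<omega> $ j) \<omega>)
      = distr M borel (\<lambda>\<omega>. \<chi> j. (case (\<beta>, j) of (\<alpha>, j) \<Rightarrow> \<lambda>\<omega>. E \<alpha> \<omega> $ j) \<omega>)"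
    by (rule iid_subfamilies_same_law[OF prob_space_axioms errors_iid _
        prob_space_axioms errors_iid _ refl]) (auto simp: inj_on_def)
  then show ?thesis by simp
qed

text \<open>Stated for arbitrary disjoint index sets: singletons separate the components of one error vector,
  and rows \<open>{\<alpha>} \<times> UNIV\<close> separate the error vectors.\<close>

lemma independent_error_blocks:
  fixes A B :: "(('n + 'n) \<times> 'p) set" and f g :: "(('n + 'n) \<times> 'p \<Rightarrow> real) \<Rightarrow> real"
  assumes "A \<inter> B = {}"
    and [measurable]: "f \<in> borel_measurable (PiM A (\<lambda>_. borel))"
      "g \<in> borel_measurable (PiM B (\<lambda>_. borel))"
  shows "indep_var borel (\<lambda>\<omega>. f (restrict (\<lambda>q. E (fst q) \<omega> $ snd q) A))
    borel (\<lambda>\<omega>. g (restrict (\<lambda>q. E (fst q) \<omega> $ snd q) B))"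
proof -
  have "indep_vars (\<lambda>_. borel) (\<lambda>q \<omega>. E (fst q) \<omega> $ snd q) UNIV"
    using errors_iid by (simp add: iid_def case_prod_unfold)
  from indep_var_compose[OF indep_var_restrict[OF this assms(1)] assms(2,3)]
  show ?thesis by (simp add: comp_def)
qed

lemma independent_errors:
  fixes f g :: "real^'p \<Rightarrow> real"
  assumes "\<alpha> \<noteq> \<beta>" and [measurable]: "f \<in> borel_measurable borel" "g \<in> borel_measurable borel"
  shows "indep_var borel (\<lambda>\<omega>. f (E \<alpha> \<omega>)) borel (\<lambda>\<omega>. g (E \<beta> \<omega>))"
proof -
  have "(\<lambda>h. f (\<chi> j. h (\<alpha>, j))) \<in> borel_measurable (PiM ({\<alpha>} \<times> UNIV) (\<lambda>_. borel))"
    if [measurable]: "f \<in> borel_measurable borel" for \<alpha> and f :: "real^'p \<Rightarrow> real"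
    by measurable
  from independent_error_blocks[of "{\<alpha>} \<times> UNIV" "{\<beta>} \<times> UNIV", OF _ this[OF assms(2)] this[OF assms(3)]]
  show ?thesis using assms(1) by auto
qed

lemma error_moments:
  "(\<integral>\<omega>. E \<alpha> \<omega> $ j \<partial>M) = 0" "(\<integral>\<omega>. (E \<alpha> \<omega> $ j)\<^sup>2 \<partial>M) = 1"
  using model by (auto simp: data_model_def)

text \<open>The value \<open>\<mu>4\<close> of the fourth moment does not by itself give integrability, as the integral of a
  nonintegrable function is 0 by convention. The moment of order \<open>4 + \<eta>\<close> does.\<close>

lemma fourth_power_integrable: "integrable M (\<lambda>\<omega>. (E \<alpha> \<omega> $ j) ^ 4)"
proof -
  obtain \<eta> where \<eta>: "\<eta> > 0" and int: "integrable M (\<lambda>\<omega>. \<bar>E \<alpha> \<omega> $ j\<bar> powr (4 + \<eta>))"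
    using model by (auto simp: data_model_def)
  have bound: "t ^ 4 \<le> 1 + \<bar>t\<bar> powr (4 + \<eta>)" for t :: real
  proof (cases "\<bar>t\<bar> \<le> 1")
    case True
    then have "\<bar>t\<bar> ^ 4 \<le> 1" by (intro power_le_one) auto
    then show ?thesis by (simp add: add_increasing2)
  next
    case False
    then have "\<bar>t\<bar> powr 4 \<le> \<bar>t\<bar> powr (4 + \<eta>)" using \<eta> by (intro powr_mono) auto
    then show ?thesis using False by (simp add: powr_numeral)
  qed
  show ?thesis
  proof (rule Bochner_Integration.integrable_bound)
    show "integrable M (\<lambda>\<omega>. 1 + \<bar>E \<alpha> \<omega> $ j\<bar> powr (4 + \<eta>))" using int by simp
    show "AE \<omega> in M. norm ((E \<alpha> \<omega> $ j) ^ 4) \<le> norm (1 + \<bar>E \<alpha> \<omega> $ j\<bar> powr (4 + \<eta>))"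
      using bound by (auto intro!: AE_I2 simp: abs_of_nonneg add_nonneg_nonneg)
  qed simp
qed

lemma quartic_integrable:
  "integrable M (\<lambda>\<omega>. (E \<alpha> \<omega> $ i * E \<alpha> \<omega> $ j) * (E \<beta> \<omega> $ k * E \<beta> \<omega> $ l))"
proof (rule Bochner_Integration.integrable_bound)
  show "integrable M (\<lambda>\<omega>. (E \<alpha> \<omega> $ i) ^ 4 + (E \<alpha> \<omega> $ j) ^ 4 + (E \<beta> \<omega> $ k) ^ 4 + (E \<beta> \<omega> $ l) ^ 4)"
    by (intro Bochner_Integration.integrable_add fourth_power_integrable)
  show "AE \<omega> in M. norm ((E \<alpha> \<omega> $ i * E \<alpha> \<omega> $ j) * (E \<beta> \<omega> $ k * E \<beta> \<omega> $ l))
      \<le> norm ((E \<alpha> \<omega> $ i) ^ 4 + (E \<alpha> \<omega> $ j) ^ 4 + (E \<beta> \<omega> $ k) ^ 4 + (E \<beta> \<omega> $ l) ^ 4)"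
    using quartic_monomial_bound by (auto intro!: AE_I2 order_trans[OF _ abs_ge_self])
qed simp

lemma error_square_integrable: "integrable M (\<lambda>\<omega>. (E \<alpha> \<omega> $ j)\<^sup>2)"
proof (rule ccontr)
  \<comment> \<open>A nonintegrable square would have integral 0 instead of 1.\<close>
  assume "\<not> integrable M (\<lambda>\<omega>. (E \<alpha> \<omega> $ j)\<^sup>2)"
  then show False using error_moments(2)[of \<alpha> j] by (simp add: not_integrable_integral_eq)
qed

lemma error_integrable: "integrable M (\<lambda>\<omega>. E \<alpha> \<omega> $ j)"
proof (rule Bochner_Integration.integrable_bound)
  show "integrable M (\<lambda>\<omega>. 1 + (E \<alpha> \<omega> $ j)\<^sup>2)" using error_square_integrable by simp
  have "\<bar>t\<bar> \<le> 1 + t\<^sup>2" for t :: real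
    using sum_squares_bound[of 1 "\<bar>t\<bar>"] by simp
  then show "AE \<omega> in M. norm (E \<alpha> \<omega> $ j) \<le> norm (1 + (E \<alpha> \<omega> $ j)\<^sup>2)"
    by (auto intro!: AE_I2 order_trans[OF _ abs_ge_self])
qed simp

text \<open>The entries of the outer product of an error vector less its mean, the identity matrix.\<close>

definition centered :: "real^'p \<Rightarrow> 'p \<Rightarrow> 'p \<Rightarrow> real" where
  "centered e j k = e $ j * e $ k - (if j = k then 1 else 0)"

lemma centered_meas [measurable]: "(\<lambda>e. centered e j k) \<in> borel_measurable borel"
  unfolding centered_def by measurable

lemma centered_mean: "has_bochner_integral M (\<lambda>\<omega>. centered (E \<alpha> \<omega>) j k) 0"
proof (cases "j = k")
  case True
  then show ?thesis
    using error_square_integrable[of \<alpha> k] error_moments(2)[of \<alpha> k]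
    by (auto simp: centered_def has_bochner_integral_iff power2_eq_square prob_space)
next
  case False
  have "indep_var borel (\<lambda>\<omega>. E \<alpha> \<omega> $ j) borel (\<lambda>\<omega>. E \<alpha> \<omega> $ k)"
    using independent_error_blocks[of "{(\<alpha>, j)}" "{(\<alpha>, k)}" "\<lambda>h. h (\<alpha>, j)" "\<lambda>h. h (\<alpha>, k)"] False
    by simp
  from indep_var_lebesgue_integral[OF this error_integrable error_integrable]
    indep_var_integrable[OF this error_integrable error_integrable]
  show ?thesis using False by (simp add: centered_def has_bochner_integral_iff error_moments)
qed

lemma centered_product_integrable:
  "integrable M (\<lambda>\<omega>. centered (E \<alpha> \<omega>) i j * centered (E \<beta> \<omega>) k l)"
proof -
  have int: "integrable M (\<lambda>\<omega>. E \<alpha> \<omega> $ i * E \<alpha> \<omega> $ j)" for \<alpha> i j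
  proof -
    have "integrable M (\<lambda>\<omega>. centered (E \<alpha> \<omega>) i j + (if i = j then 1 else 0))"
      using centered_mean[of \<alpha> i j] by (simp add: has_bochner_integral_iff)
    then show ?thesis by (simp add: centered_def)
  qed
  show ?thesis
    using quartic_integrable[of \<alpha> i j \<beta> k l] int[of \<alpha> i j] int[of \<beta> k l]
    by (simp add: centered_def left_diff_distrib right_diff_distrib)
qed

lemma noise_integral:
  "has_bochner_integral M (\<lambda>\<omega>. noise C x (E \<alpha> \<omega>) $ a) 0"
proof (cases a)
  case (Pair i l)
  have "has_bochner_integral M (\<lambda>\<omega>. \<Sum>j\<in>UNIV. \<Sum>k\<in>UNIV. (sqrtm (C x) $ i $ j * sqrtm (C x) $ l $ k) *
      centered (E \<alpha> \<omega>) j k) (\<Sum>j\<in>UNIV. \<Sum>k\<in>UNIV. (sqrtm (C x) $ i $ j * sqrtm (C x) $ l $ k) * 0)"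
    by (intro has_bochner_integral_sum has_bochner_integral_mult_right centered_mean)
  then show ?thesis by (simp add: Pair noise_nth centered_def)
qed

lemma noise_product_integrable:
  "integrable M (\<lambda>\<omega>. noise C x (E \<alpha> \<omega>) $ a * noise C y (E \<beta> \<omega>) $ b)"
proof -
  obtain i l where a: "a = (i, l)" by (cases a)
  obtain i' l' where b: "b = (i', l')" by (cases b)
  have "integrable M (\<lambda>\<omega>. \<Sum>j\<in>UNIV. \<Sum>k\<in>UNIV. \<Sum>j'\<in>UNIV. \<Sum>k'\<in>UNIV.
      ((sqrtm (C x) $ i $ j * sqrtm (C x) $ l $ k) * (sqrtm (C y) $ i' $ j' * sqrtm (C y) $ l' $ k')) *
      (centered (E \<alpha> \<omega>) j k * centered (E \<beta> \<omega>) j' k'))"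
    by (intro Bochner_Integration.integrable_sum integrable_mult_right centered_product_integrable)
  moreover have "(\<Sum>j\<in>UNIV. \<Sum>k\<in>UNIV. \<Sum>j'\<in>UNIV. \<Sum>k'\<in>UNIV.
      ((sqrtm (C x) $ i $ j * sqrtm (C x) $ l $ k) * (sqrtm (C y) $ i' $ j' * sqrtm (C y) $ l' $ k')) *
      (centered e j k * centered f j' k')) = noise C x e $ a * noise C y f $ b" for e f
    unfolding a b noise_nth centered_def[symmetric] double_sum_product
    by (intro sum.cong refl) (simp only: mult_ac)
  ultimately show ?thesis by simp
qed

text \<open>At different indices the two factors are functions of independent error vectors and have mean
  zero. At the same index the value is \<open>V\<close> by definition, up to the choice of the error index.\<close>

lemma noise_product_integral:
  "(\<integral>\<omega>. noise C (x \<alpha>) (E \<alpha> \<omega>) $ a * noise C (x \<beta>) (E \<beta> \<omega>) $ b \<partial>M)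
    = (if \<alpha> = \<beta> then V (x \<alpha>) $ a $ b else 0)"
proof (cases "\<alpha> = \<beta>")
  case True
  have "V y $ a $ b = (\<integral>e. noise C y e $ a * noise C y e $ b \<partial>distr M borel (E \<beta>))" for y
    by (simp add: V_def noise_cov_def same_error_law[of "Inl undefined" \<beta>])
  then show ?thesis using True by (simp add: integral_distr)
next
  case False
  have "indep_var borel (\<lambda>\<omega>. noise C (x \<alpha>) (E \<alpha> \<omega>) $ a) borel (\<lambda>\<omega>. noise C (x \<beta>) (E \<beta> \<omega>) $ b)"
    by (rule independent_errors[OF False]) measurable
  then show ?thesis
    using False noise_integral[of "x \<alpha>" \<alpha> a] noise_integral[of "x \<beta>" \<beta> b]
    by (subst indep_var_lebesgue_integral) (auto simp: has_bochner_integral_iff)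
qed

lemma
  shows noise_mean: "has_bochner_integral (distr M borel errors) (\<lambda>e. noise C (x \<alpha>) (e $ \<alpha>) $ a) 0"
    and noise_covariance: "has_bochner_integral (distr M borel errors)
      (\<lambda>e. noise C (x \<alpha>) (e $ \<alpha>) $ a * noise C (x \<beta>) (e $ \<beta>) $ b)
      (if \<alpha> = \<beta> then V (x \<alpha>) $ a $ b else 0)"
  using noise_integral[of "x \<alpha>" \<alpha> a] noise_product_integrable[of "x \<alpha>" \<alpha> a "x \<beta>" \<beta> b]
    noise_product_integral[of x \<alpha> a \<beta> b]
  by (simp_all add: has_bochner_integral_iff integrable_distr_eq integral_distr)

lemma V_meas [measurable]: "V \<in> borel_measurable borel"
proof -
  interpret D: prob_space "distr M borel (E (Inl undefined))" by (rule prob_space_distr) simp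
  show ?thesis unfolding V_def noise_cov_def[abs_def] by measurable
qed

lemma psd_V: "psd (V x)"
proof -
  let ?U = "\<lambda>\<omega>. noise C x (E (Inl undefined) \<omega>)"
  have V: "V x $ a $ b = (\<integral>\<omega>. ?U \<omega> $ a * ?U \<omega> $ b \<partial>M)" for a b
    using noise_product_integral[of "\<lambda>_. x" "Inl undefined" a "Inl undefined" b] by simp
  have "v \<bullet> (V x *v v) = (\<integral>\<omega>. (v \<bullet> ?U \<omega>)\<^sup>2 \<partial>M)" for v
  proof -
    have "v \<bullet> (V x *v v) = (\<Sum>a\<in>UNIV. \<Sum>b\<in>UNIV. (\<integral>\<omega>. (v $ a * v $ b) * (?U \<omega> $ a * ?U \<omega> $ b) \<partial>M))"
      by (simp add: inner_vec_def matrix_vector_mult_def V sum_distrib_left mult_ac)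
    also have "\<dots> = (\<integral>\<omega>. (\<Sum>a\<in>UNIV. \<Sum>b\<in>UNIV. (v $ a * v $ b) * (?U \<omega> $ a * ?U \<omega> $ b)) \<partial>M)"
      using noise_product_integrable by (simp add: Bochner_Integration.integral_sum)
    also have "\<dots> = (\<integral>\<omega>. (v \<bullet> ?U \<omega>)\<^sup>2 \<partial>M)"
      unfolding power2_eq_square inner_vec_def inner_real_def sum_product
      by (intro Bochner_Integration.integral_cong sum.cong refl) (simp only: mult_ac)
    finally show ?thesis .
  qed
  moreover have "transpose (V x) = V x"
    by (simp add: vec_eq_iff transpose_def V mult.commute)
  ultimately show ?thesis by (simp add: psd_def)
qed

end

section \<open>Bias, variance and loss of the fit\<close>

lemma sum_UNIV_sum: "(\<Sum>\<alpha>\<in>UNIV. f \<alpha>) = (\<Sum>j\<in>UNIV. f (Inl j)) + (\<Sum>j\<in>UNIV. f (Inr j))"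
  for f :: "'n::finite + 'n \<Rightarrow> 'a::comm_monoid_add"
  using sum.Plus[of "UNIV :: 'n set" "UNIV :: 'n set" f] by (simp add: UNIV_Plus_UNIV comp_def)

lemma matrix_minus_left: "(- P) ** Q = - (P ** Q)" for P :: "real^'k^'m"
  by (simp add: vec_eq_iff matrix_matrix_mult_def sum_negf)

lemma matrix_minus_right: "P ** (- Q) = - (P ** Q)" for P :: "real^'k^'m"
  by (simp add: vec_eq_iff matrix_matrix_mult_def sum_negf)

lemma transpose_minus: "transpose (- P) = - transpose P" for P :: "real^'k^'m"
  by (simp add: vec_eq_iff transpose_def)

lemma transpose_zero: "transpose (0 :: real^'k^'m) = 0"
  by (simp add: vec_eq_iff transpose_def)

lemma transpose_diff: "transpose (P - Q) = transpose P - transpose Q" for P :: "real^'k^'m"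
  by (simp add: vec_eq_iff transpose_def)

lemma matrix_minus_vector_mult: "(- P) *v x = - (P *v x)" for P :: "real^'k^'m"
  by (simp add: vec_eq_iff matrix_vector_mult_def sum_negf)

lemma trace_congruence_diff:
  fixes P Q :: "real^'m^'m"
  assumes V: "transpose V = V"
  shows "trace ((P - Q) ** V ** transpose (P - Q))
    = trace (P ** V ** transpose P) - 2 * trace (P ** V ** transpose Q) + trace (Q ** V ** transpose Q)"
proof -
  have "trace (Q ** V ** transpose P) = trace (transpose (Q ** V ** transpose P))"
    by (simp only: trace_transpose)
  also have "\<dots> = trace (P ** V ** transpose Q)"
    by (simp add: matrix_transpose_mul V matrix_mul_assoc)
  finally show ?thesis
    by (simp add: transpose_diff matrix_diff_left matrix_diff_right trace_sub)
qed

text \<open>Half of the amount by which the expected training loss at the index \<open>i\<close> falls short of the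
  expected loss for a fresh response at the same covariate. It is the weighted covariance of the
  response with its own fitted value.\<close>

definition optimism ::
  "('k::finite, 'p::finite) weight \<Rightarrow> ('k, 'p) weight \<Rightarrow> ('k, 'p) covariate^'n::finite \<Rightarrow> 'n \<Rightarrow> real"
  where
  "optimism V W xs i = trace (design (xs $ i) ** wls_coef W xs i ** V (xs $ i) ** W (xs $ i))"

context weighted_regression
begin

text \<open>By cyclicity of the trace; this is the same value as in \<open>sum_fit_var\<close>, which is why the variance
  under Same-X is half of OptS.\<close>

lemma sum_optimism:
  "(\<Sum>i\<in>UNIV. optimism V W xs i) = trace (matrix_inv (gram W xs) ** score_cov V W xs)"
proof -
  have "optimism V W xs i = trace (matrix_inv (gram W xs) ** (transpose (design (xs $ i)) **
      W (xs $ i) ** V (xs $ i) ** W (xs $ i) ** design (xs $ i)))" for i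
    using trace_mul_sym[of "design (xs $ i)" "wls_coef W xs i ** V (xs $ i) ** W (xs $ i)"]
    by (simp add: optimism_def wls_coef_def matrix_mul_assoc)
  then show ?thesis by (simp add: score_cov_def matrix_mult_sum_right trace_sum)
qed

lemma fit_var_eq:
  "fit_var V W xs x = (\<Sum>j\<in>UNIV. trace ((X_tilde W x ** wls_coef W xs j) ** V (xs $ j) **
     transpose (X_tilde W x ** wls_coef W xs j)))"
proof -
  have "trace ((X_tilde W x ** wls_coef W xs j) ** V (xs $ j) ** transpose (X_tilde W x ** wls_coef W xs j))
      = trace (wls_coef W xs j ** V (xs $ j) ** transpose (wls_coef W xs j) ** point_gram W x)" for j
    using trace_mul_sym[of "X_tilde W x" "wls_coef W xs j ** V (xs $ j) **
        transpose (wls_coef W xs j) ** transpose (X_tilde W x)"]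
    by (simp add: matrix_transpose_mul point_gram_def matrix_mul_assoc)
  then show ?thesis by (simp add: fit_var_def wls_cov_def matrix_mult_sum_left trace_sum)
qed

end

context covariance_model
begin

lemma covariates_indep_errors: "indep_pair M (\<lambda>\<omega>. \<chi> \<alpha>. X \<alpha> \<omega>) errors"
  by (rule indep_pairI_indep_set)
    (use model in \<open>simp_all add: data_model_def errors_def[abs_def]\<close>, measurable)

lemma train_indep_errors: "indep_pair M (train X) errors"
proof -
  have "(\<lambda>x. \<chi> j. x $ Inl j) \<in> (borel :: (('k, 'p) covariate^('n + 'n)) measure) \<rightarrow>\<^sub>M borel"
    by measurable
  from indep_pair_compose[OF covariates_indep_errors this]
  show ?thesis by (simp add: train_def[abs_def])
qed

lemma train_test_indep_errors: "indep_pair M (\<lambda>\<omega>. (train X \<omega>, X (Inr i) \<omega>)) errors"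
proof -
  have "(\<lambda>x. (\<chi> j. x $ Inl j, x $ Inr i)) \<in> (borel :: (('k, 'p) covariate^('n + 'n)) measure) \<rightarrow>\<^sub>M borel"
    unfolding borel_prod[symmetric] by measurable
  from indep_pair_compose[OF covariates_indep_errors this]
  show ?thesis by (simp add: train_def)
qed

lemma covariate_indep_errors: "indep_pair M (X \<alpha>) errors"
proof -
  have "(\<lambda>x. x $ \<alpha>) \<in> (borel :: (('k, 'p) covariate^('n + 'n)) measure) \<rightarrow>\<^sub>M borel"
    by measurable
  from indep_pair_compose[OF covariates_indep_errors this]
  show ?thesis by simp
qed

lemma prob_space_errors: "prob_space (distr M borel errors)"
  by (rule prob_space_distr) simp

lemma errors_mass: "measure (distr M borel errors) UNIV = 1"
  using prob_space.prob_space[OF prob_space_errors] by simp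

lemma V_cov_AE: "AE \<omega> in M. V_cov M X Y \<alpha> \<omega> = V (X \<alpha> \<omega>)"
  unfolding V_cov_def
proof (rule cond_cov_freeze[OF covariate_indep_errors,
      where g = "\<lambda>x e. vecm (C x) + noise C x (e $ \<alpha>)" and m = "\<lambda>x. vecm (C x)"])
  interpret D: prob_space "distr M borel errors" by (rule prob_space_errors)
  show "has_bochner_integral (distr M borel errors)
      (\<lambda>e. (vecm (C x) + noise C x (e $ \<alpha>)) $ a) (vecm (C x) $ a)" for x a
    using noise_mean[of "\<lambda>_. x" \<alpha> a] by (simp add: has_bochner_integral_iff errors_mass)
  show "has_bochner_integral (distr M borel errors)
      (\<lambda>e. ((vecm (C x) + noise C x (e $ \<alpha>)) $ a - vecm (C x) $ a) *
           ((vecm (C x) + noise C x (e $ \<alpha>)) $ b - vecm (C x) $ b)) (V x $ a $ b)" for x a b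
    using noise_covariance[of "\<lambda>_. x" \<alpha> a \<alpha> b] by simp
qed (simp_all add: vec_outer_Y)

lemma V_cov_AE_all: "AE \<omega> in M. \<forall>\<alpha>. V_cov M X Y \<alpha> \<omega> = V (X \<alpha> \<omega>)"
  using V_cov_AE by (simp add: AE_all_countable)

lemma hat_cov_AE:
  "AE \<omega> in M. hat_cov M W X Y \<omega> = matrix_inv (gram W (train X \<omega>)) ** score_cov V W (train X \<omega>)"
  using V_cov_AE_all by eventually_elim (simp add: hat_cov_eq)

lemma sandwich_AE:
  assumes "AE \<omega> in M. invertible (gram W (train X \<omega>))"
  shows "AE \<omega> in M. sandwich M W X Y \<omega> = wls_cov V W (train X \<omega>)"
  using hat_cov_AE assms by eventually_elim (simp add: sandwich_def wls_cov_eq)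

text \<open>The estimator as a function of covariates and errors, with the mean split off.\<close>

definition noisy_wls :: "('k, 'p) covariate^'n \<Rightarrow> (real^'p)^('n + 'n) \<Rightarrow> real^'k" where
  "noisy_wls xs e = wls_mean C W xs + (\<Sum>j\<in>UNIV. wls_coef W xs j *v noise C (xs $ j) (e $ Inl j))"

lemma wls_noisy:
  "\<omega> \<in> space M \<Longrightarrow> wls W (train X \<omega>) (train Y \<omega>) = noisy_wls (train X \<omega>) (errors \<omega>)"
  by (simp add: wls_eq noisy_wls_def wls_mean_def train_def vec_outer_Y
      matrix_vector_right_distrib sum.distrib)

lemma measurable_noisy_wls [measurable (raw)]:
  assumes [measurable]: "xs \<in> borel_measurable N" "e \<in> borel_measurable N"
  shows "(\<lambda>\<omega>. noisy_wls (xs \<omega>) (e \<omega>)) \<in> borel_measurable N"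
  unfolding noisy_wls_def by measurable

text \<open>One statement covers both designs: \<open>T\<close> is the training sample under Same-X, and the training
  sample together with the test covariate under Random-X. The noise enters through the training
  indices only, so the test indices receive the coefficient 0.\<close>

lemma
  fixes T :: "'w \<Rightarrow> 't::topological_space" and xs :: "'t \<Rightarrow> ('k, 'p) covariate^'n"
    and x :: "'t \<Rightarrow> ('k, 'p) covariate"
  assumes T: "indep_pair M T errors"
    and [measurable]: "xs \<in> borel_measurable borel" "x \<in> borel_measurable borel"
    and xs: "\<And>\<omega>. \<omega> \<in> space M \<Longrightarrow> xs (T \<omega>) = train X \<omega>"
    and x: "\<And>\<omega>. \<omega> \<in> space M \<Longrightarrow> x (T \<omega>) = X \<alpha> \<omega>"
  shows sq_bias_AE: "AE \<omega> in M. sq_bias M (gen_sigma M T) C W X Y \<alpha> \<omega>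
          = fit_bias C W (train X \<omega>) (X \<alpha> \<omega>)"
    and tr_var_AE: "AE \<omega> in M. tr_var M (gen_sigma M T) W X Y \<alpha> \<omega>
          = fit_var V W (train X \<omega>) (X \<alpha> \<omega>)"
proof -
  interpret D: prob_space "distr M borel errors" by (rule prob_space_errors)
  define P where "P t \<beta> = (case \<beta> of Inl j \<Rightarrow> X_tilde W (x t) ** wls_coef W (xs t) j | Inr j \<Rightarrow> 0)"
    for t and \<beta> :: "'n + 'n"
  define y where "y t \<beta> = (case \<beta> of Inl j \<Rightarrow> xs t $ j | Inr j \<Rightarrow> x t)" for t and \<beta> :: "'n + 'n"
  define m where "m t = X_tilde W (x t) *v wls_mean C W (xs t)" for t
  define K where "K t = (\<Sum>\<beta>\<in>UNIV. P t \<beta> ** V (y t \<beta>) ** transpose (P t \<beta>))" for t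
  have lin: "X_tilde W (x t) *v noisy_wls (xs t) e
      = m t + (\<Sum>\<beta>\<in>UNIV. P t \<beta> *v noise C (y t \<beta>) (e $ \<beta>))" for t e
    by (simp add: noisy_wls_def m_def P_def y_def sum_UNIV_sum matrix_vector_right_distrib
        vec.sum matrix_vector_mul_assoc)
  have Z: "C_hat_tilde W X Y \<alpha> \<omega> = X_tilde W (x (T \<omega>)) *v noisy_wls (xs (T \<omega>)) (errors \<omega>)"
    if "\<omega> \<in> space M" for \<omega>
    using that by (simp add: C_hat_tilde_def C_hat_eq wls_noisy xs x X_tilde_def matrix_vector_mul_assoc)
  have mean: "has_bochner_integral (distr M borel errors)
      (\<lambda>e. (X_tilde W (x t) *v noisy_wls (xs t) e) $ a) (m t $ a)" for t a
    using uncorrelated_linear_mean[where U = "\<lambda>\<beta> e. noise C (y t \<beta>) (e $ \<beta>)"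
        and V = "\<lambda>\<beta>. V (y t \<beta>)" and P = "P t" and a = a,
        OF noise_mean[where x = "y t"] noise_covariance[where x = "y t"]]
    by (simp add: lin has_bochner_integral_iff errors_mass)
  have cov: "has_bochner_integral (distr M borel errors)
      (\<lambda>e. ((X_tilde W (x t) *v noisy_wls (xs t) e) $ a - m t $ a) *
           ((X_tilde W (x t) *v noisy_wls (xs t) e) $ b - m t $ b)) (K t $ a $ b)" for t a b
    using uncorrelated_linear_cov[where U = "\<lambda>\<beta> e. noise C (y t \<beta>) (e $ \<beta>)"
        and V = "\<lambda>\<beta>. V (y t \<beta>)" and P = "P t" and Q = "P t" and a = a and b = b,
        OF noise_mean[where x = "y t"] noise_covariance[where x = "y t"]]
    by (simp add: lin K_def)
  have meas: "(\<lambda>(t, e). X_tilde W (x t) *v noisy_wls (xs t) e) \<in> borel_measurable (borel \<Otimes>\<^sub>M borel)"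
    by measurable
  have cond_mean: "AE \<omega> in M. cond_mean M (gen_sigma M T) (C_hat_tilde W X Y \<alpha>) \<omega> = m (T \<omega>)"
    by (rule cond_mean_freeze[OF T _ meas mean cov]) (rule Z)
  have cond_cov: "AE \<omega> in M. cond_cov M (gen_sigma M T) (C_hat_tilde W X Y \<alpha>) \<omega> = K (T \<omega>)"
    by (rule cond_cov_freeze[OF T _ meas mean cov]) (rule Z)
  show "AE \<omega> in M. sq_bias M (gen_sigma M T) C W X Y \<alpha> \<omega> = fit_bias C W (train X \<omega>) (X \<alpha> \<omega>)"
    using cond_mean AE_space
    by eventually_elim (simp add: sq_bias_def fit_bias_def m_def xs x)
  have K: "trace (K t) = fit_var V W (xs t) (x t)" for t
    by (simp add: K_def fit_var_eq sum_UNIV_sum P_def y_def trace_sum)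
  show "AE \<omega> in M. tr_var M (gen_sigma M T) W X Y \<alpha> \<omega> = fit_var V W (train X \<omega>) (X \<alpha> \<omega>)"
    using cond_cov AE_space
    by eventually_elim (simp add: tr_var_def K xs x)
qed

text \<open>The prediction loss at the index \<open>\<alpha>\<close> as a function of covariates and errors; the pair \<open>t\<close>
  holds the training covariates and the covariate at \<open>\<alpha>\<close>.\<close>

definition noisy_loss ::
  "'n + 'n \<Rightarrow> (('k, 'p) covariate^'n) \<times> ('k, 'p) covariate \<Rightarrow> (real^'p)^('n + 'n) \<Rightarrow> real" where
  "noisy_loss \<alpha> t e = (norm (sqrtm (W (snd t)) *v (vecm (C (snd t)) + noise C (snd t) (e $ \<alpha>)
      - design (snd t) *v noisy_wls (fst t) e)))\<^sup>2"

lemma pred_loss_noisy: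
  "\<omega> \<in> space M \<Longrightarrow> pred_loss W X Y \<alpha> \<omega> = noisy_loss \<alpha> (train X \<omega>, X \<alpha> \<omega>) (errors \<omega>)"
  by (simp add: pred_loss_def loss_eq C_hat_eq wls_noisy vec_outer_Y noisy_loss_def)

lemma measurable_noisy_loss [measurable (raw)]:
  assumes [measurable]: "t \<in> borel_measurable N" "e \<in> borel_measurable N"
  shows "(\<lambda>\<omega>. noisy_loss \<alpha> (t \<omega>) (e \<omega>)) \<in> borel_measurable N"
proof -
  have [measurable]: "(\<lambda>\<omega>. fst (t \<omega>)) \<in> borel_measurable N" "(\<lambda>\<omega>. snd (t \<omega>)) \<in> borel_measurable N"
    using assms(1) by (auto simp: borel_prod[symmetric])
  show ?thesis unfolding noisy_loss_def by measurable
qed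

lemma pred_loss_meas [measurable]: "pred_loss W X Y \<alpha> \<in> borel_measurable M"
proof -
  have "(\<lambda>\<omega>. (train X \<omega>, X \<alpha> \<omega>)) \<in> borel_measurable M"
    unfolding borel_prod[symmetric] by measurable
  then have "(\<lambda>\<omega>. noisy_loss \<alpha> (train X \<omega>, X \<alpha> \<omega>) (errors \<omega>)) \<in> borel_measurable M"
    by measurable
  then show ?thesis
    using measurable_cong[of M "pred_loss W X Y \<alpha>" _ borel, OF pred_loss_noisy] by simp
qed

lemma pred_loss_nonneg: "0 \<le> pred_loss W X Y \<alpha> \<omega>"
  by (simp add: pred_loss_def loss_eq)

lemma noisy_loss_linear:
  "noisy_loss \<alpha> (xs, x) e = (norm ((X_tilde W x *v wls_mean C W xs - C_tilde C W x)
     + ((\<Sum>j\<in>UNIV. (X_tilde W x ** wls_coef W xs j) *v noise C (xs $ j) (e $ Inl j))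
        - sqrtm (W x) *v noise C x (e $ \<alpha>))))\<^sup>2"
proof -
  have "sqrtm (W x) *v (vecm (C x) + noise C x (e $ \<alpha>) - design x *v noisy_wls xs e)
      = - ((X_tilde W x *v wls_mean C W xs - C_tilde C W x)
     + ((\<Sum>j\<in>UNIV. (X_tilde W x ** wls_coef W xs j) *v noise C (xs $ j) (e $ Inl j))
        - sqrtm (W x) *v noise C x (e $ \<alpha>)))"
    by (simp add: noisy_wls_def X_tilde_def C_tilde_def matrix_vector_right_distrib
        matrix_vector_mult_diff_distrib vec.sum matrix_vector_mul_assoc matrix_mul_assoc)
  then show ?thesis by (simp only: noisy_loss_def fst_conv snd_conv norm_minus_cancel)
qed

lemma trace_sqrt_W: "trace (sqrtm (W x) ** Q ** sqrtm (W x)) = trace (W x ** Q)"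
  using trace_mul_sym[of "sqrtm (W x) ** Q" "sqrtm (W x)"] by (simp add: matrix_mul_assoc)

text \<open>The noise at a test index does not enter the estimator, so it contributes the separate term
  \<open>trace (W x ** V x)\<close>.\<close>

lemma expected_test_loss:
  "has_bochner_integral (distr M borel errors) (noisy_loss (Inr i) (xs, x))
     (fit_bias C W xs x + trace (W x ** V x) + fit_var V W xs x)"
proof -
  define P where "P \<beta> = (case \<beta> of Inl j \<Rightarrow> X_tilde W x ** wls_coef W xs j
      | Inr j \<Rightarrow> if j = i then - sqrtm (W x) else 0)" for \<beta> :: "'n + 'n"
  define y where "y \<beta> = (case \<beta> of Inl j \<Rightarrow> xs $ j | Inr j \<Rightarrow> x)" for \<beta> :: "'n + 'n"
  have inr: "(\<Sum>j\<in>UNIV. P (Inr j) *v noise C (y (Inr j)) (e $ Inr j))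
      = - (sqrtm (W x) *v noise C x (e $ Inr i))" for e
  proof -
    have "P (Inr j) *v noise C (y (Inr j)) (e $ Inr j)
        = (if j = i then - (sqrtm (W x) *v noise C x (e $ Inr i)) else 0)" for j
      by (simp add: P_def y_def matrix_minus_vector_mult)
    then show ?thesis by simp
  qed
  have loss: "noisy_loss (Inr i) (xs, x) = (\<lambda>e. (norm ((X_tilde W x *v wls_mean C W xs - C_tilde C W x)
      + (\<Sum>\<beta>\<in>UNIV. P \<beta> *v noise C (y \<beta>) (e $ \<beta>))))\<^sup>2)"
    unfolding noisy_loss_linear[abs_def] sum_UNIV_sum inr by (simp add: P_def y_def)
  have "(\<Sum>j\<in>UNIV. trace (P (Inr j) ** V (y (Inr j)) ** transpose (P (Inr j)))) = trace (W x ** V x)"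
  proof -
    have "trace (P (Inr j) ** V (y (Inr j)) ** transpose (P (Inr j)))
        = (if j = i then trace (W x ** V x) else 0)" for j
      by (simp add: P_def y_def matrix_minus_left matrix_minus_right transpose_minus trace_sqrt_W)
        (simp add: trace_def)
    then show ?thesis by simp
  qed
  then have "(\<Sum>\<beta>\<in>UNIV. trace (P \<beta> ** V (y \<beta>) ** transpose (P \<beta>)))
      = trace (W x ** V x) + fit_var V W xs x"
    by (simp add: sum_UNIV_sum fit_var_eq) (simp add: P_def y_def)
  then show ?thesis
    using uncorrelated_norm_square[where U = "\<lambda>\<beta> e. noise C (y \<beta>) (e $ \<beta>)"
        and V = "\<lambda>\<beta>. V (y \<beta>)" and P = P
        and v = "X_tilde W x *v wls_mean C W xs - C_tilde C W x",
        OF prob_space_errors noise_mean[where x = y] noise_covariance[where x = y]]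
    by (simp add: loss fit_bias_def add.assoc)
qed

text \<open>The noise at the index \<open>i\<close> enters both the response and the estimator; the cross term of the two is
  the optimism.\<close>

lemma expected_train_loss:
  "has_bochner_integral (distr M borel errors) (noisy_loss (Inl i) (xs, xs $ i))
     (fit_bias C W xs (xs $ i) + trace (W (xs $ i) ** V (xs $ i)) + fit_var V W xs (xs $ i)
        - 2 * optimism V W xs i)"
proof -
  define x where "x = xs $ i"
  define H where "H j = X_tilde W x ** wls_coef W xs j" for j
  \<comment> \<open>\<open>H\<close> carries the noise through the estimator, \<open>D\<close> through the response.\<close>
  define D where "D j = (if j = i then sqrtm (W x) else 0)" for j
  define P where "P \<beta> = (case \<beta> of Inl j \<Rightarrow> H j - D j | Inr j \<Rightarrow> 0)" for \<beta> :: "'n + 'n"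
  define y where "y \<beta> = (case \<beta> of Inl j \<Rightarrow> xs $ j | Inr j \<Rightarrow> x)" for \<beta> :: "'n + 'n"
  have D_sum: "(\<Sum>j\<in>UNIV. D j *v u j) = sqrtm (W x) *v u i" for u
  proof -
    have "D j *v u j = (if j = i then sqrtm (W x) *v u i else 0)" for j by (simp add: D_def)
    then show ?thesis by simp
  qed
  have "(\<Sum>\<beta>\<in>UNIV. P \<beta> *v noise C (y \<beta>) (e $ \<beta>)) =
      (\<Sum>j\<in>UNIV. H j *v noise C (xs $ j) (e $ Inl j)) - sqrtm (W x) *v noise C x (e $ Inl i)" for e
    by (simp add: sum_UNIV_sum P_def y_def matrix_vector_mult_diff_rdistrib sum_subtractf D_sum)
      (simp add: x_def)
  then have loss: "noisy_loss (Inl i) (xs, x) = (\<lambda>e. (norm ((X_tilde W x *v wls_mean C W xs - C_tilde C W x)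
      + (\<Sum>\<beta>\<in>UNIV. P \<beta> *v noise C (y \<beta>) (e $ \<beta>))))\<^sup>2)"
    by (simp add: noisy_loss_linear fun_eq_iff H_def)
  have sym: "transpose (V z) = V z" for z using psd_V by (simp add: psd_def)
  have tr0: "trace (0 :: real^('p \<times> 'p)^('p \<times> 'p)) = 0" by (simp add: trace_def)
  have "(\<Sum>\<beta>\<in>UNIV. trace (P \<beta> ** V (y \<beta>) ** transpose (P \<beta>))) =
      (\<Sum>j\<in>UNIV. trace (H j ** V (xs $ j) ** transpose (H j)))
      - 2 * (\<Sum>j\<in>UNIV. trace (H j ** V (xs $ j) ** transpose (D j)))
      + (\<Sum>j\<in>UNIV. trace (D j ** V (xs $ j) ** transpose (D j)))"
    by (simp add: sum_UNIV_sum P_def y_def tr0 trace_congruence_diff[OF sym] sum.distrib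
        sum_subtractf sum_distrib_left)
  also have "(\<Sum>j\<in>UNIV. trace (H j ** V (xs $ j) ** transpose (H j))) = fit_var V W xs x"
    by (simp add: fit_var_eq H_def)
  also have "(\<Sum>j\<in>UNIV. trace (H j ** V (xs $ j) ** transpose (D j))) = optimism V W xs i"
  proof -
    have "trace (H i ** V x ** sqrtm (W x)) = optimism V W xs i"
      using trace_mul_sym[of "H i ** V x" "sqrtm (W x)"]
        trace_mul_sym[of "W x" "design x ** wls_coef W xs i ** V x"]
      by (simp add: H_def optimism_def X_tilde_def matrix_mul_assoc x_def)
    then have "trace (H j ** V (xs $ j) ** transpose (D j))
        = (if j = i then optimism V W xs i else 0)" for j
      by (simp add: D_def tr0 x_def transpose_zero)
    then show ?thesis by simp
  qed
  also have "(\<Sum>j\<in>UNIV. trace (D j ** V (xs $ j) ** transpose (D j))) = trace (W x ** V x)"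
  proof -
    have "trace (D j ** V (xs $ j) ** transpose (D j)) = (if j = i then trace (W x ** V x) else 0)" for j
      by (simp add: D_def tr0 trace_sqrt_W) (simp add: x_def)
    then show ?thesis by simp
  qed
  finally have tr: "(\<Sum>\<beta>\<in>UNIV. trace (P \<beta> ** V (y \<beta>) ** transpose (P \<beta>))) =
      fit_var V W xs x - 2 * optimism V W xs i + trace (W x ** V x)" .
  have "(norm (X_tilde W x *v wls_mean C W xs - C_tilde C W x))\<^sup>2
      + (\<Sum>\<beta>\<in>UNIV. trace (P \<beta> ** V (y \<beta>) ** transpose (P \<beta>)))
    = fit_bias C W xs x + trace (W x ** V x) + fit_var V W xs x - 2 * optimism V W xs i"
    by (simp add: tr fit_bias_def)
  then have "has_bochner_integral (distr M borel errors) (noisy_loss (Inl i) (xs, x))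
     (fit_bias C W xs x + trace (W x ** V x) + fit_var V W xs x - 2 * optimism V W xs i)"
    using uncorrelated_norm_square[where U = "\<lambda>\<beta> e. noise C (y \<beta>) (e $ \<beta>)"
        and V = "\<lambda>\<beta>. V (y \<beta>)" and P = P
        and v = "X_tilde W x *v wls_mean C W xs - C_tilde C W x",
        OF prob_space_errors noise_mean[where x = y] noise_covariance[where x = y]]
    by (simp only: loss)
  then show ?thesis by (simp only: x_def)
qed

lemma test_loss_integral:
  assumes "integrable M (pred_loss W X Y (Inr i))"
  shows "has_bochner_integral M (\<lambda>\<omega>. fit_bias C W (train X \<omega>) (X (Inr i) \<omega>)
      + trace (W (X (Inr i) \<omega>) ** V (X (Inr i) \<omega>)) + fit_var V W (train X \<omega>) (X (Inr i) \<omega>))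
    (\<integral>\<omega>. pred_loss W X Y (Inr i) \<omega> \<partial>M)"
proof -
  have "(\<integral>\<omega>. pred_loss W X Y (Inr i) \<omega> \<partial>M)
      = (\<integral>\<omega>. noisy_loss (Inr i) (train X \<omega>, X (Inr i) \<omega>) (errors \<omega>) \<partial>M)"
    by (rule Bochner_Integration.integral_cong) (simp_all add: pred_loss_noisy)
  moreover have exp: "has_bochner_integral (distr M borel errors) (noisy_loss (Inr i) t)
      (fit_bias C W (fst t) (snd t) + trace (W (snd t) ** V (snd t)) + fit_var V W (fst t) (snd t))"
    for t using expected_test_loss[of i "fst t" "snd t"] by simp
  moreover have meas: "(\<lambda>(t, e). noisy_loss (Inr i) t e) \<in> borel_measurable (borel \<Otimes>\<^sub>M borel)"
    by measurable
  moreover have "integrable M (\<lambda>\<omega>. noisy_loss (Inr i) (train X \<omega>, X (Inr i) \<omega>) (errors \<omega>))"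
    using assms by (rule Bochner_Integration.integrable_cong[THEN iffD1, rotated -1])
      (simp_all add: pred_loss_noisy)
  ultimately show ?thesis
    using integral_freeze[where g = "noisy_loss (Inr i)", OF train_test_indep_errors[of i] meas exp]
    by simp
qed

lemma train_loss_integral:
  assumes "integrable M (pred_loss W X Y (Inl i))"
  shows "has_bochner_integral M (\<lambda>\<omega>. fit_bias C W (train X \<omega>) (X (Inl i) \<omega>)
      + trace (W (X (Inl i) \<omega>) ** V (X (Inl i) \<omega>)) + fit_var V W (train X \<omega>) (X (Inl i) \<omega>)
      - 2 * optimism V W (train X \<omega>) i)
    (\<integral>\<omega>. pred_loss W X Y (Inl i) \<omega> \<partial>M)"
proof -
  have eq: "pred_loss W X Y (Inl i) \<omega> = noisy_loss (Inl i) (train X \<omega>, train X \<omega> $ i) (errors \<omega>)"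
    if "\<omega> \<in> space M" for \<omega>
    using that by (simp add: pred_loss_noisy train_def)
  have "(\<integral>\<omega>. pred_loss W X Y (Inl i) \<omega> \<partial>M)
      = (\<integral>\<omega>. noisy_loss (Inl i) (train X \<omega>, train X \<omega> $ i) (errors \<omega>) \<partial>M)"
    by (rule Bochner_Integration.integral_cong) (simp_all add: eq)
  moreover have "integrable M (\<lambda>\<omega>. noisy_loss (Inl i) (train X \<omega>, train X \<omega> $ i) (errors \<omega>))"
    using assms by (rule Bochner_Integration.integrable_cong[THEN iffD1, rotated -1])
      (simp_all add: eq)
  moreover have "(\<lambda>(xs, e). noisy_loss (Inl i) (xs, xs $ i) e) \<in> borel_measurable (borel \<Otimes>\<^sub>M borel)"
  proof -
    have "(\<lambda>z :: (('k, 'p) covariate^'n) \<times> ((real^'p)^('n + 'n)). (fst z, fst z $ i))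
        \<in> borel_measurable (borel \<Otimes>\<^sub>M borel)"
      by (intro borel_measurable_Pair) measurable
    from measurable_noisy_loss[OF this, of snd] show ?thesis by (simp add: case_prod_unfold)
  qed
  ultimately show ?thesis
    using integral_freeze[where g = "\<lambda>xs. noisy_loss (Inl i) (xs, xs $ i)",
        OF train_indep_errors _ expected_train_loss]
    by (simp add: train_def)
qed

text \<open>The losses are nonnegative, so integrability of their average passes to each of them.\<close>

lemma
  assumes L: "\<And>\<omega>. L \<omega> = 1 / real CARD('n) * (\<Sum>i\<in>UNIV. pred_loss W X Y (f (i :: 'n)) \<omega>)"
    and int: "integrable M L"
  shows pred_loss_integrable_if_average: "integrable M (pred_loss W X Y (f i))"
    and average_loss_integral:
      "integral\<^sup>L M L = 1 / real CARD('n) * (\<Sum>i\<in>UNIV. \<integral>\<omega>. pred_loss W X Y (f i) \<omega> \<partial>M)"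
proof -
  show "integrable M (pred_loss W X Y (f i))" for i
  proof (rule Bochner_Integration.integrable_bound)
    show "integrable M (\<lambda>\<omega>. real CARD('n) * L \<omega>)"
      using int by (rule integrable_mult_right)
    have "pred_loss W X Y (f i) \<omega> \<le> (\<Sum>i\<in>UNIV. pred_loss W X Y (f i) \<omega>)" for \<omega>
      by (rule member_le_sum) (auto simp: pred_loss_nonneg)
    then show "AE \<omega> in M. norm (pred_loss W X Y (f i) \<omega>) \<le> norm (real CARD('n) * L \<omega>)"
      by (auto simp: L pred_loss_nonneg intro!: AE_I2 order_trans[OF _ abs_ge_self])
  qed simp
  then show "integral\<^sup>L M L
      = 1 / real CARD('n) * (\<Sum>i\<in>UNIV. \<integral>\<omega>. pred_loss W X Y (f i) \<omega> \<partial>M)"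
    by (simp add: L[abs_def])
qed

lemmas pred_loss_integrable_test =
    pred_loss_integrable_if_average[where L = "test_loss W X Y" and f = Inr, OF test_loss_def]
  and test_loss_sum =
    average_loss_integral[where L = "test_loss W X Y" and f = Inr, OF test_loss_def]
  and pred_loss_integrable_train =
    pred_loss_integrable_if_average[where L = "train_loss W X Y" and f = Inl, OF train_loss_def]
  and train_loss_sum =
    average_loss_integral[where L = "train_loss W X Y" and f = Inl, OF train_loss_def]

end

section \<open>Exchangeability of the sample\<close>

lemma has_bochner_integral_distr_iff:
  fixes f :: "'a \<Rightarrow> 'b::{banach, second_countable_topology}"
  assumes "f \<in> borel_measurable N" "g \<in> measurable M N"
  shows "has_bochner_integral (distr M N g) f v \<longleftrightarrow> has_bochner_integral M (\<lambda>x. f (g x)) v"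
  using assms by (simp add: has_bochner_integral_iff integrable_distr_eq integral_distr)

lemma has_bochner_integral_AE_eq:
  fixes f g :: "'a \<Rightarrow> real"
  assumes "integrable M f" "g \<in> borel_measurable M" "AE x in M. f x = g x"
  shows "has_bochner_integral M g (integral\<^sup>L M f)"
  using has_bochner_integral_cong_AE[OF borel_measurable_integrable[OF assms(1)] assms(2,3)]
    has_bochner_integral_integrable[OF assms(1)] by simp

lemma iid_vec_measurable:
  fixes Z :: "'i \<Rightarrow> 'w \<Rightarrow> 'a::euclidean_space" and \<sigma> :: "'q::finite \<Rightarrow> 'i"
  assumes "prob_space M" "iid M Z UNIV"
  shows "(\<lambda>\<omega>. \<chi> q. Z (\<sigma> q) \<omega>) \<in> borel_measurable M"
  using iid_measurable[OF assms] by (intro measurable_vec_lambda) auto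

lemma iid_integral_transfer:
  fixes Z :: "'i \<Rightarrow> 'w \<Rightarrow> 'a::euclidean_space" and Z' :: "'j \<Rightarrow> 'v \<Rightarrow> 'a"
    and \<sigma> :: "'q::finite \<Rightarrow> 'i" and \<sigma>' :: "'q \<Rightarrow> 'j" and H :: "'a^'q \<Rightarrow> real"
  assumes Z: "prob_space M" "iid M Z UNIV" "inj \<sigma>" and Z': "prob_space M'" "iid M' Z' UNIV" "inj \<sigma>'"
    and marginal: "distr M borel (Z i) = distr M' borel (Z' j)"
    and H: "H \<in> borel_measurable borel"
    and int: "has_bochner_integral M (\<lambda>\<omega>. H (\<chi> q. Z (\<sigma> q) \<omega>)) v"
  shows "has_bochner_integral M' (\<lambda>\<omega>. H (\<chi> q. Z' (\<sigma>' q) \<omega>)) v"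
proof -
  have "has_bochner_integral (distr M borel (\<lambda>\<omega>. \<chi> q. Z (\<sigma> q) \<omega>)) H v"
    using int by (simp add: has_bochner_integral_distr_iff[OF H iid_vec_measurable[OF Z(1,2)]])
  then have "has_bochner_integral (distr M' borel (\<lambda>\<omega>. \<chi> q. Z' (\<sigma>' q) \<omega>)) H v"
    by (simp only: iid_subfamilies_same_law[OF Z Z' marginal])
  then show ?thesis
    by (simp add: has_bochner_integral_distr_iff[OF H iid_vec_measurable[OF Z'(1,2)]])
qed

lemma iid_AE_transfer:
  fixes Z :: "'i \<Rightarrow> 'w \<Rightarrow> 'a::euclidean_space" and Z' :: "'j \<Rightarrow> 'v \<Rightarrow> 'a"
    and \<sigma> :: "'q::finite \<Rightarrow> 'i" and \<sigma>' :: "'q \<Rightarrow> 'j"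
  assumes Z: "prob_space M" "iid M Z UNIV" "inj \<sigma>" and Z': "prob_space M'" "iid M' Z' UNIV" "inj \<sigma>'"
    and marginal: "distr M borel (Z i) = distr M' borel (Z' j)"
    and P: "{x. P x} \<in> sets borel"
    and ae: "AE \<omega> in M. P (\<chi> q. Z (\<sigma> q) \<omega>)"
  shows "AE \<omega> in M'. P (\<chi> q. Z' (\<sigma>' q) \<omega>)"
proof -
  have "AE x in distr M borel (\<lambda>\<omega>. \<chi> q. Z (\<sigma> q) \<omega>). P x"
    using ae P by (subst AE_distr_iff[OF iid_vec_measurable[OF Z(1,2)]]) simp_all
  then have "AE x in distr M' borel (\<lambda>\<omega>. \<chi> q. Z' (\<sigma>' q) \<omega>). P x"
    by (simp only: iid_subfamilies_same_law[OF Z Z' marginal])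
  then show ?thesis
    using P by (subst (asm) AE_distr_iff[OF iid_vec_measurable[OF Z'(1,2)]]) simp_all
qed

lemma measurable_fst_borel [measurable]:
  "(fst :: 'a::second_countable_topology \<times> 'b::second_countable_topology \<Rightarrow> 'a) \<in> borel_measurable borel"
  by (simp add: borel_prod[symmetric])

lemma measurable_snd_borel [measurable]:
  "(snd :: 'a::second_countable_topology \<times> 'b::second_countable_topology \<Rightarrow> 'b) \<in> borel_measurable borel"
  by (simp add: borel_prod[symmetric])

definition exchange_indices :: "'i \<Rightarrow> 'i \<Rightarrow> 'i \<Rightarrow> 'i" where
  "exchange_indices i j k = (if k = i then j else if k = j then i else k)"

lemma bij_exchange_indices: "bij (exchange_indices i j)"
  by (rule involuntory_imp_bij) (simp add: exchange_indices_def)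

lemma psd_entry_bound:
  fixes P :: "real^'k^'k"
  assumes "psd P"
  shows "\<bar>P $ a $ b\<bar> \<le> P $ a $ a + P $ b $ b" and "0 \<le> P $ a $ a"
proof -
  have col: "(P *v axis j 1) $ i = P $ i $ j" for i j
    by (simp add: matrix_vector_mult_basis column_def)
  have sym: "P $ b $ a = P $ a $ b"
    using assms by (auto simp: psd_def vec_eq_iff transpose_def)
  have diag: "0 \<le> P $ c $ c" for c
    using assms col[of c c] by (auto simp: psd_def inner_axis' dest: spec[of _ "axis c 1"])
  show "0 \<le> P $ a $ a" by (rule diag)
  have "0 \<le> (axis a 1 + s *\<^sub>R axis b 1) \<bullet> (P *v (axis a 1 + s *\<^sub>R axis b 1))" for s
    using assms by (simp add: psd_def)
  then have "0 \<le> P $ a $ a + 2 * s * P $ a $ b + s\<^sup>2 * P $ b $ b" for s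
    by (simp add: inner_add_left inner_axis' matrix_vector_right_distrib matrix_vector_mult_scaleR
        col sym power2_eq_square algebra_simps)
  from this[of 1] this[of "-1"] diag[of a] diag[of b]
  show "\<bar>P $ a $ b\<bar> \<le> P $ a $ a + P $ b $ b" by simp
qed

lemma trace_mult: "trace (P ** Q) = (\<Sum>a\<in>UNIV. \<Sum>b\<in>UNIV. P $ a $ b * Q $ b $ a)"
  for P Q :: "real^'k^'k"
  by (simp add: trace_def matrix_matrix_mult_def)

lemma integral_matrix_nth:
  fixes f :: "'a \<Rightarrow> real^'k^'m"
  assumes "integrable M f"
  shows "has_bochner_integral M (\<lambda>x. f x $ a $ b) ((\<integral>x. f x \<partial>M) $ a $ b)"
  using has_bochner_integral_bounded_linear[OF bounded_linear_compose[OF bounded_linear_vec_nth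
      bounded_linear_vec_nth] has_bochner_integral_integrable[OF assms]] by simp

context covariance_model
begin

lemma train_meas [measurable]: "train X \<in> borel_measurable M"
  by (rule measurable_train) simp

text \<open>Swapping two training indices preserves the law of the sample and, by symmetry of \<open>F\<close>, moves only
  the second argument.\<close>

lemma exchange_train:
  fixes F :: "('k, 'p) covariate^'n \<Rightarrow> ('k, 'p) covariate \<Rightarrow> real"
  assumes iid: "iid M (\<lambda>i. X (Inl i)) UNIV"
    and [measurable]: "(\<lambda>z. F (fst z) (snd z)) \<in> borel_measurable borel"
    and sym: "\<And>\<pi> xs x. bij \<pi> \<Longrightarrow> F (\<chi> i. xs $ \<pi> i) x = F xs x"
    and int: "has_bochner_integral M (\<lambda>\<omega>. F (train X \<omega>) (X (Inl i) \<omega>)) v"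
  shows "has_bochner_integral M (\<lambda>\<omega>. F (train X \<omega>) (X (Inl j) \<omega>)) v"
proof -
  have "(\<lambda>xs. (xs, xs $ i)) \<in> borel_measurable (borel :: (('k, 'p) covariate^'n) measure)"
    by (intro borel_measurable_Pair) measurable
  from measurable_compose[OF this assms(2)]
  have H: "(\<lambda>xs. F xs (xs $ i)) \<in> borel_measurable borel" by simp
  have "has_bochner_integral M (\<lambda>\<omega>. F (\<chi> q. X (Inl (exchange_indices i j q)) \<omega>) ((\<chi> q. X (Inl (exchange_indices i j q)) \<omega>) $ i)) v"
    by (rule iid_integral_transfer[OF prob_space_axioms iid inj_on_id prob_space_axioms iid
          bij_is_inj[OF bij_exchange_indices] refl H]) (use int in \<open>simp add: train_def\<close>)
  moreover have "F (\<chi> q. X (Inl (exchange_indices i j q)) \<omega>) ((\<chi> q. X (Inl (exchange_indices i j q)) \<omega>) $ i)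
      = F (train X \<omega>) (X (Inl j) \<omega>)" for \<omega>
    using sym[OF bij_exchange_indices, of "train X \<omega>" i j "X (Inl j) \<omega>"] by (simp add: train_def exchange_indices_def[of i j i])
  ultimately show ?thesis by simp
qed

text \<open>Swapping two test indices preserves the joint law and leaves the training sample untouched.\<close>

lemma exchange_test:
  fixes F :: "('k, 'p) covariate^'n \<Rightarrow> ('k, 'p) covariate \<Rightarrow> real"
  assumes iid: "iid M X UNIV"
    and [measurable]: "(\<lambda>z. F (fst z) (snd z)) \<in> borel_measurable borel"
    and int: "has_bochner_integral M (\<lambda>\<omega>. F (train X \<omega>) (X (Inr i) \<omega>)) v"
  shows "has_bochner_integral M (\<lambda>\<omega>. F (train X \<omega>) (X (Inr j) \<omega>)) v"
proof -
  let ?H = "\<lambda>x :: ('k, 'p) covariate^('n + 'n). F (\<chi> q. x $ Inl q) (x $ Inr i)"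
  have "(\<lambda>x. (\<chi> q. x $ Inl q, x $ Inr i)) \<in> borel_measurable (borel :: (('k, 'p) covariate^('n + 'n)) measure)"
    by (intro borel_measurable_Pair) measurable
  from measurable_compose[OF this assms(2)]
  have H: "?H \<in> borel_measurable borel" by simp
  have "has_bochner_integral M (\<lambda>\<omega>. ?H (\<chi> q. X (exchange_indices (Inr i) (Inr j) q) \<omega>)) v"
    by (rule iid_integral_transfer[OF prob_space_axioms iid inj_on_id prob_space_axioms iid
          bij_is_inj[OF bij_exchange_indices] refl H]) (use int in \<open>simp add: train_def\<close>)
  then show ?thesis by (simp add: exchange_indices_def train_def)
qed

lemma measurable_fit_bias_pair: "(\<lambda>z. fit_bias C W (fst z) (snd z))
    \<in> borel_measurable (borel :: ((('k, 'p) covariate^'m) \<times> ('k, 'p) covariate) measure)"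
  by measurable

lemma measurable_fit_var_pair: "(\<lambda>z. fit_var V W (fst z) (snd z))
    \<in> borel_measurable (borel :: ((('k, 'p) covariate^'m) \<times> ('k, 'p) covariate) measure)"
  by measurable

lemma fit_permute_sample:
  assumes "bij \<pi>"
  shows "fit_bias C W (\<chi> i. xs $ \<pi> i) x = fit_bias C W xs x"
    and "fit_var V' W (\<chi> i. xs $ \<pi> i) x = fit_var V' W xs x"
  by (simp_all add: fit_bias_def fit_var_def permute_sample[OF assms])

section \<open>The Same-X design\<close>

lemma same_X_bias:
  assumes iid: "iid M (\<lambda>i. X (Inl i)) UNIV"
    and int: "integrable M (sq_bias M (sigmaS M X) C W X Y (Inl i))"
  shows "has_bochner_integral M (\<lambda>\<omega>. fit_bias C W (train X \<omega>) (X (Inl j) \<omega>)) (B_ErrS M C W X Y i)"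
proof -
  have "AE \<omega> in M. sq_bias M (sigmaS M X) C W X Y (Inl i) \<omega> = fit_bias C W (train X \<omega>) (X (Inl i) \<omega>)"
    unfolding sigmaS_def
    by (rule sq_bias_AE[OF train_indep_errors, of "\<lambda>xs. xs" "\<lambda>xs. xs $ i"]) (simp_all add: train_def)
  then have "has_bochner_integral M (\<lambda>\<omega>. fit_bias C W (train X \<omega>) (X (Inl i) \<omega>)) (B_ErrS M C W X Y i)"
    unfolding B_ErrS_def by (intro has_bochner_integral_AE_eq int) measurable
  from exchange_train[where F = "fit_bias C W", OF iid measurable_fit_bias_pair _ this]
  show ?thesis by (simp add: fit_permute_sample(1))
qed

lemma same_X_var:
  assumes iid: "iid M (\<lambda>i. X (Inl i)) UNIV"
    and int: "integrable M (tr_var M (sigmaS M X) W X Y (Inl i))"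
  shows "has_bochner_integral M (\<lambda>\<omega>. fit_var V W (train X \<omega>) (X (Inl j) \<omega>)) (V_ErrS M W X Y i)"
proof -
  have "AE \<omega> in M. tr_var M (sigmaS M X) W X Y (Inl i) \<omega> = fit_var V W (train X \<omega>) (X (Inl i) \<omega>)"
    unfolding sigmaS_def
    by (rule tr_var_AE[OF train_indep_errors, of "\<lambda>xs. xs" "\<lambda>xs. xs $ i"]) (simp_all add: train_def)
  then have "has_bochner_integral M (\<lambda>\<omega>. fit_var V W (train X \<omega>) (X (Inl i) \<omega>)) (V_ErrS M W X Y i)"
    unfolding V_ErrS_def by (intro has_bochner_integral_AE_eq int) measurable
  from exchange_train[where F = "fit_var V W", OF iid measurable_fit_var_pair _ this]
  show ?thesis by (simp add: fit_permute_sample(2))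
qed

text \<open>Exchangeability replaces the variance at one index by the sum over the sample, where
  \<open>sum_fit_var\<close> evaluates it.\<close>

lemma same_X_var_sum:
  assumes iid: "iid M (\<lambda>i. X (Inl i)) UNIV"
    and inv: "AE \<omega> in M. invertible (gram W (train X \<omega>))"
    and int: "integrable M (tr_var M (sigmaS M X) W X Y (Inl i))"
  shows "has_bochner_integral M
      (\<lambda>\<omega>. trace (matrix_inv (gram W (train X \<omega>)) ** score_cov V W (train X \<omega>)))
      (real CARD('n) * V_ErrS M W X Y i)"
proof -
  have "has_bochner_integral M (\<lambda>\<omega>. \<Sum>j\<in>UNIV. fit_var V W (train X \<omega>) (X (Inl j) \<omega>))
      (\<Sum>j\<in>(UNIV :: 'n set). V_ErrS M W X Y i)"
    by (intro has_bochner_integral_sum same_X_var iid int)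
  moreover have "AE \<omega> in M. (\<Sum>j\<in>UNIV. fit_var V W (train X \<omega>) (X (Inl j) \<omega>))
      = trace (matrix_inv (gram W (train X \<omega>)) ** score_cov V W (train X \<omega>))"
    using inv
  proof eventually_elim
    case (elim \<omega>)
    then show ?case using sum_fit_var[OF elim, of V] by (simp add: train_def)
  qed
  moreover have "(\<lambda>\<omega>. trace (matrix_inv (gram W (train X \<omega>)) ** score_cov V W (train X \<omega>))) \<in> borel_measurable M"
    unfolding score_cov_def by measurable
  ultimately show ?thesis
    using has_bochner_integral_cong_AE[of "\<lambda>\<omega>. \<Sum>j\<in>UNIV. fit_var V W (train X \<omega>) (X (Inl j) \<omega>)" M]
    by simp
qed

lemma hat_cov_integral:
  assumes "integrable M (U_stat M W X Y)"
  shows "has_bochner_integral M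
      (\<lambda>\<omega>. trace (matrix_inv (gram W (train X \<omega>)) ** score_cov V W (train X \<omega>)))
      (\<integral>\<omega>. trace (hat_cov M W X Y \<omega>) \<partial>M)"
proof (rule has_bochner_integral_AE_eq)
  have "integrable M (\<lambda>\<omega>. real CARD('n) / 2 * U_stat M W X Y \<omega>)" using assms by simp
  then show "integrable M (\<lambda>\<omega>. trace (hat_cov M W X Y \<omega>))" by (simp add: U_stat_def)
  show "(\<lambda>\<omega>. trace (matrix_inv (gram W (train X \<omega>)) ** score_cov V W (train X \<omega>))) \<in> borel_measurable M"
    unfolding score_cov_def by measurable
  show "AE \<omega> in M. trace (hat_cov M W X Y \<omega>)
      = trace (matrix_inv (gram W (train X \<omega>)) ** score_cov V W (train X \<omega>))"
    using hat_cov_AE by eventually_elim simp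
qed

text \<open>Since test and training covariates coincide, bias, noise and variance cancel in the difference of
  test and training loss, and the optimism remains.\<close>

lemma OptS_eq:
  assumes same: "\<And>i \<omega>. \<omega> \<in> space M \<Longrightarrow> X (Inr i) \<omega> = X (Inl i) \<omega>"
    and test: "integrable M (test_loss W X Y)" and train: "integrable M (train_loss W X Y)"
    and U: "integrable M (U_stat M W X Y)"
  shows "OptS M W X Y = (\<integral>\<omega>. U_stat M W X Y \<omega> \<partial>M)"
proof -
  let ?p = "\<lambda>\<alpha>. \<integral>\<omega>. pred_loss W X Y \<alpha> \<omega> \<partial>M"
  have "has_bochner_integral M (\<lambda>\<omega>. 2 * optimism V W (train X \<omega>) i) (?p (Inr i) - ?p (Inl i))" for i
  proof -
    have "has_bochner_integral M (\<lambda>\<omega>. 2 * optimism V W (train X \<omega>) i) (?p (Inr i) - ?p (Inl i)) \<longleftrightarrow>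
      has_bochner_integral M (\<lambda>\<omega>.
        (fit_bias C W (train X \<omega>) (X (Inr i) \<omega>) + trace (W (X (Inr i) \<omega>) ** V (X (Inr i) \<omega>))
           + fit_var V W (train X \<omega>) (X (Inr i) \<omega>)) -
        (fit_bias C W (train X \<omega>) (X (Inl i) \<omega>) + trace (W (X (Inl i) \<omega>) ** V (X (Inl i) \<omega>))
           + fit_var V W (train X \<omega>) (X (Inl i) \<omega>) - 2 * optimism V W (train X \<omega>) i))
        (?p (Inr i) - ?p (Inl i))"
      by (rule has_bochner_integral_cong) (simp_all add: same)
    then show ?thesis
      using has_bochner_integral_diff[OF test_loss_integral[OF pred_loss_integrable_test[OF test]]
          train_loss_integral[OF pred_loss_integrable_train[OF train]], of i i] by simp
  qed
  then have "has_bochner_integral M (\<lambda>\<omega>. \<Sum>i\<in>UNIV. 2 * optimism V W (train X \<omega>) i)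
      (\<Sum>i\<in>UNIV. ?p (Inr i) - ?p (Inl i))"
    by (intro has_bochner_integral_sum)
  then have "has_bochner_integral M
      (\<lambda>\<omega>. 2 * trace (matrix_inv (gram W (train X \<omega>)) ** score_cov V W (train X \<omega>)))
      (\<Sum>i\<in>UNIV. ?p (Inr i) - ?p (Inl i))"
    by (simp add: sum_optimism flip: sum_distrib_left)
  from has_bochner_integral_eq[OF this has_bochner_integral_mult_right[OF hat_cov_integral[OF U]]]
  have "(\<Sum>i\<in>UNIV. ?p (Inr i) - ?p (Inl i)) = 2 * (\<integral>\<omega>. trace (hat_cov M W X Y \<omega>) \<partial>M)" .
  then show ?thesis
    by (simp add: OptS_def Err_def test_loss_sum[OF test] train_loss_sum[OF train] U_stat_def
        sum_subtractf diff_divide_distrib[symmetric])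
qed

section \<open>The Random-X design\<close>

lemma random_X_bias:
  assumes iid: "iid M X UNIV"
    and int: "integrable M (sq_bias M (sigmaR M X i) C W X Y (Inr i))"
  shows "has_bochner_integral M (\<lambda>\<omega>. fit_bias C W (train X \<omega>) (X (Inr j) \<omega>)) (B_ErrR M C W X Y i)"
proof -
  have "AE \<omega> in M. sq_bias M (sigmaR M X i) C W X Y (Inr i) \<omega> = fit_bias C W (train X \<omega>) (X (Inr i) \<omega>)"
    unfolding sigmaR_def
    by (rule sq_bias_AE[OF train_test_indep_errors, of fst snd]) simp_all
  then have "has_bochner_integral M (\<lambda>\<omega>. fit_bias C W (train X \<omega>) (X (Inr i) \<omega>)) (B_ErrR M C W X Y i)"
    unfolding B_ErrR_def by (intro has_bochner_integral_AE_eq int) measurable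
  then show ?thesis by (rule exchange_test[OF iid measurable_fit_bias_pair])
qed

lemma random_X_var:
  assumes iid: "iid M X UNIV"
    and int: "integrable M (tr_var M (sigmaR M X i) W X Y (Inr i))"
  shows "has_bochner_integral M (\<lambda>\<omega>. fit_var V W (train X \<omega>) (X (Inr j) \<omega>)) (V_ErrR M W X Y i)"
proof -
  have "AE \<omega> in M. tr_var M (sigmaR M X i) W X Y (Inr i) \<omega> = fit_var V W (train X \<omega>) (X (Inr i) \<omega>)"
    unfolding sigmaR_def
    by (rule tr_var_AE[OF train_test_indep_errors, of fst snd]) simp_all
  then have "has_bochner_integral M (\<lambda>\<omega>. fit_var V W (train X \<omega>) (X (Inr i) \<omega>)) (V_ErrR M W X Y i)"
    unfolding V_ErrR_def by (intro has_bochner_integral_AE_eq int) measurable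
  then show ?thesis by (rule exchange_test[OF iid measurable_fit_var_pair])
qed

text \<open>The Gram matrix of one point is integrable because its diagonal is dominated by that of the sum
  over the sample, and its other entries by its diagonal. It has the same mean at every index, a
  share \<open>1 / n\<close> of the mean of the sum.\<close>

lemma point_gram_integral:
  assumes iid: "iid M X UNIV" and int: "integrable M (\<lambda>\<omega>. gram W (train X \<omega>))"
  shows "has_bochner_integral M (\<lambda>\<omega>. real CARD('n) * point_gram W (X \<alpha> \<omega>) $ a $ b)
      ((\<integral>\<omega>. gram W (train X \<omega>) \<partial>M) $ a $ b)"
proof -
  have gram_nth: "gram W (train X \<omega>) $ a $ b = (\<Sum>i\<in>UNIV. point_gram W (X (Inl i) \<omega>) $ a $ b)" for \<omega> a b
    by (simp add: gram_eq train_def matrix_sum_nth)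
  have transfer: "has_bochner_integral M (\<lambda>\<omega>. point_gram W (X \<gamma> \<omega>) $ a $ b) v"
    if "has_bochner_integral M (\<lambda>\<omega>. point_gram W (X \<beta> \<omega>) $ a $ b) v" for \<beta> \<gamma> v a b
    \<comment> \<open>A single index is treated as a family over the unit type.\<close>
    using iid_integral_transfer[OF prob_space_axioms iid _ prob_space_axioms iid _ refl, of
        "\<lambda>_::unit. \<beta>" "\<lambda>_::unit. \<gamma>" "\<lambda>x. point_gram W (x $ ()) $ a $ b" v] that
    by (simp add: inj_on_def)
  have diag: "integrable M (\<lambda>\<omega>. point_gram W (X (Inl i) \<omega>) $ a $ a)" for i a
  proof (rule Bochner_Integration.integrable_bound)
    show "integrable M (\<lambda>\<omega>. gram W (train X \<omega>) $ a $ a)"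
      using integral_matrix_nth[OF int] by (simp add: has_bochner_integral_iff)
    have "0 \<le> point_gram W (X (Inl i) \<omega>) $ a $ a" for i \<omega>
      by (rule psd_entry_bound(2)[OF psd_point_gram])
    moreover from this have "point_gram W (X (Inl i) \<omega>) $ a $ a \<le> gram W (train X \<omega>) $ a $ a" for \<omega>
      unfolding gram_nth by (intro member_le_sum) auto
    ultimately show "AE \<omega> in M. norm (point_gram W (X (Inl i) \<omega>) $ a $ a) \<le> norm (gram W (train X \<omega>) $ a $ a)"
      by (auto intro!: AE_I2 order_trans[OF _ abs_ge_self])
  qed measurable
  have "integrable M (\<lambda>\<omega>. point_gram W (X (Inl i) \<omega>) $ a $ b)" for i
  proof (rule Bochner_Integration.integrable_bound)
    show "integrable M (\<lambda>\<omega>. point_gram W (X (Inl i) \<omega>) $ a $ a + point_gram W (X (Inl i) \<omega>) $ b $ b)"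
      using diag by simp
    show "AE \<omega> in M. norm (point_gram W (X (Inl i) \<omega>) $ a $ b)
        \<le> norm (point_gram W (X (Inl i) \<omega>) $ a $ a + point_gram W (X (Inl i) \<omega>) $ b $ b)"
      using psd_entry_bound(1)[OF psd_point_gram] by (auto intro!: AE_I2 order_trans[OF _ abs_ge_self])
  qed measurable
  then have "has_bochner_integral M (\<lambda>\<omega>. point_gram W (X \<beta> \<omega>) $ a $ b)
      (\<integral>\<omega>. point_gram W (X (Inl undefined) \<omega>) $ a $ b \<partial>M)" for \<beta>
    using transfer[OF has_bochner_integral_integrable] by blast
  note one = this
  have "has_bochner_integral M (\<lambda>\<omega>. gram W (train X \<omega>) $ a $ b)
      (\<Sum>i\<in>(UNIV :: 'n set). \<integral>\<omega>. point_gram W (X (Inl undefined) \<omega>) $ a $ b \<partial>M)"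
    unfolding gram_nth by (intro has_bochner_integral_sum one)
  from has_bochner_integral_eq[OF this integral_matrix_nth[OF int]]
  have "(\<integral>\<omega>. gram W (train X \<omega>) \<partial>M) $ a $ b
      = real CARD('n) * (\<integral>\<omega>. point_gram W (X (Inl undefined) \<omega>) $ a $ b \<partial>M)" by simp
  then show ?thesis using has_bochner_integral_mult_right[OF one] by simp
qed

lemma train_indep_test:
  fixes f :: "('k, 'p) covariate^'n \<Rightarrow> real" and g :: "('k, 'p) covariate \<Rightarrow> real"
  assumes iid: "iid M X UNIV"
    and [measurable]: "f \<in> borel_measurable borel" "g \<in> borel_measurable borel"
  shows "indep_var borel (\<lambda>\<omega>. f (train X \<omega>)) borel (\<lambda>\<omega>. g (X (Inr i) \<omega>))"
proof -
  have "indep_vars (\<lambda>_. borel) X UNIV" using iid by (simp add: iid_def)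
  from indep_var_restrict[OF this, of "range Inl" "{Inr i}"]
  have ind: "indep_var (PiM (range Inl) (\<lambda>_. borel)) (\<lambda>\<omega>. restrict (\<lambda>\<alpha>. X \<alpha> \<omega>) (range Inl))
      (PiM {Inr i} (\<lambda>_. borel)) (\<lambda>\<omega>. restrict (\<lambda>\<alpha>. X \<alpha> \<omega>) {Inr i})" by auto
  have "(\<lambda>h. f (\<chi> j. h (Inl j))) \<in> borel_measurable (PiM (range Inl) (\<lambda>_. borel))"
    "(\<lambda>h. g (h (Inr i))) \<in> borel_measurable (PiM {Inr i} (\<lambda>_. borel))"
    by measurable
  from indep_var_compose[OF ind this] show ?thesis by (simp add: comp_def train_def)
qed

text \<open>The trace is a sum of products of an entry of \<open>wls_cov\<close>, a function of the training sample, and an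
  entry of the Gram matrix of the test point, which is independent of it.\<close>

lemma fit_var_factorises:
  assumes iid: "iid M X UNIV"
    and inv: "AE \<omega> in M. invertible (gram W (train X \<omega>))"
    and S: "integrable M (sandwich M W X Y)" and G: "integrable M (\<lambda>\<omega>. gram W (train X \<omega>))"
  shows "has_bochner_integral M (\<lambda>\<omega>. real CARD('n) * fit_var V W (train X \<omega>) (X (Inr i) \<omega>))
     (trace ((\<integral>\<omega>. sandwich M W X Y \<omega> \<partial>M) ** (\<integral>\<omega>. gram W (train X \<omega>) \<partial>M)))"
proof -
  have S': "has_bochner_integral M (\<lambda>\<omega>. wls_cov V W (train X \<omega>) $ a $ b)
      ((\<integral>\<omega>. sandwich M W X Y \<omega> \<partial>M) $ a $ b)" for a b
  proof -
    have "AE \<omega> in M. sandwich M W X Y \<omega> $ a $ b = wls_cov V W (train X \<omega>) $ a $ b"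
      using sandwich_AE[OF inv] by eventually_elim simp
    moreover have "(\<lambda>\<omega>. wls_cov V W (train X \<omega>) $ a $ b) \<in> borel_measurable M" by measurable
    ultimately show ?thesis
      using has_bochner_integral_AE_eq[of M "\<lambda>\<omega>. sandwich M W X Y \<omega> $ a $ b"] integral_matrix_nth[OF S, of a b]
      by (auto simp: has_bochner_integral_iff)
  qed
  have "has_bochner_integral M (\<lambda>\<omega>. wls_cov V W (train X \<omega>) $ a $ b *
      (real CARD('n) * point_gram W (X (Inr i) \<omega>) $ b $ a))
    ((\<integral>\<omega>. sandwich M W X Y \<omega> \<partial>M) $ a $ b * (\<integral>\<omega>. gram W (train X \<omega>) \<partial>M) $ b $ a)" for a b
  proof -
    have ind: "indep_var borel (\<lambda>\<omega>. wls_cov V W (train X \<omega>) $ a $ b)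
        borel (\<lambda>\<omega>. real CARD('n) * point_gram W (X (Inr i) \<omega>) $ b $ a)"
      by (rule train_indep_test[OF iid]) measurable
    show ?thesis
      using indep_var_integrable[OF ind] indep_var_lebesgue_integral[OF ind] S'[of a b]
        point_gram_integral[OF iid G, of "Inr i" b a]
      by (simp add: has_bochner_integral_iff)
  qed
  then have "has_bochner_integral M (\<lambda>\<omega>. \<Sum>a\<in>UNIV. \<Sum>b\<in>UNIV. wls_cov V W (train X \<omega>) $ a $ b *
      (real CARD('n) * point_gram W (X (Inr i) \<omega>) $ b $ a))
    (\<Sum>a\<in>UNIV. \<Sum>b\<in>UNIV. (\<integral>\<omega>. sandwich M W X Y \<omega> \<partial>M) $ a $ b * (\<integral>\<omega>. gram W (train X \<omega>) \<partial>M) $ b $ a)"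
    by (intro has_bochner_integral_sum)
  then show ?thesis
    by (simp add: fit_var_def trace_mult sum_distrib_left mult.left_commute)
qed

lemma sandwich_test_integral:
  assumes inv: "AE \<omega> in M. invertible (gram W (train X \<omega>))"
    and int: "integrable M (\<lambda>\<omega>. trace (sandwich_test M W X Y i \<omega>))"
  shows "has_bochner_integral M (\<lambda>\<omega>. fit_var V W (train X \<omega>) (X (Inr i) \<omega>))
     (\<integral>\<omega>. trace (sandwich_test M W X Y i \<omega>) \<partial>M)"
proof (rule has_bochner_integral_AE_eq[OF int])
  show "AE \<omega> in M. trace (sandwich_test M W X Y i \<omega>) = fit_var V W (train X \<omega>) (X (Inr i) \<omega>)"
    using sandwich_AE[OF inv] by eventually_elim
      (simp add: sandwich_test_def fit_var_def point_gram_def matrix_mul_assoc)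
qed measurable

section \<open>Optimal weights\<close>

text \<open>That \<open>W x\<close> is the Moore--Penrose inverse of \<open>V x\<close>, expressed by the Penrose equations. This form
  is symmetric in \<open>V\<close> and \<open>W\<close> and visibly measurable in \<open>x\<close>.\<close>

definition optimal_at :: "('k, 'p) covariate \<Rightarrow> bool" where
  "optimal_at x \<longleftrightarrow> penrose (V x) (W x)"

lemma optimal_AE:
  assumes "\<And>\<alpha>. AE \<omega> in M. W (X \<alpha> \<omega>) = pinv (V_cov M X Y \<alpha> \<omega>)"
  shows "AE \<omega> in M. \<forall>\<alpha>. optimal_at (X \<alpha> \<omega>)"
proof -
  have "AE \<omega> in M. \<forall>\<alpha>. W (X \<alpha> \<omega>) = pinv (V_cov M X Y \<alpha> \<omega>)"
    using assms by (simp add: AE_all_countable)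
  then show ?thesis
    using V_cov_AE_all
  proof eventually_elim
    case (elim \<omega>)
    have "penrose (V x) (pinv (V x))" for x
      using psd_V[of x] by (intro penrose_pinv_symmetric) (simp add: psd_def)
    then show ?case using elim by (simp add: optimal_at_def)
  qed
qed

lemma optimal_score_cov:
  assumes "\<And>i. optimal_at (xs $ i)"
  shows "score_cov V W xs = gram W xs"
proof -
  have "W x ** V x ** W x = W x" if "optimal_at x" for x
    using that by (simp add: optimal_at_def penrose_def)
  then have "W (xs $ i) ** V (xs $ i) ** W (xs $ i) = W (xs $ i)" for i using assms by blast
  then have "transpose (design (xs $ i)) ** (W (xs $ i) ** V (xs $ i) ** W (xs $ i)) ** design (xs $ i)
      = transpose (design (xs $ i)) ** W (xs $ i) ** design (xs $ i)" for i by simp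
  then show ?thesis by (simp add: score_cov_def gram_eq point_gram_eq matrix_mul_assoc)
qed

lemma optimal_V_ErrS_eq:
  assumes iid: "iid M (\<lambda>i. X (Inl i)) UNIV"
    and inv: "AE \<omega> in M. invertible (gram W (train X \<omega>))"
    and int: "integrable M (tr_var M (sigmaS M X) W X Y (Inl i))"
    and opt: "AE \<omega> in M. \<forall>\<alpha>. optimal_at (X \<alpha> \<omega>)"
  shows "real CARD('n) * V_ErrS M W X Y i = real CARD('k)"
proof -
  have "AE \<omega> in M. trace (matrix_inv (gram W (train X \<omega>)) ** score_cov V W (train X \<omega>)) = real CARD('k)"
    using inv opt
  proof eventually_elim
    case (elim \<omega>)
    have "score_cov V W (train X \<omega>) = gram W (train X \<omega>)"
      by (rule optimal_score_cov) (use elim(2) in \<open>simp add: train_def\<close>)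
    then show ?case by (simp add: matrix_inv_inverse[OF elim(1)] trace_I)
  qed
  then have "(\<integral>\<omega>. trace (matrix_inv (gram W (train X \<omega>)) ** score_cov V W (train X \<omega>)) \<partial>M)
      = (\<integral>\<omega>. real CARD('k) \<partial>M)"
    using same_X_var_sum[OF iid inv int]
    by (intro integral_cong_AE) (auto simp: has_bochner_integral_iff)
  then show ?thesis
    using same_X_var_sum[OF iid inv int] by (simp add: has_bochner_integral_iff prob_space)
qed

text \<open>If the mean annihilates \<open>v\<close>, then the nonnegative variable \<open>v \<bullet> (gram *v v)\<close> has expectation
  zero, hence vanishes almost surely, while the Gram matrix is almost surely regular.\<close>

lemma expected_gram_posdef:
  assumes inv: "AE \<omega> in M. invertible (gram W (train X \<omega>))"
    and int: "integrable M (\<lambda>\<omega>. gram W (train X \<omega>))"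
  shows "psd (\<integral>\<omega>. gram W (train X \<omega>) \<partial>M)" and "invertible (\<integral>\<omega>. gram W (train X \<omega>) \<partial>M)"
proof -
  let ?A = "\<integral>\<omega>. gram W (train X \<omega>) \<partial>M"
  have A: "has_bochner_integral M (\<lambda>\<omega>. v \<bullet> (gram W (train X \<omega>) *v v)) (v \<bullet> (?A *v v))" for v
  proof -
    have "has_bochner_integral M (\<lambda>\<omega>. \<Sum>a\<in>UNIV. \<Sum>b\<in>UNIV. (v $ a * v $ b) * gram W (train X \<omega>) $ a $ b)
        (\<Sum>a\<in>UNIV. \<Sum>b\<in>UNIV. (v $ a * v $ b) * ?A $ a $ b)"
      by (intro has_bochner_integral_sum has_bochner_integral_mult_right integral_matrix_nth int)
    then show ?thesis
      by (simp add: inner_vec_def matrix_vector_mult_def sum_distrib_left mult_ac)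
  qed
  have nonneg: "0 \<le> v \<bullet> (gram W (train X \<omega>) *v v)" for v \<omega>
    using psd_gram[of "train X \<omega>"] by (simp add: psd_def)
  have "?A $ a $ b = ?A $ b $ a" for a b
  proof -
    have "gram W (train X \<omega>) $ a $ b = gram W (train X \<omega>) $ b $ a" for \<omega>
    proof -
      have "transpose (gram W (train X \<omega>)) $ a $ b = gram W (train X \<omega>) $ a $ b"
        by (simp only: transpose_gram)
      then show ?thesis by (simp add: transpose_def)
    qed
    then show ?thesis
      using has_bochner_integral_eq[OF integral_matrix_nth[OF int, of a b]]
        integral_matrix_nth[OF int, of b a] by simp
  qed
  moreover have "0 \<le> v \<bullet> (?A *v v)" for v
  proof -
    have "0 \<le> (\<integral>\<omega>. v \<bullet> (gram W (train X \<omega>) *v v) \<partial>M)"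
      by (rule integral_nonneg_AE) (simp add: nonneg)
    then show ?thesis using A[of v] by (simp add: has_bochner_integral_iff)
  qed
  ultimately show "psd ?A" by (simp add: psd_def vec_eq_iff transpose_def)
  have "v = 0" if v: "?A *v v = 0" for v
  proof -
    have "(\<integral>\<omega>. v \<bullet> (gram W (train X \<omega>) *v v) \<partial>M) = 0"
      using A[of v] v by (simp add: has_bochner_integral_iff)
    then have "AE \<omega> in M. v \<bullet> (gram W (train X \<omega>) *v v) = 0"
      using A[of v] nonneg by (subst (asm) integral_nonneg_eq_0_iff_AE) (auto simp: has_bochner_integral_iff)
    then have "AE \<omega> in M. v = 0"
      using inv
    proof eventually_elim
      case (elim \<omega>)
      let ?G = "gram W (train X \<omega>)" and ?X = "XX_tilde W (train X \<omega>)"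
      have "v \<bullet> (?G *v v) = (?X *v v) \<bullet> (?X *v v)"
        by (simp add: gram_def inner_transpose_mult flip: matrix_vector_mul_assoc
            del: transpose_matrix_vector)
      then have "?X *v v = 0" using elim by simp
      then have "?G *v v = 0"
        by (simp add: gram_def flip: matrix_vector_mul_assoc)
      then have "matrix_inv ?G *v (?G *v v) = 0" by simp
      then show "v = 0" by (simp add: matrix_vector_mul_assoc matrix_inv_inverse[OF elim(2)])
    qed
    then show ?thesis by simp
  qed
  then have "inj ((*v) ?A)"
    by (subst linear_injective_0) auto
  then show "invertible ?A" by (simp add: invertible_left_inverse matrix_left_invertible_injective)
qed

text \<open>Here the sandwich is the inverse of the Gram matrix, and the bound results from integrating
  \<open>trace_inverse_product_ge\<close> with \<open>A\<close> the expected Gram matrix: then the term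
  \<open>trace (matrix_inv A ** gram)\<close> has expectation exactly \<open>K\<close>.\<close>

lemma optimal_sandwich_trace_ge:
  assumes inv: "AE \<omega> in M. invertible (gram W (train X \<omega>))"
    and S: "integrable M (sandwich M W X Y)" and G: "integrable M (\<lambda>\<omega>. gram W (train X \<omega>))"
    and opt: "AE \<omega> in M. \<forall>\<alpha>. optimal_at (X \<alpha> \<omega>)"
  shows "real CARD('k) \<le> trace ((\<integral>\<omega>. sandwich M W X Y \<omega> \<partial>M) ** (\<integral>\<omega>. gram W (train X \<omega>) \<partial>M))"
proof -
  let ?A = "\<integral>\<omega>. gram W (train X \<omega>) \<partial>M"
  note A = expected_gram_posdef[OF inv G]
  have tr: "has_bochner_integral M (\<lambda>\<omega>. trace (f \<omega> ** R)) (trace ((\<integral>\<omega>. f \<omega> \<partial>M) ** R))"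
    if "integrable M f" for f :: "'w \<Rightarrow> real^'k^'k" and R
    unfolding trace_mult
    by (intro has_bochner_integral_sum has_bochner_integral_mult_left integral_matrix_nth that)
  have G': "has_bochner_integral M (\<lambda>\<omega>. trace (matrix_inv ?A ** gram W (train X \<omega>))) (real CARD('k))"
    using tr[OF G, of "matrix_inv ?A"]
    by (simp add: trace_mul_sym[of _ "matrix_inv ?A"] matrix_inv_inverse[OF A(2)] trace_I)
  have "AE \<omega> in M. 2 * real CARD('k) - trace (matrix_inv ?A ** gram W (train X \<omega>))
      \<le> trace (sandwich M W X Y \<omega> ** ?A)"
    using sandwich_AE[OF inv] inv opt
  proof eventually_elim
    case (elim \<omega>)
    have "score_cov V W (train X \<omega>) = gram W (train X \<omega>)"
      by (rule optimal_score_cov) (use elim(3) in \<open>simp add: train_def\<close>)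
    then have "sandwich M W X Y \<omega> = matrix_inv (gram W (train X \<omega>))"
      by (simp add: elim(1) wls_cov_eq[OF elim(2)] matrix_inv_inverse[OF elim(2)])
    then show ?case
      using trace_inverse_product_ge[OF psd_gram elim(2) A] by simp
  qed
  then have "(\<integral>\<omega>. 2 * real CARD('k) - trace (matrix_inv ?A ** gram W (train X \<omega>)) \<partial>M)
      \<le> (\<integral>\<omega>. trace (sandwich M W X Y \<omega> ** ?A) \<partial>M)"
    using tr[OF S, of ?A] G' by (intro integral_mono_AE) (auto simp: has_bochner_integral_iff)
  then show ?thesis
    using tr[OF S, of ?A] G' by (simp add: has_bochner_integral_iff prob_space)
qed

lemma test_error_decomposition:
  assumes int: "integrable M (pred_loss W X Y (Inr i))"
    and B: "has_bochner_integral M (\<lambda>\<omega>. fit_bias C W (train X \<omega>) (X (Inr i) \<omega>)) B"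
    and R: "has_bochner_integral M (\<lambda>\<omega>. fit_var V W (train X \<omega>) (X (Inr i) \<omega>)) R"
  shows "has_bochner_integral M (\<lambda>\<omega>. trace (W (X (Inr i) \<omega>) ** V (X (Inr i) \<omega>)))
     ((\<integral>\<omega>. pred_loss W X Y (Inr i) \<omega> \<partial>M) - B - R)"
  using has_bochner_integral_diff[OF has_bochner_integral_diff[OF test_loss_integral[OF int] B] R]
  by simp

end

section \<open>Comparison of the two designs\<close>

text \<open>The link between the two probability spaces is the common law of a single covariate.\<close>

locale two_designs =
  R: covariance_model MR C W \<mu>4 XR YR ER + S: covariance_model MS C W \<mu>4 XS YS ES
  for MR :: "'r measure" and MS :: "'s measure"
    and C :: "('k::finite, 'p::finite) covariate \<Rightarrow> real^'p^'p" and W :: "('k, 'p) weight"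
    and \<mu>4 :: real
    and XR :: "'n::finite + 'n \<Rightarrow> 'r \<Rightarrow> ('k, 'p) covariate" and YR ER :: "'n + 'n \<Rightarrow> 'r \<Rightarrow> real^'p"
    and XS :: "'n + 'n \<Rightarrow> 's \<Rightarrow> ('k, 'p) covariate" and YS ES :: "'n + 'n \<Rightarrow> 's \<Rightarrow> real^'p" +
  fixes i1 :: 'n
  assumes iidR: "iid MR XR UNIV" and iidS: "iid MS (\<lambda>i. XS (Inl i)) UNIV"
    and same_X: "\<omega> \<in> space MS \<Longrightarrow> XS (Inr i) \<omega> = XS (Inl i) \<omega>"
    and marginal: "distr MR borel (XR (Inl i1)) = distr MS borel (XS (Inl i1))"
    and invR: "AE \<omega> in MR. invertible (gram W (train XR \<omega>))"
    and invS: "AE \<omega> in MS. invertible (gram W (train XS \<omega>))"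
begin

text \<open>The coefficient fitted to the Random-X training sample competes on the Random-X test sample with
  the one fitted to that sample, and the resulting minimum is distributed as under Same-X.\<close>

lemma bias_gap:
  assumes intR: "integrable MR (sq_bias MR (sigmaR MR XR i1) C W XR YR (Inr i1))"
    and intS: "integrable MS (sq_bias MS (sigmaS MS XS) C W XS YS (Inl i1))"
  shows "B_ErrS MS C W XS YS i1 \<le> B_ErrR MR C W XR YR i1"
proof -
  let ?h = "\<lambda>xs :: ('k, 'p) covariate^'n. \<Sum>i\<in>UNIV. fit_bias C W xs (xs $ i)"
  let ?test = "\<lambda>\<omega>. \<chi> i. XR (Inr i) \<omega>"
  have inj: "inj (Inl :: 'n \<Rightarrow> 'n + 'n)" "inj (Inr :: 'n \<Rightarrow> 'n + 'n)" by auto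
  have "{xs :: ('k, 'p) covariate^'n. invertible (gram W xs)} = {xs \<in> space borel. det (gram W xs) \<noteq> 0}"
    by (simp add: invertible_det_nz)
  then have inv_sets: "{xs :: ('k, 'p) covariate^'n. invertible (gram W xs)} \<in> sets borel"
    by simp
  have inv: "AE \<omega> in MR. invertible (gram W (?test \<omega>))"
    by (rule iid_AE_transfer[OF R.prob_space_axioms iidR inj(1) R.prob_space_axioms iidR inj(2) refl inv_sets])
      (use invR in \<open>simp add: train_def\<close>)
  have h: "?h \<in> borel_measurable borel" by measurable
  have "has_bochner_integral MS (\<lambda>\<omega>. \<Sum>i\<in>UNIV. fit_bias C W (train XS \<omega>) (XS (Inl i) \<omega>))
      (\<Sum>i\<in>(UNIV :: 'n set). B_ErrS MS C W XS YS i1)"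
    by (intro has_bochner_integral_sum S.same_X_bias iidS intS)
  then have "has_bochner_integral MS (\<lambda>\<omega>. ?h (\<chi> i. XS (Inl (id i)) \<omega>)) (real CARD('n) * B_ErrS MS C W XS YS i1)"
    by (simp add: train_def)
  then have S: "has_bochner_integral MR (\<lambda>\<omega>. ?h (?test \<omega>)) (real CARD('n) * B_ErrS MS C W XS YS i1)"
    by (rule iid_integral_transfer[OF S.prob_space_axioms iidS inj_on_id R.prob_space_axioms iidR
          inj(2) marginal[symmetric] h])
  have R: "has_bochner_integral MR (\<lambda>\<omega>. \<Sum>i\<in>UNIV. fit_bias C W (train XR \<omega>) (XR (Inr i) \<omega>))
      (\<Sum>i\<in>(UNIV :: 'n set). B_ErrR MR C W XR YR i1)"
    by (intro has_bochner_integral_sum R.random_X_bias iidR intR)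
  have "AE \<omega> in MR. ?h (?test \<omega>) \<le> (\<Sum>i\<in>UNIV. fit_bias C W (train XR \<omega>) (XR (Inr i) \<omega>))"
    using inv
  proof eventually_elim
    case (elim \<omega>)
    then show ?case
      using R.least_squares_minimal[OF elim, of "wls_mean C W (train XR \<omega>)"]
      by (simp add: fit_bias_def)
  qed
  then have "real CARD('n) * B_ErrS MS C W XS YS i1 \<le> real CARD('n) * B_ErrR MR C W XR YR i1"
    using integral_mono_AE[of MR "\<lambda>\<omega>. ?h (?test \<omega>)"
        "\<lambda>\<omega>. \<Sum>i\<in>UNIV. fit_bias C W (train XR \<omega>) (XR (Inr i) \<omega>)"] S R
    by (simp add: has_bochner_integral_iff)
  then show ?thesis by simp
qed

text \<open>The functions \<open>R.V\<close> and \<open>S.V\<close> are defined by the error laws of two different spaces. They agree at almost every covariate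
  since both are Moore--Penrose inverses of the same \<open>W\<close>. The equations for \<open>R.V\<close>, which hold under
  the law of the Random-X covariates, are carried to Same-X as a measurable property of the
  covariate.\<close>

lemma same_noise:
  assumes optR: "AE \<omega> in MR. \<forall>\<alpha>. R.optimal_at (XR \<alpha> \<omega>)"
    and optS: "AE \<omega> in MS. \<forall>\<alpha>. S.optimal_at (XS \<alpha> \<omega>)"
    and int: "has_bochner_integral MR (\<lambda>\<omega>. trace (W (XR (Inr i) \<omega>) ** R.V (XR (Inr i) \<omega>))) N"
  shows "has_bochner_integral MS (\<lambda>\<omega>. trace (W (XS (Inr j) \<omega>) ** S.V (XS (Inr j) \<omega>))) N"
proof -
  have "{x. R.optimal_at x} = {x \<in> space borel. R.V x ** W x ** R.V x = R.V x} \<inter>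
      {x \<in> space borel. W x ** R.V x ** W x = W x} \<inter>
      {x \<in> space borel. transpose (R.V x ** W x) = R.V x ** W x} \<inter>
      {x \<in> space borel. transpose (W x ** R.V x) = W x ** R.V x}"
    by (auto simp: R.optimal_at_def penrose_def)
  also have "\<dots> \<in> sets borel"
    by (intro sets.Int borel_measurable_eq) measurable
  finally have "{x. R.optimal_at x} \<in> sets borel" .
  then have sets: "{x :: ('k, 'p) covariate^unit. R.optimal_at (x $ ())} \<in> sets borel"
    using measurable_sets[of "\<lambda>x. x $ ()" "borel :: (('k, 'p) covariate^unit) measure" borel "{x. R.optimal_at x}"]
    by (simp add: vimage_def)
  have inj: "inj (\<lambda>_::unit. Inr i :: 'n + 'n)" "inj (\<lambda>_::unit. j)"
    by (simp_all add: inj_on_def)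
  have "AE \<omega> in MR. R.optimal_at ((\<chi> q::unit. XR (Inr i) \<omega>) $ ())"
    using optR unfolding vec_lambda_beta by eventually_elim blast
  then have "AE \<omega> in MS. R.optimal_at ((\<chi> q::unit. XS (Inl j) \<omega>) $ ())"
    by (rule iid_AE_transfer[OF R.prob_space_axioms iidR inj(1) S.prob_space_axioms iidS inj(2) marginal
          sets])
  then have "AE \<omega> in MS. R.optimal_at (XS (Inl j) \<omega>)" unfolding vec_lambda_beta .
  then have "AE \<omega> in MS. trace (W (XS (Inl j) \<omega>) ** R.V (XS (Inl j) \<omega>))
      = trace (W (XS (Inr j) \<omega>) ** S.V (XS (Inr j) \<omega>))"
    using optS AE_space
  proof eventually_elim
    case (elim \<omega>)
    then have "R.V (XS (Inl j) \<omega>) = S.V (XS (Inl j) \<omega>)"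
      by (intro penrose_unique[OF penrose_sym penrose_sym])
        (auto simp: R.optimal_at_def S.optimal_at_def)
    then show ?case using elim by (simp add: same_X)
  qed
  moreover have "has_bochner_integral MS (\<lambda>\<omega>. trace (W (XS (Inl j) \<omega>) ** R.V (XS (Inl j) \<omega>))) N"
  proof -
    have "(\<lambda>x :: ('k, 'p) covariate^unit. trace (W (x $ ()) ** R.V (x $ ()))) \<in> borel_measurable borel"
      by measurable
    from iid_integral_transfer[OF R.prob_space_axioms iidR inj(1) S.prob_space_axioms iidS inj(2)
        marginal this, of N]
    show ?thesis using int by simp
  qed
  ultimately show ?thesis
    using has_bochner_integral_AE_eq[of MS "\<lambda>\<omega>. trace (W (XS (Inl j) \<omega>) ** R.V (XS (Inl j) \<omega>))"
        "\<lambda>\<omega>. trace (W (XS (Inr j) \<omega>) ** S.V (XS (Inr j) \<omega>))"]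
    by (simp add: has_bochner_integral_iff)
qed

lemma V_ErrR_eq:
  assumes "integrable MR (tr_var MR (sigmaR MR XR i1) W XR YR (Inr i1))"
    and "integrable MR (sandwich MR W XR YR)" and "integrable MR (\<lambda>\<omega>. gram W (train XR \<omega>))"
  shows "real CARD('n) * V_ErrR MR W XR YR i1
      = trace ((\<integral>\<omega>. sandwich MR W XR YR \<omega> \<partial>MR) ** (\<integral>\<omega>. gram W (train XR \<omega>) \<partial>MR))"
  by (rule has_bochner_integral_eq[OF has_bochner_integral_mult_right[OF
        R.random_X_var[OF iidR assms(1)]] R.fit_var_factorises[OF iidR invR assms(2,3)]])

lemma variance_gap:
  assumes optR: "AE \<omega> in MR. \<forall>\<alpha>. R.optimal_at (XR \<alpha> \<omega>)"
    and optS: "AE \<omega> in MS. \<forall>\<alpha>. S.optimal_at (XS \<alpha> \<omega>)"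
    and intR: "integrable MR (tr_var MR (sigmaR MR XR i1) W XR YR (Inr i1))"
    and intS: "integrable MS (tr_var MS (sigmaS MS XS) W XS YS (Inl i1))"
    and sand: "integrable MR (sandwich MR W XR YR)"
    and gram: "integrable MR (\<lambda>\<omega>. gram W (train XR \<omega>))"
  shows "V_ErrS MS W XS YS i1 \<le> V_ErrR MR W XR YR i1"
proof -
  have "real CARD('n) * V_ErrS MS W XS YS i1 \<le> real CARD('n) * V_ErrR MR W XR YR i1"
    using R.optimal_sandwich_trace_ge[OF invR sand gram optR] S.optimal_V_ErrS_eq[OF iidS invS intS optS]
      V_ErrR_eq[OF intR sand gram] by simp
  then show ?thesis by simp
qed

text \<open>The error splits into noise, bias and variance in both designs, and the noise terms
  cancel by \<open>same_noise\<close>.\<close>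

lemma error_gap:
  assumes optR: "AE \<omega> in MR. \<forall>\<alpha>. R.optimal_at (XR \<alpha> \<omega>)"
    and optS: "AE \<omega> in MS. \<forall>\<alpha>. S.optimal_at (XS \<alpha> \<omega>)"
    and testR: "integrable MR (test_loss W XR YR)" and testS: "integrable MS (test_loss W XS YS)"
    and biasR: "integrable MR (sq_bias MR (sigmaR MR XR i1) C W XR YR (Inr i1))"
    and biasS: "integrable MS (sq_bias MS (sigmaS MS XS) C W XS YS (Inl i1))"
    and varR: "integrable MR (tr_var MR (sigmaR MR XR i1) W XR YR (Inr i1))"
    and varS: "integrable MS (tr_var MS (sigmaS MS XS) W XS YS (Inl i1))"
  shows "Err MR W XR YR - Err MS W XS YS
    = (B_ErrR MR C W XR YR i1 - B_ErrS MS C W XS YS i1) + (V_ErrR MR W XR YR i1 - V_ErrS MS W XS YS i1)"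
proof -
  have R: "has_bochner_integral MR (\<lambda>\<omega>. trace (W (XR (Inr i) \<omega>) ** R.V (XR (Inr i) \<omega>)))
      ((\<integral>\<omega>. pred_loss W XR YR (Inr i) \<omega> \<partial>MR) - B_ErrR MR C W XR YR i1 - V_ErrR MR W XR YR i1)" for i
    by (rule R.test_error_decomposition[OF R.pred_loss_integrable_test[OF testR]
          R.random_X_bias[OF iidR biasR] R.random_X_var[OF iidR varR]])
  have S: "has_bochner_integral MS (\<lambda>\<omega>. trace (W (XS (Inr i) \<omega>) ** S.V (XS (Inr i) \<omega>)))
      ((\<integral>\<omega>. pred_loss W XS YS (Inr i) \<omega> \<partial>MS) - B_ErrS MS C W XS YS i1 - V_ErrS MS W XS YS i1)" for i
  proof (rule S.test_error_decomposition[OF S.pred_loss_integrable_test[OF testS]])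
    show "has_bochner_integral MS (\<lambda>\<omega>. fit_bias C W (train XS \<omega>) (XS (Inr i) \<omega>)) (B_ErrS MS C W XS YS i1)"
      using S.same_X_bias[OF iidS biasS, of i]
      by (rule has_bochner_integral_cong[THEN iffD1, rotated -1]) (simp_all add: same_X)
    show "has_bochner_integral MS (\<lambda>\<omega>. fit_var S.V W (train XS \<omega>) (XS (Inr i) \<omega>)) (V_ErrS MS W XS YS i1)"
      using S.same_X_var[OF iidS varS, of i]
      by (rule has_bochner_integral_cong[THEN iffD1, rotated -1]) (simp_all add: same_X)
  qed
  have "(\<integral>\<omega>. pred_loss W XR YR (Inr i) \<omega> \<partial>MR) - (\<integral>\<omega>. pred_loss W XS YS (Inr i) \<omega> \<partial>MS)
      = (B_ErrR MR C W XR YR i1 - B_ErrS MS C W XS YS i1) + (V_ErrR MR W XR YR i1 - V_ErrS MS W XS YS i1)"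
    for i
    using has_bochner_integral_eq[OF same_noise[OF optR optS R[of i], of i] S[of i]] by simp
  then have "(\<Sum>i\<in>UNIV. (\<integral>\<omega>. pred_loss W XR YR (Inr i) \<omega> \<partial>MR) - (\<integral>\<omega>. pred_loss W XS YS (Inr i) \<omega> \<partial>MS))
      = real CARD('n) * ((B_ErrR MR C W XR YR i1 - B_ErrS MS C W XS YS i1) + (V_ErrR MR W XR YR i1 - V_ErrS MS W XS YS i1))"
    by simp
  then show ?thesis
    by (simp add: Err_def R.test_loss_sum[OF testR] S.test_loss_sum[OF testS] sum_subtractf
        diff_divide_distrib[symmetric])
qed

end

theorem theorem6:
  fixes MR :: "'r measure" and MS :: "'s measure"
    and C :: "('k::finite, 'p::finite) covariate \<Rightarrow> real^'p^'p"
    and W :: "('k, 'p) weight"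
    and \<mu>4 :: real
    and XR :: "'n::finite + 'n \<Rightarrow> 'r \<Rightarrow> ('k, 'p) covariate"
    and YR \<E>R :: "'n + 'n \<Rightarrow> 'r \<Rightarrow> real^'p"
    and XS :: "'n + 'n \<Rightarrow> 's \<Rightarrow> ('k, 'p) covariate"
    and YS \<E>S :: "'n + 'n \<Rightarrow> 's \<Rightarrow> real^'p"
    and i1 :: 'n
  assumes C_meas: "C \<in> borel_measurable borel" and C_posdef: "\<And>x. posdef (C x)"
    and W_meas: "W \<in> borel_measurable borel" and W_psd: "\<And>x. psd (W x)"
    \<comment> \<open>the two settings, with a common joint distribution of (X, Y)\<close>
    and modelR: "data_model MR C \<mu>4 XR YR \<E>R" and randomX: "random_X MR XR YR"
    and modelS: "data_model MS C \<mu>4 XS YS \<E>S" and sameX: "same_X MS XS YS"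
    and same_law: "distr MR borel (\<lambda>\<omega>. (XR (Inl i1) \<omega>, YR (Inl i1) \<omega>)) =
                   distr MS borel (\<lambda>\<omega>. (XS (Inl i1) \<omega>, YS (Inl i1) \<omega>))"
    and invR: "AE \<omega> in MR. invertible (gram W (train XR \<omega>))"
    and invS: "AE \<omega> in MS. invertible (gram W (train XS \<omega>))"
    \<comment> \<open>finiteness of the expectations that occur\<close>
    and "integrable MS (test_loss W XS YS)"
    and "integrable MS (train_loss W XS YS)"
    and "integrable MS (U_stat MS W XS YS)"
    and "integrable MS (sq_bias MS (sigmaS MS XS) C W XS YS (Inl i1))"
    and "integrable MS (tr_var MS (sigmaS MS XS) W XS YS (Inl i1))"
    and "integrable MR (test_loss W XR YR)"
    and "integrable MR (sq_bias MR (sigmaR MR XR i1) C W XR YR (Inr i1))"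
    and "integrable MR (tr_var MR (sigmaR MR XR i1) W XR YR (Inr i1))"
    and "integrable MR (sandwich MR W XR YR)"
    and "integrable MR (\<lambda>\<omega>. gram W (train XR \<omega>))"
    and "integrable MR (\<lambda>\<omega>. trace (sandwich_test MR W XR YR i1 \<omega>))"
  shows
    "(V_ErrS MS W XS YS i1
        = 1 / real CARD('n) * (\<integral>\<omega>. trace (hat_cov MS W XS YS \<omega>) \<partial>MS) \<and>
      1 / real CARD('n) * (\<integral>\<omega>. trace (hat_cov MS W XS YS \<omega>) \<partial>MS)
        = (\<integral>\<omega>. U_stat MS W XS YS \<omega> \<partial>MS) / 2 \<and>
      (\<integral>\<omega>. U_stat MS W XS YS \<omega> \<partial>MS) / 2 = OptS MS W XS YS / 2) \<and>
     (V_ErrR MR W XR YR i1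
        = 1 / real CARD('n) * trace ((\<integral>\<omega>. sandwich MR W XR YR \<omega> \<partial>MR) **
                                     (\<integral>\<omega>. gram W (train XR \<omega>) \<partial>MR)) \<and>
      1 / real CARD('n) * trace ((\<integral>\<omega>. sandwich MR W XR YR \<omega> \<partial>MR) **
                                 (\<integral>\<omega>. gram W (train XR \<omega>) \<partial>MR))
        = (\<integral>\<omega>. trace (sandwich_test MR W XR YR i1 \<omega>) \<partial>MR)) \<and>
     B_ErrR MR C W XR YR i1 - B_ErrS MS C W XS YS i1 \<ge> 0 \<and>
     ((\<forall>\<alpha>. AE \<omega> in MR. W (XR \<alpha> \<omega>) = pinv (V_cov MR XR YR \<alpha> \<omega>)) \<and>
      (\<forall>\<alpha>. AE \<omega> in MS. W (XS \<alpha> \<omega>) = pinv (V_cov MS XS YS \<alpha> \<omega>)) \<longrightarrow>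
        V_ErrR MR W XR YR i1 - V_ErrS MS W XS YS i1 \<ge> 0 \<and>
        Err MR W XR YR \<ge> Err MS W XS YS)"
proof -
  have probR: "prob_space MR" and probS: "prob_space MS"
    using modelR modelS by (simp_all add: data_model_def)
  interpret two_designs MR MS C W \<mu>4 XR YR \<E>R XS YS \<E>S i1
  proof (intro two_designs.intro covariance_model.intro weighted_regression.intro
      covariance_model_axioms.intro two_designs_axioms.intro C_meas C_posdef W_meas W_psd
      probR probS modelR modelS invR invS)
    show "iid MR XR UNIV"
      using iid_compose[OF probR randomX[unfolded random_X_def] measurable_fst_borel] by simp
    show "iid MS (\<lambda>i. XS (Inl i)) UNIV"
      using iid_compose[OF probS conjunct1[OF sameX[unfolded same_X_def]] measurable_fst_borel] by simp
    show "XS (Inr i) \<omega> = XS (Inl i) \<omega>" if "\<omega> \<in> space MS" for i \<omega>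
      using sameX that by (simp add: same_X_def)
    have measR: "(\<lambda>\<omega>. (XR (Inl i1) \<omega>, YR (Inl i1) \<omega>)) \<in> borel_measurable MR"
      using iid_measurable[OF probR randomX[unfolded random_X_def]] by blast
    have measS: "(\<lambda>\<omega>. (XS (Inl i1) \<omega>, YS (Inl i1) \<omega>)) \<in> borel_measurable MS"
      using iid_measurable[OF probS conjunct1[OF sameX[unfolded same_X_def]]] by blast
    have "distr (distr MR borel (\<lambda>\<omega>. (XR (Inl i1) \<omega>, YR (Inl i1) \<omega>))) borel fst
        = distr (distr MS borel (\<lambda>\<omega>. (XS (Inl i1) \<omega>, YS (Inl i1) \<omega>))) borel fst"
      by (simp only: same_law)
    then show "distr MR borel (XR (Inl i1)) = distr MS borel (XS (Inl i1))"
      by (simp add: distr_distr[OF measurable_fst_borel measR] distr_distr[OF measurable_fst_borel measS]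
          comp_def)
  qed
  have VS: "real CARD('n) * V_ErrS MS W XS YS i1 = (\<integral>\<omega>. trace (hat_cov MS W XS YS \<omega>) \<partial>MS)"
    by (rule has_bochner_integral_eq[OF S.same_X_var_sum[OF iidS invS assms(16)]
          S.hat_cov_integral[OF assms(14)]])
  have VR: "real CARD('n) * V_ErrR MR W XR YR i1
      = trace ((\<integral>\<omega>. sandwich MR W XR YR \<omega> \<partial>MR) ** (\<integral>\<omega>. gram W (train XR \<omega>) \<partial>MR))"
    by (rule V_ErrR_eq[OF assms(19-21)])
  have VR': "V_ErrR MR W XR YR i1 = (\<integral>\<omega>. trace (sandwich_test MR W XR YR i1 \<omega>) \<partial>MR)"
    by (rule has_bochner_integral_eq[OF R.random_X_var[OF iidR assms(19)]
          R.sandwich_test_integral[OF invR assms(22)]])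
  have U: "(\<integral>\<omega>. U_stat MS W XS YS \<omega> \<partial>MS) = 2 / real CARD('n) * (\<integral>\<omega>. trace (hat_cov MS W XS YS \<omega>) \<partial>MS)"
    by (simp add: U_stat_def)
  have opt: "V_ErrS MS W XS YS i1 \<le> V_ErrR MR W XR YR i1 \<and> Err MS W XS YS \<le> Err MR W XR YR"
    if "\<forall>\<alpha>. AE \<omega> in MR. W (XR \<alpha> \<omega>) = pinv (V_cov MR XR YR \<alpha> \<omega>)"
      "\<forall>\<alpha>. AE \<omega> in MS. W (XS \<alpha> \<omega>) = pinv (V_cov MS XS YS \<alpha> \<omega>)"
  proof -
    have optR: "AE \<omega> in MR. \<forall>\<alpha>. R.optimal_at (XR \<alpha> \<omega>)" and optS: "AE \<omega> in MS. \<forall>\<alpha>. S.optimal_at (XS \<alpha> \<omega>)"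
      using R.optimal_AE S.optimal_AE that by blast+
    have "V_ErrS MS W XS YS i1 \<le> V_ErrR MR W XR YR i1"
      by (rule variance_gap[OF optR optS assms(19,16,20,21)])
    then show ?thesis
      using error_gap[OF optR optS assms(17,12,18,15,19,16)] bias_gap[OF assms(18,15)] by simp
  qed
  show ?thesis
  proof (intro conjI impI)
    have "real CARD('n) \<noteq> 0" by simp
    then show "V_ErrS MS W XS YS i1 = 1 / real CARD('n) * (\<integral>\<omega>. trace (hat_cov MS W XS YS \<omega>) \<partial>MS)"
      "V_ErrR MR W XR YR i1 = 1 / real CARD('n) * trace ((\<integral>\<omega>. sandwich MR W XR YR \<omega> \<partial>MR) **
                                     (\<integral>\<omega>. gram W (train XR \<omega>) \<partial>MR))"
      by (simp_all add: VS[symmetric] VR[symmetric])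
    show "1 / real CARD('n) * trace ((\<integral>\<omega>. sandwich MR W XR YR \<omega> \<partial>MR) **
                                 (\<integral>\<omega>. gram W (train XR \<omega>) \<partial>MR))
        = (\<integral>\<omega>. trace (sandwich_test MR W XR YR i1 \<omega>) \<partial>MR)"
      by (simp add: VR[symmetric] VR'[symmetric])
    show "1 / real CARD('n) * (\<integral>\<omega>. trace (hat_cov MS W XS YS \<omega>) \<partial>MS)
        = (\<integral>\<omega>. U_stat MS W XS YS \<omega> \<partial>MS) / 2"
      by (simp add: U)
    show "(\<integral>\<omega>. U_stat MS W XS YS \<omega> \<partial>MS) / 2 = OptS MS W XS YS / 2"
      using S.OptS_eq[OF same_X assms(12-14)] by simp
    show "0 \<le> B_ErrR MR C W XR YR i1 - B_ErrS MS C W XS YS i1"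
      using bias_gap[OF assms(18,15)] by simp
  qed (use opt in auto)
qed

end
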